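(* Let $N\ge2$ and fix a sign $\pm$. The map $\mathcal U_{(N,\pm)}\colon\mathcal P_{N\text{-lin}}\to\mathcal P^{\triangle}_{(N-1)\text{-lin}}$ defined in the context is a monoidal unitary functor, i.e. $\mathcal U_{(N,\pm)}p\otimes\mathcal U_{(N,\pm)}q=\mathcal U_{(N,\pm)}(p\otimes q)$, $\mathcal U_{(N,\pm)}q\cdot\mathcal U_{(N,\pm)}p=\mathcal U_{(N,\pm)}(qp)$ whenever $p$ and $q$ are composable, and $(\mathcal U_{(N,\pm)}p)^*=\mathcal U_{(N,\pm)}p^*$. Moreover $$T_{\mathcal U_{(N,\pm)}p}=U_{(N,\pm)}^{\otimes l}\,T_p\,U_{(N,\pm)}^{*\,\otimes k}$$ for any $p\in\mathcal P_{N\text{-lin}}(k,l)$, $k,l\in\mathbb N_0$. Consequently, if $\mathcal K\subseteq\mathcal P_{N\text{-lin}}$ is a linear category of partitions containing $\sigma\otimes\sigma$ and $G=(C(G),u)$ is the corresponding quantum group, then the linear category with extra singletons $\mathcal U_{(N,\pm)}\mathcal K$ corresponds to the quantum group $\tilde G:=U_{(N,\pm)}GU_{(N,\pm)}^*=(C(G),U_{(N,\pm)}uU_{(N,\pm)}^* )$.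
   Context: Partitions and linear categories. $\mathcal P(k,l)$ is the set of set partitions of $k$ upper and $l$ lower points. $\mathcal P_{N\text{-lin}}(k,l)$ is the complex vector space with basis $\mathcal P(k,l)$. Tensor product: juxtaposition, extended bilinearly. Composition of $p\in\mathcal P(k,l)$, $q\in\mathcal P(l,m)$: stack $q$ below $p$, identifying the middle rows, remove the components touching neither outer row, and multiply the resulting partition by $N^{\mathrm{rl}(p,q)}$, $\mathrm{rl}(p,q)$ being the number of removed components; extend bilinearly. Involution $*$: exchange rows, extended antilinearly. A linear category of partitions is a collection of linear subspaces $\mathcal K(k,l)\subseteq\mathcal P_{N\text{-lin}}(k,l)$ closed under tensor product, composition and involution and containing the identity partition $\mathrm{id}\in\mathcal P(1,1)$ (one block) and the pair partition in $\mathcal P(0,2)$ (one block). $\sigma\in\mathcal P(0,1)$ is the singleton; $\sigma^*\in\mathcal P(1,0)$. Maps: $T_p\colon(\mathbb C^N)^{\otimes k}\to(\mathbb C^N)^{\otimes l}$, $T_p(e_{i_1}\otimes\cdots\otimes e_{i_k})=\sum_{j_1,\dots,j_l}\delta_p(\mathbf i,\mathbf j)\,e_{j_1}\otimes\cdots\otimes e_{j_l}$, where $\delta_p(\mathbf i,\mathbf j)=1$ if points of the same block of $p$ carry equal indices and $0$ otherwise; extended linearly. $\mathcal K$ corresponds to the compact matrix quantum group $G=(C(G),u)$, where $C(G)$ is the universal C*-algebra generated by $u_{ij}$, $1\le i,j\le N$, with $u_{ij}=u_{ij}^*$ and $T_pu^{\otimes k}=u^{\otimes l}T_p$ for all $p\in\mathcal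 K(k,l)$. Extra singletons. A partition with extra singletons is a partition with points colored $\ell$ or $\triangle$, all $\triangle$-points being blocks of size one; $\mathcal P^\triangle(w_1,w_2)$ is the set of those with upper/lower color patterns $w_1,w_2$ (words over $\{\ell,\triangle\}$), and $\mathcal P^\triangle_{(N-1)\text{-lin}}(w_1,w_2)$ its linear span. The operations on these spaces are: tensor product (juxtaposition, extended bilinearly); composition $qp$, defined only when the lower color pattern of $p$ equals the upper color pattern of $q$ (stack $q$ below $p$, identifying the middle rows, remove the components touching neither outer row, and multiply the resulting partition by a factor $N-1$ for each removed component of color $\ell$ and a factor $1$ for each removed component of color $\triangle$; extended bilinearly); involution $*$ (exchange rows, extended antilinearly). For $p\in\mathcal P^\triangle(w_1,w_2)$, let $k'$, $l'$ be the numbers of upper, resp. lower, points of color $\ell$, and let $p'\in\mathcal P(k',l')$ be the partition obtained from $p$ by deleting the $\triangle$-points; then $T_p\colon(\mathbb C^{N-1})^{\otimes k'}\to(\mathbb C^{N-1})^{\otimes l'}$ is defined by $T_p(e_{i_1}\otimes\cdots\otimes e_{i_{k'}})=\sum_{j_1,\dots,j_{l'}=1}^{N-1}\delta_{p'}(\mathbf i,\mathbf j)\,e_{j_1}\otimes\cdots\otimes e_{j_{l'}}$, extended linearly. Via $\mathbb C^N=\mathbb C^{N-1}\oplus\mathbb Ce_N$ it is regarded as a map $(\mathbb C^N)^{\otimes|w_1|}\to(\mathbb C^N)^{\otimes|w_2|}$: tensor factors with color $\ell$ correspond to the summand $\mathbb C^{N-1}=\mathrm{span}\{e_1,\dots,e_{N-1}\}$,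 those with color $\triangle$ to $\mathbb Ce_N$, and it is extended by zero on the complementary summands. A linear category with extra singletons is a collection of linear subspaces of the spaces $\mathcal P^\triangle_{(N-1)\text{-lin}}(w_1,w_2)$ closed under tensor product, composition and involution and containing the identities on $\ell$ and on $\triangle$, the $\ell$-pair with two lower points, and two lower $\triangle$-points. It corresponds to the quantum group with fundamental representation $v\oplus r$ ($v$ of size $N-1$, $r$ of size $1$) whose C*-algebra is universal, generated by self-adjoint $v_{ij},r$ with relations $T_pu^{\otimes w_1}=u^{\otimes w_2}T_p$ for all $p$ in the category, where $u^{\ell}=v$, $u^\triangle=r$ and $u^{\otimes a_1\cdots a_k}=u^{a_1}\otimes\cdots\otimes u^{a_k}$. The matrix $U_{(N,\pm)}\in M_N(\mathbb C)$ (orthogonal): for $1\le i,j\le N-1$, $[U]_{ij}=\delta_{ij}-\frac1{N-1}\bigl(1\pm\frac1{\sqrt N}\bigr)$ and $[U]_{iN}=\pm\frac1{\sqrt N}$; $[U]_{Nj}=\frac1{\sqrt N}$ for all $1\le j\le N$. Dotted partitions. Put $\pi^{\downarrow}:=\frac1N\sigma\sigma^*$ and $\pi^{\cdot}:=\mathrm{id}-\frac1N\sigma\sigma^*$ in $\mathcal P_{N\text{-lin}}(1,1)$, and for a word $w=a_1\cdots a_k$ over $\{\cdot,\downarrow\}$ let $\pi^{\otimes w}=\pi^{a_1}\otimes\cdots\otimes\pi^{a_k}$. $\mathcal P_{N\text{-lin}}$ is regarded as a category whose objects are words over $\{\cdot,\downarrow\}$, with morphism spaces $\mathcal P_{N\text{-lin}}(w_1,w_2)=\{p\in\mathcal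 P_{N\text{-lin}}(|w_1|,|w_2|)\mid p=\pi^{\otimes w_2}p\,\pi^{\otimes w_1}\}$; then $\mathcal P_{N\text{-lin}}(k,l)=\bigoplus_{|w_1|=k,|w_2|=l}\mathcal P_{N\text{-lin}}(w_1,w_2)$, and likewise for any linear category $\mathcal K\ni\sigma\otimes\sigma$ (with $\mathcal K(w_1,w_2)=\mathcal K\cap\mathcal P_{N\text{-lin}}(w_1,w_2)$). For $p\in\mathcal P(k,l)$ let $w_1,w_2$ have the letter $\downarrow$ exactly at the positions of singleton blocks of $p$ in the upper, resp. lower, row, and the letter $\cdot$ elsewhere; put $\dot p:=\pi^{\otimes w_2}p\,\pi^{\otimes w_1}$. The elements $\dot p$ form a basis of $\mathcal P_{N\text{-lin}}(k,l)$, and those with fixed $w_1,w_2$ form a basis of $\mathcal P_{N\text{-lin}}(w_1,w_2)$. The map $\mathcal U_{(N,\pm)}$. On objects: $\cdot\mapsto\ell$, $\downarrow\mapsto\triangle$ letterwise. On morphisms it is linear and defined on the basis elements $\dot p$ blockwise: each singleton block of $p$ is replaced by $\sqrt N$ times an extra singleton at the same position; each block of $p$ with $m\ge2$ points (upper and lower points alike) is replaced by the linear combination of partitions of these $m$ points (all of color $\ell$) $$\sum_{\emptyset\ne S}(-c)^{m-|S|}\,b_S+\Bigl((N-1)(-c)^m+\bigl(\pm\tfrac1{\sqrt N}\bigr)^m\Bigr)\,b_\emptyset,\qquad c=\tfrac1{N-1}\bigl(1\pm\tfrac1{\sqrt N}\bigr),$$ where $S$ runs over the non-empty subsets of the $m$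 points, $b_S$ is the partition in which $S$ is one block and all other points are singletons of color $\ell$, and $b_\emptyset$ is the partition into $m$ singletons of color $\ell$; the result is expanded multilinearly over the blocks of $p$. $\mathcal U_{(N,\pm)}\mathcal K$ is the collection of the images $\mathcal U_{(N,\pm)}(\mathcal K(w_1,w_2))$. For $p\in\mathcal P_{N\text{-lin}}(k,l)$ not lying in a single $\mathcal P_{N\text{-lin}}(w_1,w_2)$, $T_{\mathcal U_{(N,\pm)}p}$ denotes the sum of the maps $T_{\mathcal U_{(N,\pm)}p'}$ over the components $p'$ of $p$ in the direct sum decomposition $\mathcal P_{N\text{-lin}}(k,l)=\bigoplus_{|w_1|=k,|w_2|=l}\mathcal P_{N\text{-lin}}(w_1,w_2)$. *)

theory Defs
  imports
    Complex_Main
    "HOL-Library.Poly_Mapping"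
    "HOL-Library.Disjoint_Sets"
    "HOL-Algebra.Ring"
begin

section \<open>Set partitions and formal linear combinations\<close>

text \<open>
  The upper points of a partition are \<open>Inl 0, Inl 1, \<dots>\<close>, the lower ones
  \<open>Inr 0, Inr 1, \<dots>\<close>, both counted from the left; a partition is the set of its blocks.
  Since the union of the blocks determines \<open>k\<close> and \<open>l\<close>, the sets \<open>parts k l\<close> are pairwise disjoint.
\<close>

type_synonym point = "nat + nat"
type_synonym part = "point set set"
type_synonym lpart = "part \<Rightarrow>\<^sub>0 complex"

definition points :: "nat \<Rightarrow> nat \<Rightarrow> point set"
  where "points k l = Inl ` {..<k} \<union> Inr ` {..<l}"

definition parts :: "nat \<Rightarrow> nat \<Rightarrow> part set"
  where "parts k l = {p. partition_on (points k l) p}"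

definition all_parts :: "part set"
  where "all_parts = (\<Union>k l. parts k l)"

definition pscale :: "complex \<Rightarrow> lpart \<Rightarrow> lpart"
  where "pscale c = Poly_Mapping.map ((*) c)"

lemma lookup_pscale [simp]: "Poly_Mapping.lookup (pscale c f) p = c * Poly_Mapping.lookup f p"
  by (simp add: pscale_def Poly_Mapping.map.rep_eq when_def)

interpretation plin: Vector_Spaces.vector_space pscale
  by unfold_locales (auto intro!: poly_mapping_eqI simp: lookup_add algebra_simps)

interpretation plin2: Vector_Spaces.vector_space_pair pscale pscale ..

definition basis_elt :: "part \<Rightarrow> lpart"
  where "basis_elt p = Poly_Mapping.single p 1"

definition lparts :: "nat \<Rightarrow> nat \<Rightarrow> lpart set"
  where "lparts k l = {f. Poly_Mapping.keys f \<subseteq> parts k l}"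

definition bilinear_ext :: "(part \<Rightarrow> part \<Rightarrow> lpart) \<Rightarrow> lpart \<Rightarrow> lpart \<Rightarrow> lpart"
  where "bilinear_ext h f g =
    (\<Sum>p\<in>Poly_Mapping.keys f. \<Sum>q\<in>Poly_Mapping.keys g.
       pscale (Poly_Mapping.lookup f p * Poly_Mapping.lookup g q) (h p q))"

definition n_up :: "part \<Rightarrow> nat" where "n_up p = card (Inl -` \<Union>p)"
definition n_low :: "part \<Rightarrow> nat" where "n_low p = card (Inr -` \<Union>p)"

definition ptensor :: "part \<Rightarrow> part \<Rightarrow> part"
  where "ptensor p q = p \<union> (\<lambda>B. map_sum ((+) (n_up p)) ((+) (n_low p)) ` B) ` q"

definition ltensor :: "lpart \<Rightarrow> lpart \<Rightarrow> lpart"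
  where "ltensor = bilinear_ext (\<lambda>p q. basis_elt (ptensor p q))"

definition pinv :: "part \<Rightarrow> part"
  where "pinv p = (\<lambda>B. case_sum Inr Inl ` B) ` p"

definition linv :: "lpart \<Rightarrow> lpart"
  where "linv f = (\<Sum>p\<in>Poly_Mapping.keys f.
    pscale (cnj (Poly_Mapping.lookup f p)) (basis_elt (pinv p)))"


text \<open>
  Stacking \<open>q\<close> below \<open>p\<close> gives three rows of points: \<open>Inl i\<close> (upper), \<open>Inr (Inl j)\<close>
  (middle, shared by \<open>p\<close> and \<open>q\<close>) and \<open>Inr (Inr t)\<close> (lower).
\<close>

type_synonym point3 = "nat + nat + nat"

definition stack :: "part \<Rightarrow> part \<Rightarrow> point3 set set"
  where "stack q p = (\<lambda>B. map_sum id Inl ` B) ` p \<union> (\<lambda>B. Inr ` B) ` q"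

definition components :: "part \<Rightarrow> part \<Rightarrow> point3 set set"
  where "components q p =
    \<Union>(stack q p) // {(x, y). \<exists>B\<in>stack q p. x \<in> B \<and> y \<in> B}\<^sup>*"

definition outer :: "point \<Rightarrow> point3"
  where "outer = map_sum id Inr"

definition removed :: "part \<Rightarrow> part \<Rightarrow> point3 set set"
  where "removed q p = {C \<in> components q p. outer -` C = {}}"

definition pcomp :: "part \<Rightarrow> part \<Rightarrow> part"
  where "pcomp q p = (\<lambda>C. outer -` C) ` (components q p - removed q p)"

definition lcomp :: "nat \<Rightarrow> lpart \<Rightarrow> lpart \<Rightarrow> lpart"
  where "lcomp N = bilinear_ext (\<lambda>q p.
    pscale (of_nat N ^ card (removed q p)) (basis_elt (pcomp q p)))"

definition id_part :: part where "id_part = {{Inl 0, Inr 0}}"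
definition pair_part :: part where "pair_part = {{Inr 0, Inr 1}}"
definition singleton_part :: part where "singleton_part = {{Inr 0}}"

definition linear_category :: "nat \<Rightarrow> (nat \<Rightarrow> nat \<Rightarrow> lpart set) \<Rightarrow> bool"
  where "linear_category N K \<longleftrightarrow>
    (\<forall>k l. K k l \<subseteq> lparts k l \<and> plin.subspace (K k l)) \<and>
    (\<forall>k l k' l'. \<forall>f\<in>K k l. \<forall>g\<in>K k' l'. ltensor f g \<in> K (k + k') (l + l')) \<and>
    (\<forall>k l m. \<forall>f\<in>K k l. \<forall>g\<in>K l m. lcomp N g f \<in> K k m) \<and>
    (\<forall>k l. \<forall>f\<in>K k l. linv f \<in> K l k) \<and>
    basis_elt id_part \<in> K 1 1 \<and> basis_elt pair_part \<in> K 0 2"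

definition lsigma :: lpart where "lsigma = basis_elt singleton_part"


section \<open>Partitions with extra singletons\<close>

datatype color = Ell | Tri

definition color_of :: "color list \<Rightarrow> color list \<Rightarrow> point \<Rightarrow> color"
  where "color_of w1 w2 x = (case x of Inl i \<Rightarrow> w1 ! i | Inr j \<Rightarrow> w2 ! j)"

definition tri_points :: "color list \<Rightarrow> color list \<Rightarrow> point set"
  where "tri_points w1 w2 = {x \<in> points (length w1) (length w2). color_of w1 w2 x = Tri}"

text \<open>
  The colors are not recorded in the partition itself: they are given by the words indexing the
  space. Tensor product and involution are those of uncolored partitions.
\<close>

definition tparts :: "color list \<Rightarrow> color list \<Rightarrow> part set"
  where "tparts w1 w2 =
    {p \<in> parts (length w1) (length w2). \<forall>x\<in>tri_points w1 w2. {x} \<in> p}"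

definition ltparts :: "color list \<Rightarrow> color list \<Rightarrow> lpart set"
  where "ltparts w1 w2 = {f. Poly_Mapping.keys f \<subseteq> tparts w1 w2}"

text \<open>
  A removed component consists of middle points only, all of the same color, so for a middle row
  with color pattern \<open>w\<close> it has color \<open>\<triangle>\<close> iff it contains a point of that color.
\<close>

definition removed_factor :: "nat \<Rightarrow> color list \<Rightarrow> point3 set \<Rightarrow> complex"
  where "removed_factor N w C = (if \<exists>j. Inr (Inl j) \<in> C \<and> w ! j = Tri then 1 else of_nat N - 1)"

definition tcomp :: "nat \<Rightarrow> color list \<Rightarrow> lpart \<Rightarrow> lpart \<Rightarrow> lpart"
  where "tcomp N w = bilinear_ext (\<lambda>q p.
    pscale (\<Prod>C\<in>removed q p. removed_factor N w C) (basis_elt (pcomp q p)))"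

fun id_color :: "color \<Rightarrow> lpart"
  where
    "id_color Ell = basis_elt {{Inl 0, Inr 0}}"
  | "id_color Tri = basis_elt {{Inl 0}, {Inr 0}}"

fun id_word :: "color list \<Rightarrow> lpart"
  where
    "id_word [] = basis_elt {}"
  | "id_word (a # w) = ltensor (id_color a) (id_word w)"

definition tri_linear_category :: "nat \<Rightarrow> (color list \<Rightarrow> color list \<Rightarrow> lpart set) \<Rightarrow> bool"
  where "tri_linear_category N L \<longleftrightarrow>
    (\<forall>w1 w2. L w1 w2 \<subseteq> ltparts w1 w2 \<and> plin.subspace (L w1 w2)) \<and>
    (\<forall>w1 w2 w1' w2'. \<forall>f\<in>L w1 w2. \<forall>g\<in>L w1' w2'. ltensor f g \<in> L (w1 @ w1') (w2 @ w2')) \<and>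
    (\<forall>w1 w2 w3. \<forall>f\<in>L w1 w2. \<forall>g\<in>L w2 w3. tcomp N w2 g f \<in> L w1 w3) \<and>
    (\<forall>w1 w2. \<forall>f\<in>L w1 w2. linv f \<in> L w2 w1) \<and>
    id_color Ell \<in> L [Ell] [Ell] \<and> id_color Tri \<in> L [Tri] [Tri] \<and>
    basis_elt {{Inr 0, Inr 1}} \<in> L [] [Ell, Ell] \<and>
    basis_elt {{Inr 0}, {Inr 1}} \<in> L [] [Tri, Tri]"


section \<open>The associated linear maps\<close>

text \<open>
  The standard basis vectors \<open>e\<^sub>1, \<dots>, e\<^sub>N\<close> are indexed by \<open>0, \<dots>, N - 1\<close>; in particular \<open>e\<^sub>N\<close> has
  index \<open>N - 1\<close>. The standard basis of \<open>(\<complex>\<^sup>N)\<^sup>\<otimes>\<^sup>k\<close> is indexed by \<open>multi_idx N k\<close>, and a linear map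
  \<open>(\<complex>\<^sup>N)\<^sup>\<otimes>\<^sup>k \<rightarrow> (\<complex>\<^sup>N)\<^sup>\<otimes>\<^sup>l\<close> is given by its matrix, the row (output) index coming first.
\<close>

definition multi_idx :: "nat \<Rightarrow> nat \<Rightarrow> nat list set"
  where "multi_idx N k = {i. length i = k \<and> set i \<subseteq> {..<N}}"

definition label :: "nat list \<Rightarrow> nat list \<Rightarrow> point \<Rightarrow> nat"
  where "label i j x = (case x of Inl a \<Rightarrow> i ! a | Inr b \<Rightarrow> j ! b)"

definition delta :: "part \<Rightarrow> nat list \<Rightarrow> nat list \<Rightarrow> complex"
  where "delta p i j = of_bool (\<forall>B\<in>p. \<forall>x\<in>B. \<forall>y\<in>B. label i j x = label i j y)"

definition T_map :: "lpart \<Rightarrow> nat list \<Rightarrow> nat list \<Rightarrow> complex"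
  where "T_map f j i = (\<Sum>p\<in>Poly_Mapping.keys f. Poly_Mapping.lookup f p * delta p i j)"

definition delete_points :: "point set \<Rightarrow> part \<Rightarrow> part"
  where "delete_points X p = (\<lambda>B. B - X) ` p - {{}}"

text \<open>
  \<open>word_idx N w\<close> indexes the basis of the subspace of \<open>(\<complex>\<^sup>N)\<^sup>\<otimes>\<^sup>|\<^sup>w\<^sup>|\<close> whose factors of color \<open>\<ell>\<close> are
  \<open>\<complex>\<^sup>N\<^sup>-\<^sup>1\<close> and whose factors of color \<open>\<triangle>\<close> are spanned by \<open>e\<^sub>N\<close>. In \<open>tT_map\<close> the points of color \<open>\<ell>\<close>
  keep their positions after the deletion of the others instead of being renumbered; the matrix
  is that of the extension by zero.
\<close>

definition color_idx :: "nat \<Rightarrow> color \<Rightarrow> nat set"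
  where "color_idx N a = (case a of Ell \<Rightarrow> {..<N - 1} | Tri \<Rightarrow> {N - 1})"

definition word_idx :: "nat \<Rightarrow> color list \<Rightarrow> nat list set"
  where "word_idx N w = {i. length i = length w \<and> (\<forall>n<length w. i ! n \<in> color_idx N (w ! n))}"

definition tT_map ::
  "nat \<Rightarrow> color list \<Rightarrow> color list \<Rightarrow> lpart \<Rightarrow> nat list \<Rightarrow> nat list \<Rightarrow> complex"
  where "tT_map N w1 w2 f j i =
    (if i \<in> word_idx N w1 \<and> j \<in> word_idx N w2
     then \<Sum>p\<in>Poly_Mapping.keys f.
       Poly_Mapping.lookup f p * delta (delete_points (tri_points w1 w2) p) i j
     else 0)"

text \<open>In the following, \<open>s\<close> is the sign, \<open>1\<close> or \<open>- 1\<close>.\<close>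

definition U_const :: "nat \<Rightarrow> real \<Rightarrow> real"
  where "U_const N s = 1 / (real N - 1) * (1 + s / sqrt (real N))"

definition U_mat :: "nat \<Rightarrow> real \<Rightarrow> nat \<Rightarrow> nat \<Rightarrow> complex"
  where "U_mat N s i j =
    (if i = N - 1 then complex_of_real (1 / sqrt (real N))
     else if j = N - 1 then complex_of_real (s / sqrt (real N))
     else of_bool (i = j) - complex_of_real (U_const N s))"

definition tensor_power :: "(nat \<Rightarrow> nat \<Rightarrow> complex) \<Rightarrow> nat \<Rightarrow> nat list \<Rightarrow> nat list \<Rightarrow> complex"
  where "tensor_power M k i j = (\<Prod>n<k. M (i ! n) (j ! n))"

definition adjoint_mat :: "('i \<Rightarrow> 'j \<Rightarrow> complex) \<Rightarrow> 'j \<Rightarrow> 'i \<Rightarrow> complex"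
  where "adjoint_mat M i j = cnj (M j i)"

definition mat_prod :: "'j set \<Rightarrow> ('i \<Rightarrow> 'j \<Rightarrow> complex) \<Rightarrow> ('j \<Rightarrow> 'k \<Rightarrow> complex) \<Rightarrow> 'i \<Rightarrow> 'k \<Rightarrow> complex"
  where "mat_prod J M M' i k = (\<Sum>j\<in>J. M i j * M' j k)"


section \<open>Dotted partitions\<close>

datatype letter = Dot | Down

fun pi_letter :: "nat \<Rightarrow> letter \<Rightarrow> lpart"
  where
    "pi_letter N Down = pscale (1 / of_nat N) (lcomp N lsigma (linv lsigma))"
  | "pi_letter N Dot = basis_elt id_part - pscale (1 / of_nat N) (lcomp N lsigma (linv lsigma))"

fun pi_word :: "nat \<Rightarrow> letter list \<Rightarrow> lpart"
  where
    "pi_word N [] = basis_elt {}"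
  | "pi_word N (a # w) = ltensor (pi_letter N a) (pi_word N w)"

definition corner :: "nat \<Rightarrow> letter list \<Rightarrow> letter list \<Rightarrow> lpart \<Rightarrow> lpart"
  where "corner N w1 w2 f = lcomp N (pi_word N w2) (lcomp N f (pi_word N w1))"

definition dhom :: "nat \<Rightarrow> letter list \<Rightarrow> letter list \<Rightarrow> lpart set"
  where "dhom N w1 w2 = {f \<in> lparts (length w1) (length w2). f = corner N w1 w2 f}"

definition up_word :: "part \<Rightarrow> letter list"
  where "up_word p = map (\<lambda>i. if {Inl i} \<in> p then Down else Dot) [0..<n_up p]"

definition low_word :: "part \<Rightarrow> letter list"
  where "low_word p = map (\<lambda>j. if {Inr j} \<in> p then Down else Dot) [0..<n_low p]"

definition dotted :: "nat \<Rightarrow> part \<Rightarrow> lpart"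
  where "dotted N p = corner N (up_word p) (low_word p) (basis_elt p)"


section \<open>The functor\<close>

fun U_obj :: "letter \<Rightarrow> color"
  where "U_obj Dot = Ell" | "U_obj Down = Tri"

definition one_block :: "point set \<Rightarrow> point set \<Rightarrow> part"
  where "one_block B S = (if S = {} then {} else {S}) \<union> (\<lambda>x. {x}) ` (B - S)"

definition U_block :: "nat \<Rightarrow> real \<Rightarrow> point set \<Rightarrow> lpart"
  where "U_block N s B =
    (let m = card B; c = U_const N s in
     if m = 1 then pscale (complex_of_real (sqrt (real N))) (basis_elt {B})
     else (\<Sum>S\<in>Pow B - {{}}. pscale (complex_of_real ((- c) ^ (m - card S))) (basis_elt (one_block B S)))
        + pscale (complex_of_real ((real N - 1) * (- c) ^ m + (s / sqrt (real N)) ^ m))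
            (basis_elt (one_block B {})))"

text \<open>Multilinear expansion over the blocks: \<open>g\<close> chooses one term of each \<open>U_block N s B\<close>.\<close>

definition U_dotted :: "nat \<Rightarrow> real \<Rightarrow> part \<Rightarrow> lpart"
  where "U_dotted N s p =
    (\<Sum>g\<in>(\<Pi>\<^sub>E B\<in>p. Poly_Mapping.keys (U_block N s B)).
       pscale (\<Prod>B\<in>p. Poly_Mapping.lookup (U_block N s B) (g B)) (basis_elt (\<Union>B\<in>p. g B)))"

text \<open>
  The linear map with value \<open>U_dotted N s p\<close> on the element \<open>dotted N p\<close> of the basis of all dotted
  partitions.
\<close>

definition U_map :: "nat \<Rightarrow> real \<Rightarrow> lpart \<Rightarrow> lpart"
  where "U_map N s = plin2.construct (dotted N ` all_parts)
    (\<lambda>f. U_dotted N s (the_inv_into all_parts (dotted N) f))"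

definition monoidal_unitary_functor :: "nat \<Rightarrow> (letter \<Rightarrow> color) \<Rightarrow> (lpart \<Rightarrow> lpart) \<Rightarrow> bool"
  where "monoidal_unitary_functor N Fo F \<longleftrightarrow>
    (\<forall>w1 w2. \<forall>f\<in>dhom N w1 w2. F f \<in> ltparts (map Fo w1) (map Fo w2)) \<and>
    (\<forall>w. F (pi_word N w) = id_word (map Fo w)) \<and>
    (\<forall>w1 w2 w1' w2'. \<forall>p\<in>dhom N w1 w2. \<forall>q\<in>dhom N w1' w2'.
       ltensor (F p) (F q) = F (ltensor p q)) \<and>
    (\<forall>w1 w2 w3. \<forall>p\<in>dhom N w1 w2. \<forall>q\<in>dhom N w2 w3.
       tcomp N (map Fo w2) (F q) (F p) = F (lcomp N q p)) \<and>
    (\<forall>w1 w2. \<forall>p\<in>dhom N w1 w2. linv (F p) = F (linv p))"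

definition U_cat ::
  "nat \<Rightarrow> real \<Rightarrow> (nat \<Rightarrow> nat \<Rightarrow> lpart set) \<Rightarrow> color list \<Rightarrow> color list \<Rightarrow> lpart set"
  where "U_cat N s K v1 v2 =
    {U_map N s p | p w1 w2. map U_obj w1 = v1 \<and> map U_obj w2 = v2 \<and>
       p \<in> K (length w1) (length w2) \<inter> dhom N w1 w2}"

text \<open>
  The matrix of \<open>T\<close> applied to the image of \<open>p\<close>, for \<open>p\<close> in \<open>lparts k l\<close>: the component of \<open>p\<close> in
  \<open>dhom N w1 w2\<close> is \<open>corner N w1 w2 p\<close>, as the \<open>pi_word N w\<close> with \<open>w\<close> of length \<open>k\<close> are pairwise
  orthogonal projections with sum the identity.
\<close>

definition T_U_map :: "nat \<Rightarrow> real \<Rightarrow> nat \<Rightarrow> nat \<Rightarrow> lpart \<Rightarrow> nat list \<Rightarrow> nat list \<Rightarrow> complex"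
  where "T_U_map N s k l p j i =
    (\<Sum>w1\<in>{w. length w = k}. \<Sum>w2\<in>{w. length w = l}.
       tT_map N (map U_obj w1) (map U_obj w2) (U_map N s (corner N w1 w2 p)) j i)"


section \<open>Unital C*-algebras\<close>

record 'a cstar = "'a ring" +
  cscale :: "complex \<Rightarrow> 'a \<Rightarrow> 'a"
  cadj :: "'a \<Rightarrow> 'a"
  cnorm :: "'a \<Rightarrow> real"

locale cstar_algebra = ring A for A :: "'a cstar" (structure) +
  assumes scale_closed: "x \<in> carrier A \<Longrightarrow> cscale A a x \<in> carrier A"
    and scale_add: "\<lbrakk>x \<in> carrier A; y \<in> carrier A\<rbrakk> \<Longrightarrow>
      cscale A a (x \<oplus> y) = cscale A a x \<oplus> cscale A a y"
    and add_scale: "x \<in> carrier A \<Longrightarrow> cscale A (a + b) x = cscale A a x \<oplus> cscale A b x"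
    and scale_scale: "x \<in> carrier A \<Longrightarrow> cscale A a (cscale A b x) = cscale A (a * b) x"
    and scale_one: "x \<in> carrier A \<Longrightarrow> cscale A 1 x = x"
    and scale_mult_left: "\<lbrakk>x \<in> carrier A; y \<in> carrier A\<rbrakk> \<Longrightarrow>
      cscale A a x \<otimes> y = cscale A a (x \<otimes> y)"
    and scale_mult_right: "\<lbrakk>x \<in> carrier A; y \<in> carrier A\<rbrakk> \<Longrightarrow>
      x \<otimes> cscale A a y = cscale A a (x \<otimes> y)"
    and adj_closed: "x \<in> carrier A \<Longrightarrow> cadj A x \<in> carrier A"
    and adj_adj: "x \<in> carrier A \<Longrightarrow> cadj A (cadj A x) = x"
    and adj_add: "\<lbrakk>x \<in> carrier A; y \<in> carrier A\<rbrakk> \<Longrightarrow> cadj A (x \<oplus> y) = cadj A x \<oplus> cadj A y"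
    and adj_scale: "x \<in> carrier A \<Longrightarrow> cadj A (cscale A a x) = cscale A (cnj a) (cadj A x)"
    and adj_mult: "\<lbrakk>x \<in> carrier A; y \<in> carrier A\<rbrakk> \<Longrightarrow> cadj A (x \<otimes> y) = cadj A y \<otimes> cadj A x"
    and norm_nonneg: "x \<in> carrier A \<Longrightarrow> 0 \<le> cnorm A x"
    and norm_eq_zero: "x \<in> carrier A \<Longrightarrow> cnorm A x = 0 \<longleftrightarrow> x = \<zero>"
    and norm_triangle: "\<lbrakk>x \<in> carrier A; y \<in> carrier A\<rbrakk> \<Longrightarrow> cnorm A (x \<oplus> y) \<le> cnorm A x + cnorm A y"
    and norm_scale: "x \<in> carrier A \<Longrightarrow> cnorm A (cscale A a x) = cmod a * cnorm A x"
    and norm_mult: "\<lbrakk>x \<in> carrier A; y \<in> carrier A\<rbrakk> \<Longrightarrow> cnorm A (x \<otimes> y) \<le> cnorm A x * cnorm A y"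
    and norm_cstar: "x \<in> carrier A \<Longrightarrow> cnorm A (cadj A x \<otimes> x) = (cnorm A x)\<^sup>2"
    and complete: "\<lbrakk>\<And>n. X n \<in> carrier A;
        \<And>e. 0 < e \<Longrightarrow> \<exists>M. \<forall>m\<ge>M. \<forall>n\<ge>M. cnorm A (X m \<ominus> X n) < e\<rbrakk> \<Longrightarrow>
      \<exists>x\<in>carrier A. (\<lambda>n. cnorm A (X n \<ominus> x)) \<longlonglongrightarrow> 0"

definition cstar_subalgebra :: "'a cstar \<Rightarrow> 'a set \<Rightarrow> bool"
  where "cstar_subalgebra A S \<longleftrightarrow>
    S \<subseteq> carrier A \<and> \<one>\<^bsub>A\<^esub> \<in> S \<and>
    (\<forall>x\<in>S. \<forall>y\<in>S. x \<oplus>\<^bsub>A\<^esub> y \<in> S \<and> x \<otimes>\<^bsub>A\<^esub> y \<in> S) \<and>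
    (\<forall>x\<in>S. cadj A x \<in> S \<and> (\<forall>a. cscale A a x \<in> S)) \<and>
    (\<forall>X x. (\<forall>n. X n \<in> S) \<longrightarrow> x \<in> carrier A \<longrightarrow> (\<lambda>n. cnorm A (X n \<ominus>\<^bsub>A\<^esub> x)) \<longlonglongrightarrow> 0 \<longrightarrow> x \<in> S)"

definition cstar_generated :: "'a cstar \<Rightarrow> 'a set \<Rightarrow> bool"
  where "cstar_generated A G \<longleftrightarrow>
    G \<subseteq> carrier A \<and> (\<forall>S. cstar_subalgebra A S \<longrightarrow> G \<subseteq> S \<longrightarrow> S = carrier A)"

definition star_hom :: "'a cstar \<Rightarrow> 'b cstar \<Rightarrow> ('a \<Rightarrow> 'b) set"
  where "star_hom A B = {\<phi> \<in> ring_hom A B. \<forall>x\<in>carrier A.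
    (\<forall>a. \<phi> (cscale A a x) = cscale B a (\<phi> x)) \<and> \<phi> (cadj A x) = cadj B (\<phi> x)}"


section \<open>The associated quantum groups\<close>

text \<open>
  \<open>intertwines A I J T X Y\<close> says \<open>T X = Y T\<close> for a scalar matrix \<open>T\<close> (rows \<open>J\<close>, columns \<open>I\<close>) and
  square matrices \<open>X\<close> (over \<open>I\<close>) and \<open>Y\<close> (over \<open>J\<close>) with entries in \<open>A\<close>.
\<close>

definition intertwines :: "'a cstar \<Rightarrow> 'i set \<Rightarrow> 'j set \<Rightarrow> ('j \<Rightarrow> 'i \<Rightarrow> complex) \<Rightarrow>
    ('i \<Rightarrow> 'i \<Rightarrow> 'a) \<Rightarrow> ('j \<Rightarrow> 'j \<Rightarrow> 'a) \<Rightarrow> bool"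
  where "intertwines A I J T X Y \<longleftrightarrow>
    (\<forall>j\<in>J. \<forall>i\<in>I. (\<Oplus>\<^bsub>A\<^esub>i'\<in>I. cscale A (T j i') (X i' i)) = (\<Oplus>\<^bsub>A\<^esub>j'\<in>J. cscale A (T j' i) (Y j j')))"

definition list_prod :: "'a cstar \<Rightarrow> 'a list \<Rightarrow> 'a"
  where "list_prod A xs = foldr (\<lambda>x y. x \<otimes>\<^bsub>A\<^esub> y) xs \<one>\<^bsub>A\<^esub>"

definition rep_power :: "'a cstar \<Rightarrow> (nat \<Rightarrow> nat \<Rightarrow> 'a) \<Rightarrow> nat \<Rightarrow> nat list \<Rightarrow> nat list \<Rightarrow> 'a"
  where "rep_power A u k i j = list_prod A (map (\<lambda>n. u (i ! n) (j ! n)) [0..<k])"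

definition satisfies_relations ::
  "nat \<Rightarrow> (nat \<Rightarrow> nat \<Rightarrow> lpart set) \<Rightarrow> 'a cstar \<Rightarrow> (nat \<Rightarrow> nat \<Rightarrow> 'a) \<Rightarrow> bool"
  where "satisfies_relations N K A u \<longleftrightarrow>
    (\<forall>i<N. \<forall>j<N. u i j \<in> carrier A \<and> cadj A (u i j) = u i j) \<and>
    (\<forall>k l. \<forall>p\<in>K k l. intertwines A (multi_idx N k) (multi_idx N l) (T_map p)
       (rep_power A u k) (rep_power A u l))"

text \<open>
  \<open>(A, u)\<close> is the quantum group of \<open>K\<close>: the C*-algebra \<open>A\<close> is generated by the entries of \<open>u\<close>, which
  satisfy the relations, and is universal with this property. As quantification over all types is
  not available, the test algebras \<open>B\<close> range over the C*-algebras with carrier in an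
  arbitrary type \<open>'b\<close>, which is a parameter. The *-homomorphism is unique since \<open>A\<close> is generated
  by \<open>u\<close>, and its range lies in the separable C*-subalgebra of \<open>B\<close> generated by finitely many
  elements; so a type \<open>'b\<close> of at least the cardinality of the continuum yields the universal property
  with respect to all unital C*-algebras.
\<close>

definition is_quantum_group :: "'b itself \<Rightarrow> nat \<Rightarrow> (nat \<Rightarrow> nat \<Rightarrow> lpart set) \<Rightarrow>
    'a cstar \<Rightarrow> (nat \<Rightarrow> nat \<Rightarrow> 'a) \<Rightarrow> bool"
  where "is_quantum_group TB N K A u \<longleftrightarrow>
    cstar_algebra A \<and> satisfies_relations N K A u \<and>
    cstar_generated A {u i j | i j. i < N \<and> j < N} \<and>
    (\<forall>(B :: 'b cstar) y. cstar_algebra B \<longrightarrow> satisfies_relations N K B y \<longrightarrow>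
       (\<exists>\<phi>\<in>star_hom A B. \<forall>i<N. \<forall>j<N. \<phi> (u i j) = y i j))"

definition word_rep :: "'a cstar \<Rightarrow> (nat \<Rightarrow> nat \<Rightarrow> 'a) \<Rightarrow> 'a \<Rightarrow> color list \<Rightarrow>
    nat list \<Rightarrow> nat list \<Rightarrow> 'a"
  where "word_rep A v r w i j =
    list_prod A (map (\<lambda>n. case w ! n of Ell \<Rightarrow> v (i ! n) (j ! n) | Tri \<Rightarrow> r) [0..<length w])"

definition satisfies_tri_relations :: "nat \<Rightarrow> (color list \<Rightarrow> color list \<Rightarrow> lpart set) \<Rightarrow>
    'a cstar \<Rightarrow> (nat \<Rightarrow> nat \<Rightarrow> 'a) \<Rightarrow> 'a \<Rightarrow> bool"
  where "satisfies_tri_relations N L A v r \<longleftrightarrow>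
    (\<forall>i<N - 1. \<forall>j<N - 1. v i j \<in> carrier A \<and> cadj A (v i j) = v i j) \<and>
    r \<in> carrier A \<and> cadj A r = r \<and>
    (\<forall>w1 w2. \<forall>p\<in>L w1 w2. intertwines A (word_idx N w1) (word_idx N w2) (tT_map N w1 w2 p)
       (word_rep A v r w1) (word_rep A v r w2))"

definition direct_sum :: "nat \<Rightarrow> 'a cstar \<Rightarrow> (nat \<Rightarrow> nat \<Rightarrow> 'a) \<Rightarrow> 'a \<Rightarrow> nat \<Rightarrow> nat \<Rightarrow> 'a"
  where "direct_sum N A v r i j =
    (if i < N - 1 \<and> j < N - 1 then v i j else if i = N - 1 \<and> j = N - 1 then r else \<zero>\<^bsub>A\<^esub>)"

definition is_tri_quantum_group :: "'b itself \<Rightarrow> nat \<Rightarrow> (color list \<Rightarrow> color list \<Rightarrow> lpart set) \<Rightarrow>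
    'a cstar \<Rightarrow> (nat \<Rightarrow> nat \<Rightarrow> 'a) \<Rightarrow> bool"
  where "is_tri_quantum_group TB N L A u \<longleftrightarrow>
    cstar_algebra A \<and>
    (\<exists>v r. (\<forall>i<N. \<forall>j<N. u i j = direct_sum N A v r i j) \<and>
       satisfies_tri_relations N L A v r \<and>
       cstar_generated A (insert r {v i j | i j. i < N - 1 \<and> j < N - 1}) \<and>
       (\<forall>(B :: 'b cstar) v' r'. cstar_algebra B \<longrightarrow> satisfies_tri_relations N L B v' r' \<longrightarrow>
          (\<exists>\<phi>\<in>star_hom A B. (\<forall>i<N - 1. \<forall>j<N - 1. \<phi> (v i j) = v' i j) \<and> \<phi> r = r')))"

definition conjugate :: "nat \<Rightarrow> 'a cstar \<Rightarrow> (nat \<Rightarrow> nat \<Rightarrow> complex) \<Rightarrow> (nat \<Rightarrow> nat \<Rightarrow> 'a) \<Rightarrow>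
    nat \<Rightarrow> nat \<Rightarrow> 'a"
  where "conjugate N A M u i j =
    (\<Oplus>\<^bsub>A\<^esub>a\<in>{..<N}. \<Oplus>\<^bsub>A\<^esub>b\<in>{..<N}. cscale A (M i a * adjoint_mat M b j) (u a b))"

end

theory Submission
  imports Defs "HOL-Computational_Algebra.Polynomial"
begin

text \<open>
  For each \<open>N\<close> the map \<open>T\<close> turns the operations on combinations of partitions into those on matrices,
  and a combination of partitions of \<open>n\<close> points is determined by its matrix as soon as \<open>N\<close> exceeds \<open>n\<close>.
  So an identity between combinations can be checked on matrices for large \<open>N\<close>, and since all
  coefficients that occur are rational functions of \<open>sqrt N\<close>, it then holds for every \<open>N \<ge> 2\<close>.

  On matrices everything reduces to single blocks: \<open>T\<close> of a partition, with a matrix applied to each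
  tensor factor, is a product over the blocks of sums over one common index. Expanding
  \<open>\<Prod>\<^sub>x (\<delta> - c)\<close> in such a factor produces exactly the terms by which the functor replaces a block,
  so \<open>T\<close> of the image is conjugation by \<open>U\<close>. Functoriality follows because \<open>U\<close> is orthogonal and
  carries the projections \<open>\<pi>\<close> to the coordinate projections.

  For the quantum groups, conjugation by \<open>U\<close> transports the intertwiner relations. The one given by
  \<open>\<sigma> \<sigma>\<^sup>*\<close> says that the conjugated representation commutes with the projection onto \<open>e\<^sub>N\<close>, which
  splits it as \<open>v \<oplus> r\<close>.
\<close>

section \<open>Sums over labelings constant on blocks\<close>

text \<open>For small \<open>N\<close> the matrices of distinct partitions can be linearly
  dependent, so an identity at the given \<open>N\<close> cannot be read off from its matrices;
  hence the detour through all larger values. It requires every map in a form that makes sense for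
  all \<open>N\<close> and has rational coefficients. \<open>U_map\<close> is not given in this
  form: it is fixed by its values on the dotted basis, which itself moves with \<open>N\<close>. The
  formula \<open>U_corner\<close> takes its place; it comes from writing a compressed partition as a
  multiple of a dotted one. That multiple is the same whether rows of the projections or rows of U
  are inserted, which is why the images match conjugation by U. Composition meets another obstacle:
  between images, the middle index is summed only over the values allowed by its word. This partial
  sum over U is the matrix of the projection of the word, and morphisms absorb it. For the universal
  property, relations known only on the subspaces of two words must be extended by zero to full
  tensor powers. This works because v \<oplus> r has no mixed entries; summing over all words gives
  back the full relation, each component lying in the category thanks to \<sigma> \<otimes>
  \<sigma>.\<close>

definition block_const :: "'x set set \<Rightarrow> ('x \<Rightarrow> 'b) \<Rightarrow> bool"
  where "block_const P a \<longleftrightarrow> (\<forall>B\<in>P. \<forall>x\<in>B. \<forall>y\<in>B. a x = a y)"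

lemma block_const_cong:
  assumes "\<And>x. x \<in> \<Union>P \<Longrightarrow> a x = b x"
  shows "block_const P a = block_const P b"
  using assms unfolding block_const_def by (metis UnionI)

text \<open>A labeling that is constant on the blocks amounts to a choice of one label per block, so
  the sum factorizes. It is used for the components of a stacked pair
  (\<open>sum_delta_comp\<close>) and for the blocks of a single partition
  (\<open>sum_delta_blocks\<close>).\<close>

lemma sum_block_const:
  fixes m :: "'x \<Rightarrow> 'b \<Rightarrow> complex"
  assumes X: "finite X" and P: "partition_on X P" and L: "finite L"
  shows "(\<Sum>a\<in>X \<rightarrow>\<^sub>E L. of_bool (block_const P a) * (\<Prod>x\<in>X. m x (a x))) =
    (\<Prod>B\<in>P. \<Sum>b\<in>L. \<Prod>x\<in>B. m x b)"
proof -
  define bl where "bl x = (THE B. B \<in> P \<and> x \<in> B)" for x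
  define rp where "rp B = (SOME x. x \<in> B)" for B :: "'x set"
  have finP: "finite P" using X P by (metis finite_elements)
  have U: "\<Union>P = X" using P by (simp add: partition_on_def)
  have dj: "disjoint P" using P by (simp add: partition_on_def)
  have uniq: "B = C" if "B \<in> P" "C \<in> P" "x \<in> B" "x \<in> C" for B C x
    using dj that by (meson disjnt_iff pairwise_def)
  have bl: "bl x = B" if "B \<in> P" "x \<in> B" for x B
    unfolding bl_def by (rule the_equality) (use that uniq in auto)
  have blP: "bl x \<in> P \<and> x \<in> bl x" if "x \<in> X" for x
    using that U bl by (metis UnionE)
  have rp: "rp B \<in> B" if "B \<in> P" for B
  proof -
    have "B \<noteq> {}" using P that by (auto simp: partition_on_def)
    then show ?thesis unfolding rp_def by (metis equals0I someI_ex)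
  qed
  have rpX: "rp B \<in> X" if "B \<in> P" for B using rp[OF that] that U by blast
  have "(\<Sum>a\<in>X \<rightarrow>\<^sub>E L. of_bool (block_const P a) * (\<Prod>x\<in>X. m x (a x))) =
     (\<Sum>a\<in>{a \<in> X \<rightarrow>\<^sub>E L. block_const P a}. \<Prod>x\<in>X. m x (a x))"
    by (rule sum.mono_neutral_cong_right) (use X L in \<open>auto intro!: finite_PiE\<close>)
  \<comment> \<open>\<open>rp\<close> picks a representative of each block and \<open>bl\<close>
    finds the block of a point; reading a labeling at the representatives and pulling back along
    \<open>bl\<close> are mutually inverse.\<close>
  also have "\<dots> = (\<Sum>g\<in>P \<rightarrow>\<^sub>E L. \<Prod>B\<in>P. \<Prod>x\<in>B. m x (g B))"
  proof (rule sum.reindex_bij_witness[where j = "\<lambda>a. \<lambda>B\<in>P. a (rp B)" and i = "\<lambda>g. \<lambda>x\<in>X. g (bl x)"])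
    fix a assume a: "a \<in> {a \<in> X \<rightarrow>\<^sub>E L. block_const P a}"
    have eq: "a (rp B) = a x" if "B \<in> P" "x \<in> B" for B x
      using a rp that unfolding block_const_def by blast
    show "(\<lambda>x\<in>X. (\<lambda>B\<in>P. a (rp B)) (bl x)) = a"
    proof
      fix x show "(\<lambda>x\<in>X. (\<lambda>B\<in>P. a (rp B)) (bl x)) x = a x"
        using a eq blP by (cases "x \<in> X") (auto simp: PiE_def extensional_def)
    qed
    show "(\<lambda>B\<in>P. a (rp B)) \<in> P \<rightarrow>\<^sub>E L"
      using a rpX by (auto simp: PiE_def)
    have "(\<Prod>x\<in>X. m x (a x)) = (\<Prod>B\<in>P. \<Prod>x\<in>B. m x (a x))"
      unfolding U[symmetric]
      by (subst prod.Union_disjoint) (use X U uniq in \<open>auto intro: finite_subset\<close>)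
    also have "\<dots> = (\<Prod>B\<in>P. \<Prod>x\<in>B. m x ((\<lambda>B\<in>P. a (rp B)) B))"
      by (intro prod.cong refl) (simp add: eq)
    finally show "(\<Prod>B\<in>P. \<Prod>x\<in>B. m x ((\<lambda>B\<in>P. a (rp B)) B)) = (\<Prod>x\<in>X. m x (a x))" by simp
  next
    fix g assume g: "g \<in> P \<rightarrow>\<^sub>E L"
    show "(\<lambda>B\<in>P. (\<lambda>x\<in>X. g (bl x)) (rp B)) = g"
    proof
      fix B show "(\<lambda>B\<in>P. (\<lambda>x\<in>X. g (bl x)) (rp B)) B = g B"
        using g rp rpX bl by (cases "B \<in> P") (auto simp: PiE_def extensional_def)
    qed
    have "block_const P (\<lambda>x\<in>X. g (bl x))"
      unfolding block_const_def using bl U by (metis UnionI restrict_apply')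
    then show "(\<lambda>x\<in>X. g (bl x)) \<in> {a \<in> X \<rightarrow>\<^sub>E L. block_const P a}"
      using g blP by (auto simp: PiE_def)
  qed
  also have "\<dots> = (\<Prod>B\<in>P. \<Sum>b\<in>L. \<Prod>x\<in>B. m x b)"
    by (rule prod_sum_PiE[symmetric]) (use finP L in auto)
  finally show ?thesis .
qed


section \<open>Linear extension of functionals\<close>

text \<open>Coefficients (\<open>lookup_eq_lin\<close>) and matrix entries
  (\<open>T_map_lin\<close>) are both functionals of this form, so one calculus of linear extension
  proves identities of either kind.\<close>

definition lin :: "(part \<Rightarrow> complex) \<Rightarrow> lpart \<Rightarrow> complex"
  where "lin \<phi> f = (\<Sum>p\<in>Poly_Mapping.keys f. Poly_Mapping.lookup f p * \<phi> p)"

lemma lin_superset: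
  assumes "finite S" "Poly_Mapping.keys f \<subseteq> S"
  shows "lin \<phi> f = (\<Sum>p\<in>S. Poly_Mapping.lookup f p * \<phi> p)"
  unfolding lin_def by (rule sum.mono_neutral_left) (use assms in \<open>auto simp: in_keys_iff\<close>)

lemma lin_add: "lin \<phi> (f + g) = lin \<phi> f + lin \<phi> g"
proof -
  define S where "S = Poly_Mapping.keys f \<union> Poly_Mapping.keys g"
  have S: "finite S" "Poly_Mapping.keys f \<subseteq> S" "Poly_Mapping.keys g \<subseteq> S"
    "Poly_Mapping.keys (f + g) \<subseteq> S"
    using Poly_Mapping.keys_add[of f g] by (auto simp: S_def)
  show ?thesis
    unfolding lin_superset[OF S(1,2)] lin_superset[OF S(1,3)] lin_superset[OF S(1,4)]
    by (simp add: lookup_add sum.distrib algebra_simps)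
qed

lemma keys_pscale: "Poly_Mapping.keys (pscale c f) \<subseteq> Poly_Mapping.keys f"
  by (auto simp: in_keys_iff)

lemma lin_pscale: "lin \<phi> (pscale c f) = c * lin \<phi> f"
  unfolding lin_superset[OF finite_keys keys_pscale] unfolding lin_def
  by (simp add: sum_distrib_left mult.assoc)

lemma lin_zero [simp]: "lin \<phi> 0 = 0"
  by (simp add: lin_def)

lemma pscale_minus_one: "pscale (-1) f = - f"
  by (rule poly_mapping_eqI) simp

lemma lin_diff: "lin \<phi> (f - g) = lin \<phi> f - lin \<phi> g"
proof -
  have "f - g = f + pscale (-1) g" by (simp add: pscale_minus_one)
  then show ?thesis by (simp only: lin_add lin_pscale) simp
qed

lemma lin_sum: "lin \<phi> (\<Sum>i\<in>I. F i) = (\<Sum>i\<in>I. lin \<phi> (F i))"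
  by (induction I rule: infinite_finite_induct) (auto simp: lin_add)

lemma lin_basis_elt [simp]: "lin \<phi> (basis_elt p) = \<phi> p"
  by (simp add: lin_def basis_elt_def)

lemma lin_cong:
  assumes "\<And>p. p \<in> Poly_Mapping.keys f \<Longrightarrow> \<phi> p = \<psi> p"
  shows "lin \<phi> f = lin \<psi> f"
  unfolding lin_def by (intro sum.cong refl) (simp add: assms)

lemma lin_const_mult: "lin (\<lambda>p. c * \<phi> p) f = c * lin \<phi> f"
  by (simp add: lin_def sum_distrib_left mult.left_commute)

lemma lin_sum_functional: "lin (\<lambda>p. \<Sum>i\<in>I. \<phi> i p) f = (\<Sum>i\<in>I. lin (\<phi> i) f)"
  unfolding lin_def by (subst sum.swap) (simp add: sum_distrib_left)

text \<open>Moves a functional through a bilinear extension, so that claims about tensor products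
  and compositions reduce to pairs of partitions.\<close>

lemma lin_bilinear_ext:
  "lin \<phi> (bilinear_ext h f g) = lin (\<lambda>p. lin (\<lambda>q. lin \<phi> (h p q)) g) f"
proof -
  have "lin \<phi> (bilinear_ext h f g) =
    (\<Sum>p\<in>Poly_Mapping.keys f. \<Sum>q\<in>Poly_Mapping.keys g.
       Poly_Mapping.lookup f p * Poly_Mapping.lookup g q * lin \<phi> (h p q))"
    unfolding bilinear_ext_def lin_sum lin_pscale ..
  also have "\<dots> = lin (\<lambda>p. lin (\<lambda>q. lin \<phi> (h p q)) g) f"
    unfolding lin_def by (simp add: sum_distrib_left mult.assoc)
  finally show ?thesis .
qed

lemma lookup_eq_lin: "Poly_Mapping.lookup f r = lin (\<lambda>p. of_bool (p = r)) f"
proof -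
  have "lin (\<lambda>p. of_bool (p = r)) f = (\<Sum>p\<in>insert r (Poly_Mapping.keys f). Poly_Mapping.lookup f p * of_bool (p = r))"
    by (rule lin_superset) auto
  also have "\<dots> = (\<Sum>p\<in>{r}. Poly_Mapping.lookup f p * of_bool (p = r))"
    by (rule sum.mono_neutral_right) auto
  finally show ?thesis by simp
qed

lemma basis_expansion:
  assumes "finite S" "Poly_Mapping.keys f \<subseteq> S"
  shows "f = (\<Sum>p\<in>S. pscale (Poly_Mapping.lookup f p) (basis_elt p))"
proof (rule poly_mapping_eqI)
  fix r
  have "Poly_Mapping.lookup (\<Sum>p\<in>S. pscale (Poly_Mapping.lookup f p) (basis_elt p)) r =
      (\<Sum>p\<in>S. Poly_Mapping.lookup f p * of_bool (p = r))"
    unfolding lookup_eq_lin[of "\<Sum>p\<in>S. _ p"] lin_sum lin_pscale lin_basis_elt ..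
  also have "\<dots> = lin (\<lambda>p. of_bool (p = r)) f" using lin_superset[OF assms] by simp
  finally show "Poly_Mapping.lookup f r = Poly_Mapping.lookup (\<Sum>p\<in>S. pscale (Poly_Mapping.lookup f p) (basis_elt p)) r"
    using lookup_eq_lin[of f r] by simp
qed

lemma lin_linv: "lin \<phi> (linv f) = cnj (lin (\<lambda>p. cnj (\<phi> (pinv p))) f)"
  unfolding linv_def lin_sum lin_pscale lin_basis_elt by (simp add: lin_def)

lemma T_map_lin: "T_map f j i = lin (\<lambda>p. delta p i j) f"
  by (simp add: T_map_def lin_def)

lemma bilinear_ext_basis_elt [simp]: "bilinear_ext h (basis_elt p) (basis_elt q) = h p q"
  by (rule poly_mapping_eqI) (simp only: lookup_eq_lin lin_bilinear_ext lin_basis_elt)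


section \<open>Membership in the spaces of linear combinations\<close>

lemma keys_basis_elt [simp]: "Poly_Mapping.keys (basis_elt p) = {p}"
  by (simp add: basis_elt_def)

text \<open>Common form of \<open>lparts\<close> and \<open>ltparts\<close>, so that the closure
  rules are proved once.\<close>

definition lspan :: "part set \<Rightarrow> lpart set"
  where "lspan S = {f. Poly_Mapping.keys f \<subseteq> S}"

lemma lspan_zero [simp]: "0 \<in> lspan S" by (simp add: lspan_def)
lemma lspan_add: "f \<in> lspan S \<Longrightarrow> g \<in> lspan S \<Longrightarrow> f + g \<in> lspan S"
  unfolding lspan_def using Poly_Mapping.keys_add[of f g] by auto
lemma lspan_pscale: "f \<in> lspan S \<Longrightarrow> pscale c f \<in> lspan S"
  unfolding lspan_def using keys_pscale by blast
lemma lspan_diff: "f \<in> lspan S \<Longrightarrow> g \<in> lspan S \<Longrightarrow> f - g \<in> lspan S"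
  using lspan_add[of f S "pscale (-1) g"] lspan_pscale[of g S "-1"] by (simp add: pscale_minus_one)
lemma lspan_sum: "(\<And>i. i \<in> I \<Longrightarrow> F i \<in> lspan S) \<Longrightarrow> (\<Sum>i\<in>I. F i) \<in> lspan S"
  by (induction I rule: infinite_finite_induct) (auto simp: lspan_add)
lemma lspan_basis_elt [simp]: "basis_elt p \<in> lspan S \<longleftrightarrow> p \<in> S" by (simp add: lspan_def)
lemma lparts_lspan: "lparts k l = lspan (parts k l)" by (simp add: lparts_def lspan_def)
lemma ltparts_lspan: "ltparts v w = lspan (tparts v w)" by (simp add: ltparts_def lspan_def)

lemma bilinear_ext_lspan:
  assumes "f \<in> lspan S" "g \<in> lspan S'" "\<And>p q. p \<in> S \<Longrightarrow> q \<in> S' \<Longrightarrow> h p q \<in> lspan R"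
  shows "bilinear_ext h f g \<in> lspan R"
  unfolding bilinear_ext_def using assms
  by (intro lspan_sum lspan_pscale assms(3)) (auto simp: lspan_def)

lemma linv_lspan:
  assumes "f \<in> lspan S" "\<And>p. p \<in> S \<Longrightarrow> pinv p \<in> R"
  shows "linv f \<in> lspan R"
  unfolding linv_def using assms
  by (intro lspan_sum lspan_pscale) (auto simp: lspan_def)

section \<open>Operations on partitions\<close>

lemma finite_points [simp]: "finite (points k l)"
  by (simp add: points_def)

lemma finite_parts [simp]: "finite (parts k l)"
  unfolding parts_def by (rule finitely_many_partition_on) simp

lemma Inl_in_points [simp]: "Inl n \<in> points k l \<longleftrightarrow> n < k"
  and Inr_in_points [simp]: "Inr n \<in> points k l \<longleftrightarrow> n < l"
  by (auto simp: points_def)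

lemma Union_parts: "p \<in> parts k l \<Longrightarrow> \<Union>p = points k l"
  by (simp add: parts_def partition_on_def)

lemma parts_subset_points: "p \<in> parts k l \<Longrightarrow> B \<in> p \<Longrightarrow> B \<subseteq> points k l"
  using Union_parts by blast

lemma parts_block_unique:
  "p \<in> parts k l \<Longrightarrow> B \<in> p \<Longrightarrow> C \<in> p \<Longrightarrow> x \<in> B \<Longrightarrow> x \<in> C \<Longrightarrow> B = C"
  unfolding parts_def partition_on_def pairwise_def disjnt_iff by blast

lemma parts_nonempty: "p \<in> parts k l \<Longrightarrow> B \<in> p \<Longrightarrow> B \<noteq> {}"
  unfolding parts_def partition_on_def by auto

lemma finite_parts_member: "p \<in> parts k l \<Longrightarrow> finite p"
  unfolding parts_def using finite_elements finite_points by blast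

lemma finite_block: "p \<in> parts k l \<Longrightarrow> B \<in> p \<Longrightarrow> finite B"
  using parts_subset_points finite_points finite_subset by metis

lemma partsI:
  assumes "\<Union>p = points k l" "{} \<notin> p" "\<And>B C x. B \<in> p \<Longrightarrow> C \<in> p \<Longrightarrow> x \<in> B \<Longrightarrow> x \<in> C \<Longrightarrow> B = C"
  shows "p \<in> parts k l"
  unfolding parts_def mem_Collect_eq by (rule partition_onI) (use assms in \<open>auto simp: disjnt_iff\<close>)

lemma n_up_parts [simp]: "p \<in> parts k l \<Longrightarrow> n_up p = k"
  and n_low_parts [simp]: "p \<in> parts k l \<Longrightarrow> n_low p = l"
proof -
  have "Inl -` points k l = {..<k}" "Inr -` points k l = {..<l}" by auto
  then show "p \<in> parts k l \<Longrightarrow> n_up p = k" "p \<in> parts k l \<Longrightarrow> n_low p = l"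
    by (simp_all add: n_up_def n_low_def Union_parts)
qed

lemma map_sum_add_inj: "inj (map_sum ((+) (a::nat)) ((+) (b::nat)))"
  by (auto simp: inj_def map_sum_def split: sum.splits)

lemma ptensor_parts:
  assumes p: "p \<in> parts k l" and q: "q \<in> parts k' l'"
  shows "ptensor p q \<in> parts (k + k') (l + l')"
proof -
  let ?f = "map_sum ((+) k) ((+) l)"
  let ?q = "(\<lambda>B. ?f ` B) ` q"
  have eq: "ptensor p q = p \<union> ?q" using p by (simp add: ptensor_def)
  have Uq: "\<Union>?q = ?f ` points k' l'" using Union_parts[OF q] by blast
  have disj: "points k l \<inter> ?f ` points k' l' = {}" by (auto simp: points_def)
  have "points (k + k') (l + l') = points k l \<union> ?f ` points k' l'"
  proof -
    have "x \<in> points k l \<union> ?f ` points k' l'" if x: "x \<in> points (k + k') (l + l')" for x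
    proof (cases x)
      case (Inl n)
      then show ?thesis using x image_eqI[of "Inl n" ?f "Inl (n - k)" "points k' l'"]
        by (cases "n < k") auto
    next
      case (Inr n)
      then show ?thesis using x image_eqI[of "Inr n" ?f "Inr (n - l)" "points k' l'"]
        by (cases "n < l") auto
    qed
    then show ?thesis by (auto simp: points_def)
  qed
  then have U: "\<Union>(ptensor p q) = points (k + k') (l + l')"
    unfolding eq using Union_parts[OF p] Uq by auto
  show ?thesis
  proof (rule partsI[OF U])
    show "{} \<notin> ptensor p q" unfolding eq using parts_nonempty[OF p] parts_nonempty[OF q] by auto
    fix B C x assume B: "B \<in> ptensor p q" and C: "C \<in> ptensor p q" and x: "x \<in> B" "x \<in> C"
    have pq: False if "B' \<in> p" "C' \<in> ?q" "x \<in> B'" "x \<in> C'" for B' C'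
      using that parts_subset_points[OF p] Uq disj by blast
    from B C consider "B \<in> p" "C \<in> p" | "B \<in> ?q" "C \<in> ?q" using x pq unfolding eq by blast
    then show "B = C"
    proof cases
      case 1 then show ?thesis using parts_block_unique[OF p] x by blast
    next
      case 2
      then obtain B' C' where BC: "B' \<in> q" "B = ?f ` B'" "C' \<in> q" "C = ?f ` C'" by blast
      with x obtain y where "y \<in> B'" "y \<in> C'" using map_sum_add_inj[of k l] by (auto simp: inj_def)
      then show ?thesis using parts_block_unique[OF q] BC by metis
    qed
  qed
qed

lemma delta_block_const: "delta p i j = of_bool (block_const p (label i j))"
  by (simp add: delta_def block_const_def)

lemma block_const_union: "block_const (P \<union> Q) a \<longleftrightarrow> block_const P a \<and> block_const Q a"
  by (auto simp: block_const_def)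

lemma block_const_image: "block_const ((\<lambda>B. f ` B) ` P) a \<longleftrightarrow> block_const P (a \<circ> f)"
  by (auto simp: block_const_def)

lemma label_Inl [simp]: "label i j (Inl n) = i ! n" and label_Inr [simp]: "label i j (Inr n) = j ! n"
  by (simp_all add: label_def)

lemma delta_ptensor:
  assumes p: "p \<in> parts k l" and len: "length i = k" "length j = l"
  shows "delta (ptensor p q) (i @ i') (j @ j') = delta p i j * delta q i' j'"
proof -
  have "block_const p (label (i @ i') (j @ j')) = block_const p (label i j)"
    by (rule block_const_cong)
      (use len Union_parts[OF p] in \<open>auto simp: label_def points_def nth_append split: sum.splits\<close>)
  moreover have "label (i @ i') (j @ j') \<circ> map_sum ((+) k) ((+) l) = label i' j'"
    using len by (auto simp: fun_eq_iff label_def split: sum.splits)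
  ultimately show ?thesis
    using p by (simp add: delta_block_const ptensor_def block_const_union block_const_image)
qed

lemma pinv_parts: "p \<in> parts k l \<Longrightarrow> pinv p \<in> parts l k"
proof -
  assume p: "p \<in> parts k l"
  let ?f = "case_sum Inr Inl :: point \<Rightarrow> point"
  have inj: "inj ?f" by (auto simp: inj_def split: sum.splits)
  have "points l k = ?f ` points k l" by (auto simp: points_def image_Un image_image)
  then have U: "\<Union>(pinv p) = points l k"
    unfolding pinv_def Union_parts[OF p, symmetric] by blast
  show "pinv p \<in> parts l k"
  proof (rule partsI[OF U])
    show "{} \<notin> pinv p" using parts_nonempty[OF p] by (auto simp: pinv_def)
    fix B C x assume "B \<in> pinv p" "C \<in> pinv p" and x: "x \<in> B" "x \<in> C"
    then obtain B' C' where BC: "B' \<in> p" "B = ?f ` B'" "C' \<in> p" "C = ?f ` C'"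
      unfolding pinv_def by blast
    with x obtain y where "y \<in> B'" "y \<in> C'" using inj by (metis (no_types, lifting) imageE injD)
    then show "B = C" using parts_block_unique[OF p] BC by metis
  qed
qed

lemma delta_pinv: "delta (pinv p) i j = delta p j i"
proof -
  have "label i j \<circ> case_sum Inr Inl = label j i"
    by (auto simp: fun_eq_iff label_def split: sum.splits)
  then show ?thesis by (simp add: delta_block_const pinv_def block_const_image)
qed

section \<open>Components of two stacked partitions\<close>

definition stack_rel :: "part \<Rightarrow> part \<Rightarrow> (point3 \<times> point3) set"
  where "stack_rel q p = {(x, y). \<exists>B\<in>stack q p. x \<in> B \<and> y \<in> B}"

lemma components_stack_rel: "components q p = \<Union>(stack q p) // (stack_rel q p)\<^sup>*"
  by (simp add: components_def stack_rel_def)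

lemma sym_stack_rel: "sym ((stack_rel q p)\<^sup>*)"
  by (rule sym_rtrancl) (auto simp: sym_def stack_rel_def)

lemma stack_rel_closed: "(x, y) \<in> (stack_rel q p)\<^sup>* \<Longrightarrow> x \<in> \<Union>(stack q p) \<Longrightarrow> y \<in> \<Union>(stack q p)"
  by (induction rule: rtrancl_induct) (auto simp: stack_rel_def)

lemma components_partition: "partition_on (\<Union>(stack q p)) (components q p)"
proof (rule partition_onI)
  let ?r = "(stack_rel q p)\<^sup>*"
  show "\<Union>(components q p) = \<Union>(stack q p)"
    unfolding components_stack_rel quotient_def using stack_rel_closed by blast
  show "{} \<notin> components q p"
    unfolding components_stack_rel quotient_def by blast
  fix C D assume "C \<in> components q p" "D \<in> components q p" "C \<noteq> D"
  then obtain x y where xy: "C = ?r `` {x}" "D = ?r `` {y}"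
    unfolding components_stack_rel quotient_def by blast
  show "disjnt C D"
  proof (rule ccontr)
    assume "\<not> disjnt C D"
    then obtain z where "(x, z) \<in> ?r" "(y, z) \<in> ?r" unfolding xy disjnt_iff by blast
    then have "(x, y) \<in> ?r" "(y, x) \<in> ?r"
      using sym_stack_rel[of q p] by (meson rtrancl_trans symE)+
    then have "C = D" unfolding xy by (auto intro: rtrancl_trans)
    with \<open>C \<noteq> D\<close> show False ..
  qed
qed

lemma component_class:
  assumes "C \<in> components q p" "x \<in> C"
  shows "C = (stack_rel q p)\<^sup>* `` {x}"
proof -
  obtain y where y: "C = (stack_rel q p)\<^sup>* `` {y}"
    using assms(1) unfolding components_stack_rel quotient_def by blast
  then have "(y, x) \<in> (stack_rel q p)\<^sup>*" "(x, y) \<in> (stack_rel q p)\<^sup>*"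
    using assms(2) sym_stack_rel[of q p] by (auto dest: symD)
  then show ?thesis unfolding y by (auto intro: rtrancl_trans)
qed

text \<open>A point met only by its own singleton block has no neighbour in the relation, so its
  class does not grow. Triangle points are of this kind.\<close>

lemma component_singleton:
  assumes C: "C \<in> components q p" "x \<in> C" and x: "\<And>B. B \<in> stack q p \<Longrightarrow> x \<in> B \<Longrightarrow> B = {x}"
  shows "C = {x}"
proof -
  have "y = x" if "(x, y) \<in> (stack_rel q p)\<^sup>*" for y
    using that by (induction rule: rtrancl_induct) (use x in \<open>auto simp: stack_rel_def\<close>)
  then show ?thesis using component_class[OF C] by auto
qed

text \<open>Equality of labels spreads along chains of overlapping blocks. Hence the product of the
  two deltas of a stacked pair tests constancy on its components.\<close>

lemma block_const_components: "block_const (components q p) a \<longleftrightarrow> block_const (stack q p) a"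
proof
  assume c: "block_const (components q p) a"
  show "block_const (stack q p) a"
    unfolding block_const_def
  proof (intro ballI)
    fix B x y assume B: "B \<in> stack q p" and xy: "x \<in> B" "y \<in> B"
    then have "x \<in> \<Union>(stack q p)" "(x, y) \<in> (stack_rel q p)\<^sup>*" by (auto simp: stack_rel_def)
    then have "(stack_rel q p)\<^sup>* `` {x} \<in> components q p" "y \<in> (stack_rel q p)\<^sup>* `` {x}"
      "x \<in> (stack_rel q p)\<^sup>* `` {x}"
      unfolding components_stack_rel by (auto intro: quotientI)
    then show "a x = a y" using c unfolding block_const_def by blast
  qed
next
  assume s: "block_const (stack q p) a"
  have "a x = a y" if "(x, y) \<in> (stack_rel q p)\<^sup>*" for x y
    using that by (induction rule: rtrancl_induct) (use s in \<open>auto simp: stack_rel_def block_const_def\<close>)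
  then show "block_const (components q p) a"
    unfolding block_const_def using component_class by (metis Image_singleton_iff)
qed

lemma Union_stack:
  assumes "p \<in> parts k l" "q \<in> parts l m"
  shows "\<Union>(stack q p) = Inl ` {..<k} \<union> (Inr \<circ> Inl) ` {..<l} \<union> (Inr \<circ> Inr) ` {..<m}"
proof -
  have "\<Union>(stack q p) = map_sum id Inl ` \<Union>p \<union> Inr ` \<Union>q" unfolding stack_def by blast
  then show ?thesis unfolding Union_parts[OF assms(1)] Union_parts[OF assms(2)]
    by (auto simp: points_def image_Un image_image)
qed

text \<open>A removed component is one whose outer trace is empty, so composition is a preimage
  partition and \<open>partition_on_vimage\<close> applies.\<close>

lemma pcomp_vimage: "pcomp q p = (-`) outer ` components q p - {{}}"
  unfolding pcomp_def removed_def by auto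

lemma pcomp_parts:
  assumes "p \<in> parts k l" "q \<in> parts l m"
  shows "pcomp q p \<in> parts k m"
proof -
  have "outer -` \<Union>(stack q p) = points k m"
    unfolding Union_stack[OF assms] by (auto simp: outer_def points_def map_sum_def split: sum.splits)
  then show ?thesis
    using partition_on_vimage[OF components_partition[of q p], of outer]
    by (simp add: parts_def pcomp_vimage)
qed

definition label3 :: "nat list \<Rightarrow> nat list \<Rightarrow> nat list \<Rightarrow> point3 \<Rightarrow> nat"
  where "label3 i h j = case_sum ((!) i) (case_sum ((!) h) ((!) j))"

lemma label3_simps [simp]: "label3 i h j (Inl n) = i ! n" "label3 i h j (Inr (Inl n)) = h ! n"
  "label3 i h j (Inr (Inr n)) = j ! n" "label3 i h j (outer x) = label i j x"
  by (auto simp: label3_def outer_def label_def split: sum.splits)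

lemma block_const_stack:
  "block_const (stack q p) (label3 i h j) \<longleftrightarrow> block_const p (label i h) \<and> block_const q (label h j)"
proof -
  have "label3 i h j \<circ> map_sum id Inl = label i h" "label3 i h j \<circ> Inr = label h j"
    by (auto simp: fun_eq_iff label3_def label_def split: sum.splits)
  then show ?thesis unfolding stack_def block_const_union block_const_image by simp
qed

lemma prod_of_bool: "finite S \<Longrightarrow> (\<Prod>x\<in>S. of_bool (Q x) :: complex) = of_bool (\<forall>x\<in>S. Q x)"
  by (induction S rule: finite_induct) auto

lemma finite_multi_idx [simp]: "finite (multi_idx N k)"
proof -
  have "multi_idx N k = {i. set i \<subseteq> {..<N} \<and> length i = k}" by (auto simp: multi_idx_def)
  then show ?thesis using finite_lists_length_eq[of "{..<N}" k] by simp
qed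

lemma multi_idx_nth: "i \<in> multi_idx N k \<Longrightarrow> n < k \<Longrightarrow> i ! n < N"
  by (auto simp: multi_idx_def subset_iff)

lemma multi_idxI: "length i = k \<Longrightarrow> (\<And>n. n < k \<Longrightarrow> i ! n < N) \<Longrightarrow> i \<in> multi_idx N k"
  by (auto simp: multi_idx_def in_set_conv_nth)

text \<open>The middle labels of a component range over the color set \<open>F C\<close> of that component.\<close>

lemma sum_delta_comp:
  assumes p: "p \<in> parts k l" and q: "q \<in> parts l m"
    and i: "i \<in> multi_idx N k" and j: "j \<in> multi_idx N m"
    and F: "\<And>C. C \<in> components q p \<Longrightarrow> F C \<subseteq> {..<N}"
    and F_outer: "\<And>C x. C \<in> components q p \<Longrightarrow> outer x \<in> C \<Longrightarrow> label i j x \<in> F C"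
  shows "(\<Sum>h\<in>{h \<in> multi_idx N l. \<forall>n<l. \<forall>C\<in>components q p. Inr (Inl n) \<in> C \<longrightarrow> h ! n \<in> F C}.
      delta q h j * delta p i h) = (\<Prod>C\<in>removed q p. of_nat (card (F C))) * delta (pcomp q p) i j"
    (is "sum ?d ?M = _")
proof -
  define X where "X = \<Union>(stack q p)"
  define K where "K = components q p"
  \<comment> \<open>The weight is 0 or 1: it pins the outer points to the labels \<open>i\<close>
    and \<open>j\<close> and confines a middle point to the label set of its component. This turns
    the sum over \<open>h\<close> into one over all labelings of the three rows, to which
    \<open>sum_block_const\<close> applies.\<close>
  define m' where "m' x b = (of_bool (case x of Inr (Inl n) \<Rightarrow> \<forall>C\<in>K. x \<in> C \<longrightarrow> b \<in> F C
     | Inl n \<Rightarrow> b = i ! n | Inr (Inr n) \<Rightarrow> b = j ! n) :: complex)" for x b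
  have X: "X = Inl ` {..<k} \<union> (Inr \<circ> Inl) ` {..<l} \<union> (Inr \<circ> Inr) ` {..<m}"
    unfolding X_def using Union_stack[OF p q] .
  have finX: "finite X" unfolding X by simp
  have part: "partition_on X K" unfolding X_def K_def by (rule components_partition)
  have finK: "finite K" using finX part finite_elements by blast
  have uniq: "C = D" if "C \<in> K" "D \<in> K" "x \<in> C" "x \<in> D" for C D x
    using part that unfolding partition_on_def pairwise_def by (auto simp: disjnt_iff)
  have finC: "finite C" if "C \<in> K" for C
    using that finX part unfolding partition_on_def by (meson Sup_upper finite_subset)
  have KX: "C \<subseteq> X" if "C \<in> K" for C using that part unfolding partition_on_def by blast
  have prodm: "(\<Prod>x\<in>X. m' x (a x)) = of_bool (\<forall>x\<in>X. m' x (a x) = 1)" for a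
    unfolding m'_def prod_of_bool[OF finX] by auto
  have "sum ?d ?M = (\<Sum>h\<in>?M. of_bool (block_const K (label3 i h j)))"
    by (intro sum.cong refl)
      (auto simp: K_def block_const_components block_const_stack delta_block_const)
  also have "\<dots> = (\<Sum>a\<in>{a \<in> X \<rightarrow>\<^sub>E {..<N}. \<forall>x\<in>X. m' x (a x) = 1}. of_bool (block_const K a))"
  proof (rule sum.reindex_bij_witness[where j = "\<lambda>h. restrict (label3 i h j) X"
        and i = "\<lambda>a. map (\<lambda>n. a (Inr (Inl n))) [0..<l]"])
    fix h assume h: "h \<in> ?M"
    show "map (\<lambda>n. restrict (label3 i h j) X (Inr (Inl n))) [0..<l] = h"
      using h by (intro nth_equalityI) (auto simp: multi_idx_def X)
    show "restrict (label3 i h j) X \<in> {a \<in> X \<rightarrow>\<^sub>E {..<N}. \<forall>x\<in>X. m' x (a x) = 1}"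
    proof -
      have "label3 i h j x < N \<and> m' x (label3 i h j x) = 1" if "x \<in> X" for x
        using that i j h multi_idx_nth unfolding X m'_def K_def by (auto simp: multi_idx_nth)
      then show ?thesis by auto
    qed
    have "block_const K (restrict (label3 i h j) X) = block_const K (label3 i h j)"
      by (rule block_const_cong) (use part in \<open>auto simp: partition_on_def\<close>)
    then show "(of_bool (block_const K (restrict (label3 i h j) X)) :: complex) =
        of_bool (block_const K (label3 i h j))" by simp
  next
    fix a assume a: "a \<in> {a \<in> X \<rightarrow>\<^sub>E {..<N}. \<forall>x\<in>X. m' x (a x) = 1}"
    show "restrict (label3 i (map (\<lambda>n. a (Inr (Inl n))) [0..<l]) j) X = a"
    proof
      fix x
      show "restrict (label3 i (map (\<lambda>n. a (Inr (Inl n))) [0..<l]) j) X x = a x"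
      proof (cases "x \<in> X")
        case True
        then have "m' x (a x) = 1" using a by blast
        then show ?thesis using True unfolding X m'_def by auto
      next
        case False
        then show ?thesis using a by (auto simp: PiE_def extensional_def)
      qed
    qed
    show "map (\<lambda>n. a (Inr (Inl n))) [0..<l] \<in> ?M"
    proof -
      have "a (Inr (Inl n)) < N" if "n < l" for n
        using a that by (auto simp: X)
      moreover have "a (Inr (Inl n)) \<in> F C" if "n < l" "C \<in> K" "Inr (Inl n) \<in> C" for n C
      proof -
        have "m' (Inr (Inl n)) (a (Inr (Inl n))) = 1" using a that by (auto simp: X)
        then show ?thesis using that by (auto simp: m'_def)
      qed
      ultimately show ?thesis by (auto simp: multi_idx_def K_def)
    qed
  qed
  also have "\<dots> = (\<Sum>a\<in>X \<rightarrow>\<^sub>E {..<N}. of_bool (block_const K a) * (\<Prod>x\<in>X. m' x (a x)))"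
    unfolding prodm
    by (rule sum.mono_neutral_cong_left) (use finX in \<open>auto intro!: finite_PiE\<close>)
  also have "\<dots> = (\<Prod>C\<in>K. \<Sum>b<N. \<Prod>x\<in>C. m' x b)"
    by (rule sum_block_const[OF finX part]) simp
  also have "\<dots> = (\<Prod>C\<in>removed q p. \<Sum>b<N. \<Prod>x\<in>C. m' x b) * (\<Prod>C\<in>K - removed q p. \<Sum>b<N. \<Prod>x\<in>C. m' x b)"
    using finK by (subst prod.subset_diff[of "removed q p"]) (auto simp: removed_def K_def mult.commute)
  \<comment> \<open>A removed component consists of middle points, so every label in
    \<open>F C\<close> is admissible and the sum counts them.\<close>
  also have "(\<Prod>C\<in>removed q p. \<Sum>b<N. \<Prod>x\<in>C. m' x b) = (\<Prod>C\<in>removed q p. of_nat (card (F C)))"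
  proof (rule prod.cong[OF refl])
    fix C assume "C \<in> removed q p"
    then have C: "C \<in> K" "outer -` C = {}" by (auto simp: removed_def K_def)
    obtain x0 where x0: "x0 \<in> C" using part C unfolding partition_on_def by (metis all_not_in_conv)
    have mid: "\<exists>n. x = Inr (Inl n)" if "x \<in> C" for x
    proof -
      have "outer (Inl n) \<notin> C" "outer (Inr n) \<notin> C" for n using C(2) by auto
      then show ?thesis using that unfolding outer_def by (cases x) (auto simp: sum.split_sel, metis sum.exhaust)
    qed
    have "m' x b = of_bool (b \<in> F C)" if xC: "x \<in> C" for x b
    proof -
      obtain n where "x = Inr (Inl n)" using mid[OF xC] ..
      moreover have "(\<forall>D\<in>K. x \<in> D \<longrightarrow> b \<in> F D) \<longleftrightarrow> b \<in> F C" using uniq xC C(1) by metis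
      ultimately show ?thesis by (simp add: m'_def)
    qed
    then have "(\<Prod>x\<in>C. m' x b) = of_bool (b \<in> F C)" for b
      using x0 finC[OF C(1)] by (auto simp: card_gt_0_iff cong: prod.cong)
    then have "(\<Sum>b<N. \<Prod>x\<in>C. m' x b) = (\<Sum>b<N. of_bool (b \<in> F C))" by simp
    also have "\<dots> = (\<Sum>b\<in>F C. 1)"
      by (rule sum.mono_neutral_cong_right) (use F C in \<open>auto simp: K_def\<close>)
    finally show "(\<Sum>b<N. \<Prod>x\<in>C. m' x b) = of_nat (card (F C))" by simp
  qed
  \<comment> \<open>One outer point \<open>x0\<close> of the component leaves
    \<open>label i j x0\<close> as the only candidate label; it contributes exactly when all outer
    points of the component agree.\<close>
  also have "(\<Prod>C\<in>K - removed q p. \<Sum>b<N. \<Prod>x\<in>C. m' x b) =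
      (\<Prod>C\<in>K - removed q p. of_bool (\<forall>x\<in>outer -` C. \<forall>y\<in>outer -` C. label i j x = label i j y))"
  proof (rule prod.cong[OF refl])
    fix C assume "C \<in> K - removed q p"
    then have C: "C \<in> K" "outer -` C \<noteq> {}" by (auto simp: removed_def K_def)
    then obtain x0 where x0: "outer x0 \<in> C" by auto
    have mouter: "m' (outer x) b = of_bool (b = label i j x)" for x b
      by (cases x) (auto simp: m'_def outer_def)
    have lN: "label i j x0 < N"
      using F[of C] F_outer[of C x0] C x0 by (auto simp: K_def)
    have cases: "(\<exists>y. x = outer y) \<or> (\<exists>n. x = Inr (Inl n))" for x :: point3
      by (metis id_apply map_sum.simps outer_def sum.exhaust)
    have pr: "(\<Prod>x\<in>C. m' x b) = of_bool (\<forall>x\<in>C. m' x b = 1)" for b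
      unfolding m'_def prod_of_bool[OF finC[OF C(1)]] by auto
    have "(\<forall>x\<in>C. m' x b = 1) \<longleftrightarrow> b = label i j x0 \<and>
        (\<forall>x\<in>outer -` C. \<forall>y\<in>outer -` C. label i j x = label i j y)" (is "?l \<longleftrightarrow> ?r") for b
    proof
      assume ?l
      then have "b = label i j x" if "outer x \<in> C" for x using mouter that by (metis of_bool_eq_1_iff)
      then show ?r using x0 by auto
    next
      assume r: ?r
      show ?l
      proof
        fix x assume x: "x \<in> C"
        from cases[of x] show "m' x b = 1"
        proof
          assume "\<exists>y. x = outer y"
          then obtain y where y: "x = outer y" ..
          then have "label i j y = label i j x0" "b = label i j x0" using r x x0 by blast+
          then show ?thesis by (simp add: y mouter)
        next
          assume "\<exists>n. x = Inr (Inl n)"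
          moreover have "b \<in> F D" if "D \<in> K" "x \<in> D" for D
          proof -
            have "D = C" using uniq[OF that(1) C(1) that(2) x] .
            then show ?thesis using F_outer[of C x0] C(1) x0 r[THEN conjunct1] by (simp add: K_def)
          qed
          ultimately show ?thesis by (auto simp: m'_def)
        qed
      qed
    qed
    then have "(\<Sum>b<N. \<Prod>x\<in>C. m' x b) = (\<Sum>b<N. of_bool (b = label i j x0) *
        of_bool (\<forall>x\<in>outer -` C. \<forall>y\<in>outer -` C. label i j x = label i j y))"
      by (simp only: pr of_bool_conj)
    also have "\<dots> = of_bool (\<forall>x\<in>outer -` C. \<forall>y\<in>outer -` C. label i j x = label i j y)"
      unfolding sum_distrib_right[symmetric] using lN by (simp add: of_bool_def)
    finally show "(\<Sum>b<N. \<Prod>x\<in>C. m' x b) = \<dots>" .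
  qed
  also have "\<dots> = delta (pcomp q p) i j"
    using finK by (subst prod_of_bool) (auto simp: delta_def pcomp_def K_def)
  finally show ?thesis .
qed

section \<open>Matrices of the operations\<close>

lemma ltensor_lparts: "f \<in> lparts k l \<Longrightarrow> g \<in> lparts k' l' \<Longrightarrow> ltensor f g \<in> lparts (k + k') (l + l')"
  unfolding lparts_lspan ltensor_def by (rule bilinear_ext_lspan) (auto intro: ptensor_parts)

lemma linv_lparts: "f \<in> lparts k l \<Longrightarrow> linv f \<in> lparts l k"
  unfolding lparts_lspan by (rule linv_lspan) (auto intro: pinv_parts)

lemma lcomp_lparts: "g \<in> lparts l m \<Longrightarrow> f \<in> lparts k l \<Longrightarrow> lcomp N g f \<in> lparts k m"
  unfolding lparts_lspan lcomp_def
  by (rule bilinear_ext_lspan) (auto intro!: lspan_pscale pcomp_parts)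

lemma keys_lparts: "f \<in> lparts k l \<Longrightarrow> p \<in> Poly_Mapping.keys f \<Longrightarrow> p \<in> parts k l"
  by (auto simp: lparts_def)

lemma keys_ltparts: "f \<in> ltparts v w \<Longrightarrow> p \<in> Poly_Mapping.keys f \<Longrightarrow> p \<in> tparts v w"
  by (auto simp: ltparts_def)

lemma lin_mult_lin: "lin (\<lambda>p. lin (\<lambda>q. \<phi> p * \<psi> q) g) f = lin \<phi> f * lin \<psi> g"
proof -
  have "lin (\<lambda>q. \<phi> p * \<psi> q) g = lin \<psi> g * \<phi> p" for p
    by (simp add: lin_const_mult)
  then have "lin (\<lambda>p. lin (\<lambda>q. \<phi> p * \<psi> q) g) f = lin (\<lambda>p. lin \<psi> g * \<phi> p) f"
    by presburger
  then show ?thesis unfolding lin_const_mult by (simp add: mult.commute)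
qed

lemma T_map_ltensor:
  assumes f: "f \<in> lparts k l" and len: "length i = k" "length j = l"
  shows "T_map (ltensor f g) (j @ j') (i @ i') = T_map f j i * T_map g j' i'"
proof -
  have "T_map (ltensor f g) (j @ j') (i @ i') =
      lin (\<lambda>p. lin (\<lambda>q. delta p i j * delta q i' j') g) f"
    unfolding T_map_lin ltensor_def lin_bilinear_ext lin_basis_elt
    by (intro lin_cong) (rule delta_ptensor[OF keys_lparts[OF f] len])
  then show ?thesis by (simp add: lin_mult_lin T_map_lin)
qed

lemma T_map_linv: "T_map (linv f) j i = cnj (T_map f i j)"
proof -
  have "cnj (delta p i j) = delta p i j" for p i j by (simp add: delta_def)
  then show ?thesis unfolding T_map_lin lin_linv by (simp add: delta_pinv)
qed

text \<open>The case of \<open>sum_delta_comp\<close> with all labels allowed in the middle: a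
  removed component then counts \<open>N\<close> labels, which is the factor in the definition of
  the composition.\<close>

lemma T_map_lcomp:
  assumes g: "g \<in> lparts l m" and f: "f \<in> lparts k l"
    and i: "i \<in> multi_idx N k" and j: "j \<in> multi_idx N m"
  shows "T_map (lcomp N g f) j i = (\<Sum>h\<in>multi_idx N l. T_map g j h * T_map f h i)"
proof -
  have "of_nat N ^ card (removed q p) * delta (pcomp q p) i j =
      (\<Sum>h\<in>multi_idx N l. delta q h j * delta p i h)"
    if p: "p \<in> parts k l" and q: "q \<in> parts l m" for p q
  proof -
    have l: "label i j x < N" if "outer x \<in> C" "C \<in> components q p" for x C
    proof -
      have "outer x \<in> \<Union>(stack q p)"
        using components_partition[of q p] that unfolding partition_on_def by blast
      then show ?thesis unfolding Union_stack[OF p q] outer_def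
        using multi_idx_nth[OF i] multi_idx_nth[OF j] by (cases x) auto
    qed
    have "{h \<in> multi_idx N l. \<forall>n<l. \<forall>C\<in>components q p. Inr (Inl n) \<in> C \<longrightarrow> h ! n \<in> {..<N}} = multi_idx N l"
      using multi_idx_nth by auto
    then show ?thesis using sum_delta_comp[OF p q i j, of "\<lambda>_. {..<N}"] l by auto
  qed
  then have "T_map (lcomp N g f) j i =
     lin (\<lambda>q. lin (\<lambda>p. \<Sum>h\<in>multi_idx N l. delta q h j * delta p i h) f) g"
    unfolding T_map_lin lcomp_def lin_bilinear_ext lin_pscale lin_basis_elt
    by (intro lin_cong) (auto dest: keys_lparts[OF f] keys_lparts[OF g])
  then show ?thesis by (simp add: lin_sum_functional lin_mult_lin T_map_lin)
qed

section \<open>Matrices in the presence of extra singletons\<close>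

lemma word_idx_nth: "i \<in> word_idx N w \<Longrightarrow> n < length w \<Longrightarrow> i ! n \<in> color_idx N (w ! n)"
  by (simp add: word_idx_def)

lemma word_idx_subset: "0 < N \<Longrightarrow> word_idx N w \<subseteq> multi_idx N (length w)"
proof
  assume N: "0 < N"
  fix i assume i: "i \<in> word_idx N w"
  show "i \<in> multi_idx N (length w)"
  proof (rule multi_idxI)
    show "length i = length w" using i by (simp add: word_idx_def)
    fix n assume "n < length w"
    then have "i ! n \<in> color_idx N (w ! n)" using i by (simp add: word_idx_def)
    then show "i ! n < N" using N by (auto simp: color_idx_def split: color.splits)
  qed
qed

lemma tparts_parts: "p \<in> tparts v w \<Longrightarrow> p \<in> parts (length v) (length w)"
  by (simp add: tparts_def)

lemma ltparts_lparts: "f \<in> ltparts v w \<Longrightarrow> f \<in> lparts (length v) (length w)"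
  by (auto simp: ltparts_def lparts_def dest: tparts_parts)

lemma tri_Inl_singleton: "p \<in> tparts v w \<Longrightarrow> n < length v \<Longrightarrow> v ! n = Tri \<Longrightarrow> {Inl n} \<in> p"
  and tri_Inr_singleton: "p \<in> tparts v w \<Longrightarrow> n' < length w \<Longrightarrow> w ! n' = Tri \<Longrightarrow> {Inr n'} \<in> p"
  by (auto simp: tparts_def tri_points_def color_of_def)

lemma tri_block:
  assumes p: "p \<in> tparts v w" and B: "B \<in> p" and x: "x \<in> B" "x \<in> tri_points v w"
  shows "B = {x}"
proof -
  have "{x} \<in> p" using p x by (simp add: tparts_def)
  then show ?thesis using parts_block_unique[OF tparts_parts[OF p] B _ x(1)] by blast
qed

text \<open>Triangle points are singleton blocks, and a singleton block imposes no condition on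
  labels. So their deletion is invisible to \<open>delta\<close>, and \<open>tT_map\<close> is just
  \<open>T_map\<close> cut down to the indices of the words.\<close>

lemma delta_delete_points:
  assumes p: "p \<in> tparts v w"
  shows "delta (delete_points (tri_points v w) p) i j = delta p i j"
proof -
  let ?X = "tri_points v w"
  have "block_const p a \<longleftrightarrow> block_const ((\<lambda>B. B - ?X) ` p - {{}}) a" for a :: "point \<Rightarrow> nat"
  proof -
    have "(\<forall>x\<in>B. \<forall>y\<in>B. a x = a y) \<longleftrightarrow> (\<forall>x\<in>B - ?X. \<forall>y\<in>B - ?X. a x = a y)" if "B \<in> p" for B
    proof (cases "B \<inter> ?X = {}")
      case True
      then have "B - ?X = B" by blast
      then show ?thesis by simp
    next
      case False
      then obtain x where "B = {x}" "x \<in> ?X" using tri_block[OF p \<open>B \<in> p\<close>] by blast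
      then show ?thesis by simp
    qed
    moreover have "block_const ((\<lambda>B. B - ?X) ` p - {{}}) a \<longleftrightarrow> block_const ((\<lambda>B. B - ?X) ` p) a"
      unfolding block_const_def by (metis (no_types, lifting) Diff_iff empty_iff insertE)
    ultimately show ?thesis unfolding block_const_def ball_simps(9) by metis
  qed
  then show ?thesis by (simp add: delta_block_const delete_points_def)
qed

lemma tT_map_T_map:
  assumes "f \<in> ltparts v w"
  shows "tT_map N v w f j i = (if i \<in> word_idx N v \<and> j \<in> word_idx N w then T_map f j i else 0)"
  unfolding tT_map_def T_map_def using keys_ltparts[OF assms] by (simp add: delta_delete_points)

text \<open>An outer triangle point is alone in its block, so stacking attaches nothing to it and it
  is a component by itself.\<close>

lemma pcomp_tparts:
  assumes p: "p \<in> tparts u v" and q: "q \<in> tparts v w"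
  shows "pcomp q p \<in> tparts u w"
proof -
  note pp = tparts_parts[OF p] and qp = tparts_parts[OF q]
  have "{x} \<in> pcomp q p" if x: "x \<in> tri_points u w" for x
  proof -
    have "outer x \<in> \<Union>(stack q p)"
      using x unfolding Union_stack[OF pp qp] by (auto simp: tri_points_def points_def outer_def)
    then obtain C where C: "C \<in> components q p" "outer x \<in> C"
      using components_partition[of q p] unfolding partition_on_def by blast
    have "C = {outer x}"
    proof (rule component_singleton[OF C])
      fix B assume B: "B \<in> stack q p" "outer x \<in> B"
      show "B = {outer x}"
      proof (cases x)
        case (Inl n)
        then obtain B' where B': "B' \<in> p" "B = map_sum id Inl ` B'" "Inl n \<in> B'"
          using B unfolding stack_def outer_def by (auto simp: map_sum_def split: sum.splits)
        have "Inl n \<in> tri_points u v"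
          using x Inl by (auto simp: tri_points_def color_of_def)
        then show ?thesis using tri_block[OF p B'(1,3)] B' Inl by (simp add: outer_def)
      next
        case (Inr n)
        then obtain B' where B': "B' \<in> q" "B = Inr ` B'" "Inr n \<in> B'"
          using B unfolding stack_def outer_def by (auto simp: map_sum_def split: sum.splits)
        have "Inr n \<in> tri_points v w"
          using x Inr by (auto simp: tri_points_def color_of_def)
        then show ?thesis using tri_block[OF q B'(1,3)] B' Inr by (simp add: outer_def)
      qed
    qed
    then have "outer -` C = {x}" by (auto simp: outer_def map_sum_def split: sum.splits)
    then show ?thesis using C unfolding pcomp_vimage by (metis DiffI empty_not_insert image_eqI singletonD)
  qed
  then show ?thesis using pcomp_parts[OF pp qp] by (simp add: tparts_def)
qed

text \<open>A component with a triangle point is that point alone, so each component has one color.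
  The label sets \<open>{N - 1}\<close> and \<open>{..<N - 1}\<close> then have 1 and N - 1
  elements, the two factors of the composition with extra singletons.\<close>

lemma T_map_tcomp:
  assumes g: "g \<in> ltparts v w" and f: "f \<in> ltparts u v" and N: "0 < N"
    and i: "i \<in> word_idx N u" and j: "j \<in> word_idx N w"
  shows "T_map (tcomp N v g f) j i = (\<Sum>h\<in>word_idx N v. T_map g j h * T_map f h i)"
proof -
  define col where "col = case_sum ((!) u) (case_sum ((!) v) ((!) w))"
  define F where "F C = (if \<exists>x\<in>C. col x = Tri then {N - 1} else {..<N - 1})" for C
  have "(\<Prod>C\<in>removed q p. removed_factor N v C) * delta (pcomp q p) i j =
      (\<Sum>h\<in>word_idx N v. delta q h j * delta p i h)"
    if p: "p \<in> tparts u v" and q: "q \<in> tparts v w" for p q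
  proof -
    note pp = tparts_parts[OF p] and qp = tparts_parts[OF q]
    have CU: "C \<subseteq> \<Union>(stack q p)" if "C \<in> components q p" for C
      using components_partition[of q p] that unfolding partition_on_def by blast
    have single: "C = {x}" if C: "C \<in> components q p" "x \<in> C" and x: "col x = Tri" for C x
    proof (rule component_singleton[OF C])
      fix B assume B: "B \<in> stack q p" "x \<in> B"
      have xU: "x \<in> \<Union>(stack q p)" using B by blast
      from B(1) consider B' where "B' \<in> p" "B = map_sum id Inl ` B'" | B' where "B' \<in> q" "B = Inr ` B'"
        unfolding stack_def by blast
      then show "B = {x}"
      proof cases
        case 1
        then obtain y where y: "y \<in> B'" "x = map_sum id Inl y" using B by blast
        have "y \<in> tri_points u v"
          using x y parts_subset_points[OF pp 1(1)]
          by (cases y) (auto simp: tri_points_def color_of_def col_def)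
        then show ?thesis using tri_block[OF p 1(1) y(1)] y 1 by simp
      next
        case 2
        then obtain y where y: "y \<in> B'" "x = Inr y" using B by blast
        have "y \<in> tri_points v w"
          using x y parts_subset_points[OF qp 2(1)]
          by (cases y) (auto simp: tri_points_def color_of_def col_def)
        then show ?thesis using tri_block[OF q 2(1) y(1)] y 2 by simp
      qed
    qed
    have F_eq: "F C = color_idx N (col x)" if "C \<in> components q p" "x \<in> C" for C x
    proof (cases "\<exists>y\<in>C. col y = Tri")
      case True
      then obtain y where "y \<in> C" "col y = Tri" ..
      then have "C = {y}" using single that by blast
      then show ?thesis using that \<open>col y = Tri\<close> by (simp add: F_def color_idx_def)
    next
      case False
      then have "col x = Ell" using that by (metis color.exhaust)
      then show ?thesis using False by (auto simp: F_def color_idx_def)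
    qed
    have i': "i \<in> multi_idx N (length u)" and j': "j \<in> multi_idx N (length w)"
      using i j word_idx_subset[OF N] by blast+
    have sub: "F C \<subseteq> {..<N}" for C using N by (auto simp: F_def)
    have lab: "label i j x \<in> F C" if "C \<in> components q p" "outer x \<in> C" for C x
    proof -
      have "outer x \<in> \<Union>(stack q p)" using CU that by blast
      then have "label i j x \<in> color_idx N (col (outer x))"
        unfolding Union_stack[OF pp qp] outer_def
        using word_idx_nth[OF i] word_idx_nth[OF j] by (cases x) (auto simp: col_def)
      then show ?thesis using F_eq[OF that] by simp
    qed
    have "{h \<in> multi_idx N (length v). \<forall>n<length v. \<forall>C\<in>components q p. Inr (Inl n) \<in> C \<longrightarrow> h ! n \<in> F C}
       = word_idx N v"
    proof -
      have "(\<forall>C\<in>components q p. Inr (Inl n) \<in> C \<longrightarrow> h ! n \<in> F C) \<longleftrightarrow> h ! n \<in> color_idx N (v ! n)"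
        if n: "n < length v" for h n
      proof -
        have "Inr (Inl n) \<in> \<Union>(stack q p)" using n unfolding Union_stack[OF pp qp] by auto
        then obtain C where "C \<in> components q p" "Inr (Inl n) \<in> C"
          using components_partition[of q p] unfolding partition_on_def by blast
        moreover have "col (Inr (Inl n)) = v ! n" by (simp add: col_def)
        ultimately show ?thesis using F_eq by metis
      qed
      then show ?thesis using word_idx_subset[OF N, of v]
        by (auto simp: word_idx_def multi_idx_def)
    qed
    moreover have "removed_factor N v C = of_nat (card (F C))" if "C \<in> removed q p" for C
    proof -
      have C: "C \<in> components q p" "outer -` C = {}" using that by (auto simp: removed_def)
      then have "outer x \<notin> C" for x by auto
      then have "\<exists>n. x = Inr (Inl n)" if "x \<in> C" for x
        using that by (metis id_apply map_sum.simps outer_def sum.exhaust)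
      then have "(\<exists>x\<in>C. col x = Tri) \<longleftrightarrow> (\<exists>n. Inr (Inl n) \<in> C \<and> v ! n = Tri)"
        by (force simp: col_def)
      then show ?thesis using N unfolding removed_factor_def F_def by (auto simp: of_nat_diff)
    qed
    ultimately show ?thesis
      using sum_delta_comp[OF pp qp i' j', of F, OF sub lab] by simp
  qed
  then have "T_map (tcomp N v g f) j i =
     lin (\<lambda>q. lin (\<lambda>p. \<Sum>h\<in>word_idx N v. delta q h j * delta p i h) f) g"
    unfolding T_map_lin tcomp_def lin_bilinear_ext lin_pscale lin_basis_elt
    by (intro lin_cong) (auto dest: keys_ltparts[OF f] keys_ltparts[OF g])
  then show ?thesis by (simp add: lin_sum_functional lin_mult_lin T_map_lin)
qed

lemma ptensor_tparts:
  assumes p: "p \<in> tparts v w" and q: "q \<in> tparts v' w'"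
  shows "ptensor p q \<in> tparts (v @ v') (w @ w')"
proof -
  note pp = tparts_parts[OF p] and qp = tparts_parts[OF q]
  have "{x} \<in> ptensor p q" if x: "x \<in> tri_points (v @ v') (w @ w')" for x
  proof (cases x)
    case (Inl n)
    show ?thesis
    proof (cases "n < length v")
      case True
      then have "{Inl n} \<in> p" using x Inl p
        by (auto simp: tri_points_def color_of_def nth_append intro: tri_Inl_singleton)
      then show ?thesis by (simp add: Inl ptensor_def)
    next
      case False
      then have "{Inl (n - length v)} \<in> q" using x Inl q
        by (auto simp: tri_points_def color_of_def nth_append intro: tri_Inl_singleton)
      then have "map_sum ((+) (n_up p)) ((+) (n_low p)) ` {Inl (n - length v)} \<in> ptensor p q"
        unfolding ptensor_def by blast
      then show ?thesis using False pp by (simp add: Inl)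
    qed
  next
    case (Inr n)
    show ?thesis
    proof (cases "n < length w")
      case True
      then have "{Inr n} \<in> p" using x Inr p
        by (auto simp: tri_points_def color_of_def nth_append intro: tri_Inr_singleton)
      then show ?thesis by (simp add: Inr ptensor_def)
    next
      case False
      then have "{Inr (n - length w)} \<in> q" using x Inr q
        by (auto simp: tri_points_def color_of_def nth_append intro: tri_Inr_singleton)
      then have "map_sum ((+) (n_up p)) ((+) (n_low p)) ` {Inr (n - length w)} \<in> ptensor p q"
        unfolding ptensor_def by blast
      then show ?thesis using False pp by (simp add: Inr)
    qed
  qed
  then show ?thesis using ptensor_parts[OF pp qp] by (simp add: tparts_def)
qed

lemma ltensor_ltparts:
  "f \<in> ltparts v w \<Longrightarrow> g \<in> ltparts v' w' \<Longrightarrow> ltensor f g \<in> ltparts (v @ v') (w @ w')"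
  unfolding ltparts_lspan ltensor_def by (rule bilinear_ext_lspan) (auto intro: ptensor_tparts)

lemma pinv_tparts:
  assumes p: "p \<in> tparts v w"
  shows "pinv p \<in> tparts w v"
proof -
  have "{x} \<in> pinv p" if x: "x \<in> tri_points w v" for x
  proof -
    let ?f = "case_sum Inr Inl :: point \<Rightarrow> point"
    have "?f x \<in> tri_points v w"
      using x by (cases x) (auto simp: tri_points_def color_of_def)
    then have "{?f x} \<in> p" using p by (simp add: tparts_def)
    then have "?f ` {?f x} \<in> pinv p" unfolding pinv_def by blast
    then show ?thesis by (cases x) auto
  qed
  then show ?thesis using pinv_parts[OF tparts_parts[OF p]] by (simp add: tparts_def)
qed

section \<open>Faithfulness in large dimension\<close>

text \<open>The labeling by the blocks of a finest partition \<open>p\<close> in the support kills all other partitions.\<close>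

lemma T_map_faithful:
  assumes f: "f \<in> ltparts v w" and N: "length v + length w < N"
    and T: "\<And>i j. i \<in> word_idx N v \<Longrightarrow> j \<in> word_idx N w \<Longrightarrow> T_map f j i = 0"
  shows "f = 0"
proof (rule ccontr)
  assume "f \<noteq> 0"
  then have ne: "Poly_Mapping.keys f \<noteq> {}" by simp
  \<comment> \<open>A maximal number of blocks is a convenient form of being finest: a strict
    refinement would have more blocks.\<close>
  obtain p where p: "p \<in> Poly_Mapping.keys f" and "card p = Max (card ` Poly_Mapping.keys f)"
    using obtains_MAX[OF finite_keys ne, of card] by metis
  then have max: "card q \<le> card p" if "q \<in> Poly_Mapping.keys f" for q
    using that by simp
  have pt: "p \<in> tparts v w" using keys_ltparts[OF f p] .
  note pp = tparts_parts[OF pt]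
  let ?X = "points (length v) (length w)"
  have fp: "finite p" using finite_parts_member[OF pp] .
  have some: "(SOME x. x \<in> B) \<in> B" if "q \<in> tparts v w" "B \<in> q" for q B
    using parts_nonempty[OF tparts_parts[OF that(1)] that(2)] by (simp add: some_in_eq)
  have "inj_on (\<lambda>B. SOME x. x \<in> B) p"
  proof (rule inj_onI)
    fix B C assume B: "B \<in> p" and C: "C \<in> p" and eq: "(SOME x. x \<in> B) = (SOME x. x \<in> C)"
    show "B = C" using parts_block_unique[OF pp B C some[OF pt B]] some[OF pt C] eq by simp
  qed
  moreover have "(\<lambda>B. SOME x. x \<in> B) ` p \<subseteq> ?X"
    using some[OF pt] parts_subset_points[OF pp] by blast
  ultimately have "card p \<le> card ?X" by (simp add: card_inj_on_le)
  also have "card ?X = length v + length w"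
    unfolding points_def by (subst card_Un_disjoint) (auto simp: card_image)
  finally have "card p \<le> N - 1" using N by linarith
  \<comment> \<open>There are at most as many blocks as points, hence fewer than \<open>N\<close>,
    so the blocks get distinct labels below \<open>N - 1\<close>; the label \<open>N - 1\<close>
    stays reserved for triangle points, as the words require.\<close>
  then obtain e where e: "inj_on e p" "e ` p \<subseteq> {..<N - 1}"
    using fp card_le_inj[of p "{..<N - 1}"] by auto
  define bl where "bl x = (THE B. B \<in> p \<and> x \<in> B)" for x
  have bl: "bl x = B" if "B \<in> p" "x \<in> B" for x B
    unfolding bl_def by (rule the_equality) (use that parts_block_unique[OF pp] in auto)
  have blP: "bl x \<in> p \<and> x \<in> bl x" if "x \<in> ?X" for x
    using that bl Union_parts[OF pp] by (metis UnionE)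
  define a where "a x = (if x \<in> tri_points v w then N - 1 else e (bl x))" for x
  define i where "i = map (\<lambda>n. a (Inl n)) [0..<length v]"
  define j where "j = map (\<lambda>n. a (Inr n)) [0..<length w]"
  have lab: "label i j x = a x" if "x \<in> ?X" for x
    using that by (auto simp: i_def j_def points_def)
  have eN: "e (bl x) < N - 1" if "x \<in> ?X" for x using blP[OF that] e by blast
  have i: "i \<in> word_idx N v"
    unfolding word_idx_def i_def a_def color_idx_def using eN
    by (auto simp: tri_points_def color_of_def split: color.splits)
  have j: "j \<in> word_idx N w"
    unfolding word_idx_def j_def a_def color_idx_def using eN
    by (auto simp: tri_points_def color_of_def split: color.splits)
  have "delta q i j = of_bool (q = p)" if q: "q \<in> Poly_Mapping.keys f" for q
  proof -
    have qt: "q \<in> tparts v w" using keys_ltparts[OF f q] .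
    note qp = tparts_parts[OF qt]
    have "delta q i j = of_bool (block_const q a)"
      unfolding delta_block_const using block_const_cong[of q "label i j" a] lab Union_parts[OF qp] by simp
    moreover have "block_const q a \<longleftrightarrow> q = p"
    proof
      assume "q = p"
      have "a x = a y" if "B \<in> p" "x \<in> B" "y \<in> B" for B x y
        using that bl tri_block[OF pt] unfolding a_def by (metis singletonD)
      then show "block_const q a" unfolding \<open>q = p\<close> block_const_def by blast
    next
      assume c: "block_const q a"
      have sub: "B \<subseteq> bl x" if B: "B \<in> q" "x \<in> B" for B x
      proof
        fix y assume y: "y \<in> B"
        have xy: "x \<in> ?X" "y \<in> ?X" using B y parts_subset_points[OF qp] by blast+
        show "y \<in> bl x"
        proof (cases "B \<inter> tri_points v w = {}")
          case False
          then have "y = x" using tri_block[OF qt B(1)] B y by blast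
          then show ?thesis using blP xy by blast
        next
          case True
          then have "a x = e (bl x)" "a y = e (bl y)" using B y by (auto simp: a_def)
          moreover have "a x = a y" using c B y unfolding block_const_def by blast
          ultimately have "bl x = bl y" using e(1) blP xy by (metis inj_onD)
          then show ?thesis using blP xy by metis
        qed
      qed
      \<comment> \<open>If the labeling is constant on the blocks of \<open>q\<close>, every block
        \<open>B\<close> of \<open>q\<close> lies in the block \<open>\<beta> B\<close> of
        \<open>p\<close>, so \<open>q\<close> refines \<open>p\<close>. By maximality
        \<open>q\<close> has no more blocks than \<open>p\<close>, which makes
        \<open>\<beta>\<close> injective and then the identity.\<close>
      define \<beta> where "\<beta> B = bl (SOME x. x \<in> B)" for B
      have \<beta>: "B \<subseteq> \<beta> B" "\<beta> B \<in> p" if B: "B \<in> q" for B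
        using sub[OF B some[OF qt B]] blP parts_subset_points[OF qp B] some[OF qt B]
        unfolding \<beta>_def by blast+
      have surj: "\<beta> ` q = p"
      proof
        show "\<beta> ` q \<subseteq> p" using \<beta> by blast
        show "p \<subseteq> \<beta> ` q"
        proof
          fix C assume C: "C \<in> p"
          then obtain x where x: "x \<in> C" using parts_nonempty[OF pp] by blast
          then have "x \<in> ?X" using C parts_subset_points[OF pp] by blast
          then obtain B where B: "B \<in> q" "x \<in> B" using Union_parts[OF qp] by blast
          have "x \<in> \<beta> B" using \<beta>(1)[OF B(1)] B(2) by blast
          then have "\<beta> B = C" by (rule parts_block_unique[OF pp \<beta>(2)[OF B(1)] C _ x])
          then show "C \<in> \<beta> ` q" using B by blast
        qed
      qed
      have inj: "inj_on \<beta> q"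
      proof (rule eq_card_imp_inj_on)
        show "finite q" using finite_parts_member[OF qp] .
        have "card p \<le> card q" using surj card_image_le[OF \<open>finite q\<close>, of \<beta>] by simp
        then show "card (\<beta> ` q) = card q" using max[OF q] surj by simp
      qed
      have "\<beta> B = B" if B: "B \<in> q" for B
      proof (rule equalityI[OF _ \<beta>(1)[OF B]], rule subsetI)
        fix y assume y: "y \<in> \<beta> B"
        then have "y \<in> ?X" using \<beta>(2)[OF B] parts_subset_points[OF pp] by blast
        then obtain B' where B': "B' \<in> q" "y \<in> B'" using Union_parts[OF qp] by blast
        have "y \<in> \<beta> B'" using \<beta>(1)[OF B'(1)] B'(2) by blast
        then have "\<beta> B' = \<beta> B"
          by (rule parts_block_unique[OF pp \<beta>(2)[OF B'(1)] \<beta>(2)[OF B] _ y])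
        then show "y \<in> B" using inj B B' by (metis inj_onD)
      qed
      then show "q = p" using surj by simp
    qed
    ultimately show ?thesis by simp
  qed
  then have "T_map f j i = lin (\<lambda>q. of_bool (q = p)) f"
    unfolding T_map_lin by (rule lin_cong)
  also have "\<dots> = Poly_Mapping.lookup f p" by (simp add: lookup_eq_lin)
  finally show False using T[OF i j] p by (simp add: in_keys_iff)
qed

section \<open>Interpolation in the parameter\<close>

text \<open>The variable is sqrt N rather than N because of the entries of U. The denominator must
  be free of zeros at every N \<ge> 2 and not just at large N, since otherwise an identity could not
  be carried down to small N.\<close>

definition ratfam :: "(nat \<Rightarrow> complex) \<Rightarrow> bool"
  where "ratfam f \<longleftrightarrow> (\<exists>P Q. \<forall>N\<ge>2. poly Q (of_real (sqrt (real N))) \<noteq> 0 \<and>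
    f N = poly P (of_real (sqrt (real N))) / poly Q (of_real (sqrt (real N))))"

lemma ratfam_const [simp, intro]: "ratfam (\<lambda>N. c)"
  unfolding ratfam_def by (rule exI[of _ "[:c:]"], rule exI[of _ 1]) simp

lemma ratfam_sqrt: "ratfam (\<lambda>N. of_real (sqrt (real N)))"
  unfolding ratfam_def by (rule exI[of _ "[:0, 1:]"], rule exI[of _ 1]) simp

lemma ratfam_cong: "(\<And>N. 2 \<le> N \<Longrightarrow> f N = g N) \<Longrightarrow> ratfam f = ratfam g"
  by (simp add: ratfam_def)

lemma ratfam_add: "ratfam f \<Longrightarrow> ratfam g \<Longrightarrow> ratfam (\<lambda>N. f N + g N)"
proof -
  assume "ratfam f" "ratfam g"
  then obtain P Q P' Q' where *: "\<And>N. 2 \<le> N \<Longrightarrow> poly Q (of_real (sqrt (real N))) \<noteq> 0 \<and>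
    f N = poly P (of_real (sqrt (real N))) / poly Q (of_real (sqrt (real N)))"
    "\<And>N. 2 \<le> N \<Longrightarrow> poly Q' (of_real (sqrt (real N))) \<noteq> 0 \<and>
    g N = poly P' (of_real (sqrt (real N))) / poly Q' (of_real (sqrt (real N)))"
    unfolding ratfam_def by blast
  show ?thesis unfolding ratfam_def
    by (rule exI[of _ "P * Q' + P' * Q"], rule exI[of _ "Q * Q'"]) (use * in \<open>auto simp: field_simps\<close>)
qed

lemma ratfam_mult: "ratfam f \<Longrightarrow> ratfam g \<Longrightarrow> ratfam (\<lambda>N. f N * g N)"
proof -
  assume "ratfam f" "ratfam g"
  then obtain P Q P' Q' where *: "\<And>N. 2 \<le> N \<Longrightarrow> poly Q (of_real (sqrt (real N))) \<noteq> 0 \<and>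
    f N = poly P (of_real (sqrt (real N))) / poly Q (of_real (sqrt (real N)))"
    "\<And>N. 2 \<le> N \<Longrightarrow> poly Q' (of_real (sqrt (real N))) \<noteq> 0 \<and>
    g N = poly P' (of_real (sqrt (real N))) / poly Q' (of_real (sqrt (real N)))"
    unfolding ratfam_def by blast
  show ?thesis unfolding ratfam_def
    by (rule exI[of _ "P * P'"], rule exI[of _ "Q * Q'"]) (use * in auto)
qed

lemma ratfam_sum: "(\<And>i. i \<in> I \<Longrightarrow> ratfam (f i)) \<Longrightarrow> ratfam (\<lambda>N. \<Sum>i\<in>I. f i N)"
  by (induction I rule: infinite_finite_induct) (auto intro: ratfam_add)

lemma ratfam_prod: "(\<And>i. i \<in> I \<Longrightarrow> ratfam (f i)) \<Longrightarrow> ratfam (\<lambda>N. \<Prod>i\<in>I. f i N)"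
  by (induction I rule: infinite_finite_induct) (auto intro: ratfam_mult)

lemma ratfam_power: "ratfam f \<Longrightarrow> ratfam (\<lambda>N. f N ^ n)"
  by (induction n) (auto intro: ratfam_mult)

lemma ratfam_uminus: "ratfam f \<Longrightarrow> ratfam (\<lambda>N. - f N)"
  using ratfam_mult[of "\<lambda>_. -1" f] by simp

lemma ratfam_diff: "ratfam f \<Longrightarrow> ratfam g \<Longrightarrow> ratfam (\<lambda>N. f N - g N)"
  using ratfam_add[OF _ ratfam_uminus] by simp

lemma ratfam_inverse:
  assumes "ratfam f" "\<And>N. 2 \<le> N \<Longrightarrow> f N \<noteq> 0"
  shows "ratfam (\<lambda>N. inverse (f N))"
proof -
  obtain P Q where *: "\<And>N. 2 \<le> N \<Longrightarrow> poly Q (of_real (sqrt (real N))) \<noteq> 0 \<and>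
    f N = poly P (of_real (sqrt (real N))) / poly Q (of_real (sqrt (real N)))"
    using assms(1) unfolding ratfam_def by blast
  show ?thesis unfolding ratfam_def
    by (rule exI[of _ Q], rule exI[of _ P]) (use * assms(2) in \<open>force simp: field_simps\<close>)
qed

lemma ratfam_divide:
  "ratfam f \<Longrightarrow> ratfam g \<Longrightarrow> (\<And>N. 2 \<le> N \<Longrightarrow> g N \<noteq> 0) \<Longrightarrow> ratfam (\<lambda>N. f N / g N)"
  unfolding divide_inverse by (intro ratfam_mult ratfam_inverse)

lemma ratfam_of_nat: "ratfam (\<lambda>N. of_nat N)"
proof -
  have "ratfam (\<lambda>N. of_real (sqrt (real N)) * of_real (sqrt (real N)))"
    by (intro ratfam_mult ratfam_sqrt)
  then show ?thesis by (simp flip: of_real_mult)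
qed

text \<open>As sqrt N is real, conjugating the value amounts to conjugating the coefficients of both
  polynomials.\<close>

lemma ratfam_cnj: "ratfam f \<Longrightarrow> ratfam (\<lambda>N. cnj (f N))"
proof -
  assume "ratfam f"
  then obtain P Q where *: "\<And>N. 2 \<le> N \<Longrightarrow> poly Q (of_real (sqrt (real N))) \<noteq> 0 \<and>
    f N = poly P (of_real (sqrt (real N))) / poly Q (of_real (sqrt (real N)))"
    unfolding ratfam_def by blast
  show ?thesis unfolding ratfam_def
    by (rule exI[of _ "map_poly cnj P"], rule exI[of _ "map_poly cnj Q"]) (use * in auto)
qed

text \<open>The numbers sqrt N are pairwise distinct, so the numerator has infinitely many roots and
  is the zero polynomial.\<close>

lemma ratfam_zero:
  assumes f: "ratfam f" and large: "\<And>N. m \<le> N \<Longrightarrow> f N = 0" and N: "2 \<le> N"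
  shows "f N = 0"
proof -
  obtain P Q where *: "\<And>N. 2 \<le> N \<Longrightarrow> poly Q (of_real (sqrt (real N))) \<noteq> 0 \<and>
    f N = poly P (of_real (sqrt (real N))) / poly Q (of_real (sqrt (real N)))"
    using f unfolding ratfam_def by blast
  have "infinite ((\<lambda>N. of_real (sqrt (real N)) :: complex) ` {max 2 m..})"
    by (subst finite_image_iff) (auto simp: inj_on_def infinite_Ici)
  moreover have "(\<lambda>N. of_real (sqrt (real N)) :: complex) ` {max 2 m..} \<subseteq> {x. poly P x = 0}"
    using * large by fastforce
  ultimately have "P = 0" using poly_roots_finite finite_subset by blast
  then show ?thesis using *[OF N] by simp
qed

text \<open>
  Families indexed by \<open>N\<close>; the values at \<open>N < 2\<close>, where divisions by \<open>N\<close> and \<open>N - 1\<close> degenerate, do not matter.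
\<close>

definition lfam :: "part set \<Rightarrow> (nat \<Rightarrow> lpart) \<Rightarrow> bool"
  where "lfam S F \<longleftrightarrow> (\<forall>N\<ge>2. F N \<in> lspan S) \<and> (\<forall>p. ratfam (\<lambda>N. Poly_Mapping.lookup (F N) p))"

lemma lfam_const: "f \<in> lspan S \<Longrightarrow> lfam S (\<lambda>N. f)"
  by (simp add: lfam_def)

lemma lookup_basis_elt: "Poly_Mapping.lookup (basis_elt p) r = of_bool (p = r)"
  by (simp add: basis_elt_def lookup_single when_def)

lemma lookup_sum: "Poly_Mapping.lookup (\<Sum>i\<in>I. F i) r = (\<Sum>i\<in>I. Poly_Mapping.lookup (F i) r)"
  by (induction I rule: infinite_finite_induct) (auto simp: lookup_add)

lemma lfam_sum: "(\<And>i. i \<in> I \<Longrightarrow> lfam S (F i)) \<Longrightarrow> lfam S (\<lambda>N. \<Sum>i\<in>I. F i N)"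
  unfolding lfam_def by (auto simp: lookup_sum intro!: lspan_sum ratfam_sum)

lemma lfam_add: "lfam S F \<Longrightarrow> lfam S G \<Longrightarrow> lfam S (\<lambda>N. F N + G N)"
  unfolding lfam_def by (auto simp: lookup_add intro!: lspan_add ratfam_add)

lemma lfam_diff: "lfam S F \<Longrightarrow> lfam S G \<Longrightarrow> lfam S (\<lambda>N. F N - G N)"
  unfolding lfam_def by (auto simp: lookup_minus intro!: lspan_diff ratfam_diff)

lemma lfam_pscale: "ratfam c \<Longrightarrow> lfam S F \<Longrightarrow> lfam S (\<lambda>N. pscale (c N) (F N))"
  unfolding lfam_def by (auto intro!: lspan_pscale ratfam_mult)

text \<open>All supports lie in the fixed finite set \<open>S\<close>. Summing over \<open>S\<close>
  removes the dependence of the index set on \<open>N\<close>, and the rules for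
  \<open>ratfam\<close> apply.\<close>

lemma ratfam_lin:
  assumes S: "finite S" and F: "lfam S F" and phi: "\<And>p. p \<in> S \<Longrightarrow> ratfam (\<lambda>N. \<phi> N p)"
  shows "ratfam (\<lambda>N. lin (\<phi> N) (F N))"
proof -
  have "ratfam (\<lambda>N. \<Sum>p\<in>S. Poly_Mapping.lookup (F N) p * \<phi> N p)"
    using F phi by (intro ratfam_sum ratfam_mult) (auto simp: lfam_def)
  moreover have "lin (\<phi> N) (F N) = (\<Sum>p\<in>S. Poly_Mapping.lookup (F N) p * \<phi> N p)" if "2 \<le> N" for N
    by (rule lin_superset[OF S]) (use F that in \<open>auto simp: lfam_def lspan_def\<close>)
  ultimately show ?thesis using ratfam_cong by (metis (no_types, lifting))
qed

lemma lfam_bilinear_ext: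
  assumes fin: "finite S" "finite S'" and F: "lfam S F" and G: "lfam S' G"
    and h: "\<And>p q. p \<in> S \<Longrightarrow> q \<in> S' \<Longrightarrow> lfam R (\<lambda>N. h N p q)"
  shows "lfam R (\<lambda>N. bilinear_ext (h N) (F N) (G N))"
  unfolding lfam_def
proof (intro conjI allI impI)
  fix N :: nat assume "2 \<le> N"
  then show "bilinear_ext (h N) (F N) (G N) \<in> lspan R"
    using F G h by (intro bilinear_ext_lspan) (auto simp: lfam_def)
next
  fix r
  have "lin (\<lambda>r'. of_bool (r' = r)) (h N p q) = Poly_Mapping.lookup (h N p q) r" for N p q
    by (simp add: lookup_eq_lin)
  then have "ratfam (\<lambda>N. lin (\<lambda>p. lin (\<lambda>q. lin (\<lambda>r'. of_bool (r' = r)) (h N p q)) (G N)) (F N))"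
    using h by (intro ratfam_lin[OF fin(1) F] ratfam_lin[OF fin(2) G]) (auto simp: lfam_def)
  then show "ratfam (\<lambda>N. Poly_Mapping.lookup (bilinear_ext (h N) (F N) (G N)) r)"
    by (simp only: lookup_eq_lin lin_bilinear_ext)
qed

section \<open>Operations applied to families\<close>

lemma finite_tparts [simp]: "finite (tparts v w)"
  by (rule finite_subset[of _ "parts (length v) (length w)"]) (auto dest: tparts_parts)

lemma lfam_ltensor:
  "lfam (parts k l) F \<Longrightarrow> lfam (parts k' l') G \<Longrightarrow>
    lfam (parts (k + k') (l + l')) (\<lambda>N. ltensor (F N) (G N))"
  unfolding ltensor_def
  by (rule lfam_bilinear_ext) (auto intro!: lfam_const ptensor_parts)

lemma lfam_ltensor_tri:
  "lfam (tparts v w) F \<Longrightarrow> lfam (tparts v' w') G \<Longrightarrow>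
    lfam (tparts (v @ v') (w @ w')) (\<lambda>N. ltensor (F N) (G N))"
  unfolding ltensor_def
  by (rule lfam_bilinear_ext) (auto intro!: lfam_const ptensor_tparts)

lemma lfam_lcomp:
  "lfam (parts l m) G \<Longrightarrow> lfam (parts k l) F \<Longrightarrow> lfam (parts k m) (\<lambda>N. lcomp N (G N) (F N))"
  unfolding lcomp_def
  by (rule lfam_bilinear_ext)
    (auto intro!: lfam_const lfam_pscale ratfam_power ratfam_of_nat pcomp_parts)

lemma lfam_tcomp:
  "lfam (tparts v w) G \<Longrightarrow> lfam (tparts u v) F \<Longrightarrow> lfam (tparts u w) (\<lambda>N. tcomp N v (G N) (F N))"
  unfolding tcomp_def
proof (rule lfam_bilinear_ext)
  have *: "ratfam (\<lambda>N. removed_factor N v C)" for C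
    unfolding removed_factor_def
    by (cases "\<exists>j. Inr (Inl j) \<in> C \<and> v ! j = Tri", simp_all only: if_True if_False)
      (intro ratfam_diff ratfam_of_nat ratfam_const)+
  show "lfam (tparts u w) (\<lambda>N. pscale (\<Prod>C\<in>removed q p. removed_factor N v C) (basis_elt (pcomp q p)))"
    if "q \<in> tparts v w" "p \<in> tparts u v" for q p
    using that by (intro lfam_pscale ratfam_prod *) (auto intro!: lfam_const pcomp_tparts)
qed auto

lemma lfam_linv_aux:
  assumes S: "finite S" and F: "lfam S F" and R: "\<And>p. p \<in> S \<Longrightarrow> pinv p \<in> R"
  shows "lfam R (\<lambda>N. linv (F N))"
  unfolding lfam_def
proof (intro conjI allI impI)
  fix N :: nat assume "2 \<le> N"
  then show "linv (F N) \<in> lspan R"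
    using F R by (intro linv_lspan) (auto simp: lfam_def)
next
  fix r
  show "ratfam (\<lambda>N. Poly_Mapping.lookup (linv (F N)) r)"
    unfolding lookup_eq_lin lin_linv by (intro ratfam_cnj ratfam_lin[OF S F]) auto
qed

lemma lfam_linv: "lfam (parts k l) F \<Longrightarrow> lfam (parts l k) (\<lambda>N. linv (F N))"
  by (rule lfam_linv_aux) (auto intro: pinv_parts)

lemma lfam_linv_tri: "lfam (tparts v w) F \<Longrightarrow> lfam (tparts w v) (\<lambda>N. linv (F N))"
  by (rule lfam_linv_aux) (auto intro: pinv_tparts)

text \<open>The interpolation principle. Once N exceeds the number of points, the matrices determine
  the combination, so all coefficients of the difference vanish there; being rational, they vanish
  at every N \<ge> 2. The price is that the matrix identity has to be shown for all N \<ge> 2, not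
  only for the one of interest.\<close>

lemma lfam_eqI_tri:
  assumes F: "lfam (tparts v w) F" and G: "lfam (tparts v w) G" and N: "2 \<le> N"
    and T: "\<And>N i j. \<lbrakk>2 \<le> N; i \<in> word_idx N v; j \<in> word_idx N w\<rbrakk> \<Longrightarrow> T_map (F N) j i = T_map (G N) j i"
  shows "F N = G N"
proof -
  have diff: "lfam (tparts v w) (\<lambda>N. F N - G N)" using lfam_diff[OF F G] .
  have large: "F N - G N = 0" if "length v + length w + 2 \<le> N" for N
  proof (rule T_map_faithful)
    show "F N - G N \<in> ltparts v w" using diff that by (simp add: ltparts_lspan lfam_def)
    show "T_map (F N - G N) j i = 0" if "i \<in> word_idx N v" "j \<in> word_idx N w" for i j
      using T[of N i j] that \<open>length v + length w + 2 \<le> N\<close> by (simp add: T_map_lin lin_diff)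
  qed (use that in simp)
  have "Poly_Mapping.lookup (F N - G N) p = 0" for p
    by (rule ratfam_zero[of "\<lambda>N. Poly_Mapping.lookup (F N - G N) p" "length v + length w + 2"])
      (use diff large N in \<open>auto simp: lfam_def\<close>)
  then show ?thesis by (intro poly_mapping_eqI) (simp add: lookup_minus)
qed

text \<open>Over words with the single color \<open>Ell\<close> there are no triangle points, so
  uncolored partitions are a special case; indices below N - 1 already suffice for the test.\<close>

lemma lfam_eqI:
  assumes F: "lfam (parts k l) F" and G: "lfam (parts k l) G" and N: "2 \<le> N"
    and T: "\<And>N i j. \<lbrakk>2 \<le> N; i \<in> multi_idx N k; j \<in> multi_idx N l\<rbrakk> \<Longrightarrow> T_map (F N) j i = T_map (G N) j i"
  shows "F N = G N"
proof -
  let ?v = "replicate k Ell" and ?w = "replicate l Ell"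
  have eq: "tparts ?v ?w = parts k l"
    by (auto simp: tparts_def tri_points_def color_of_def points_def)
  have sub: "word_idx N (replicate k Ell) \<subseteq> multi_idx N k" if "2 \<le> N" for N k
    using word_idx_subset[of N "replicate k Ell"] that by simp
  show ?thesis
  proof (rule lfam_eqI_tri[of ?v ?w F G, OF _ _ N])
    show "T_map (F M) j i = T_map (G M) j i"
      if "2 \<le> M" "i \<in> word_idx M ?v" "j \<in> word_idx M ?w" for M i j
      using T[OF that(1)] sub[OF that(1)] that(2,3) by blast
  qed (use F G in \<open>simp_all add: eq\<close>)
qed

section \<open>Laws of tensor product, composition and involution\<close>

lemma lfam_lparts: "f \<in> lparts k l \<Longrightarrow> lfam (parts k l) (\<lambda>N. f)"
  by (simp add: lfam_const lparts_lspan)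

text \<open>On matrices this is associativity of the product. A direct argument would have to match
  the numbers of removed components; here \<open>f\<close>, \<open>g\<close>, \<open>h\<close> are
  held fixed while the parameter of the composition varies.\<close>

lemma lcomp_assoc:
  assumes f: "f \<in> lparts k l" and g: "g \<in> lparts l m" and h: "h \<in> lparts m n" and N: "2 \<le> N"
  shows "lcomp N h (lcomp N g f) = lcomp N (lcomp N h g) f"
proof (rule lfam_eqI[of k n "\<lambda>N. lcomp N h (lcomp N g f)" "\<lambda>N. lcomp N (lcomp N h g) f", OF _ _ N])
  fix N i j assume "2 \<le> N" and i: "i \<in> multi_idx N k" and j: "j \<in> multi_idx N n"
  show "T_map (lcomp N h (lcomp N g f)) j i = T_map (lcomp N (lcomp N h g) f) j i"
    by (simp add: T_map_lcomp[OF h lcomp_lparts[OF g f] i j] T_map_lcomp[OF lcomp_lparts[OF h g] f i j]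
      T_map_lcomp[OF g f i] T_map_lcomp[OF h g _ j] sum_distrib_left sum_distrib_right mult.assoc cong: sum.cong)
     (rule sum.swap)
qed (use f g h in \<open>auto intro!: lfam_lcomp lfam_lparts\<close>)

lemma multi_idx_append:
  assumes "i \<in> multi_idx N (k + k')"
  obtains a b where "i = a @ b" "a \<in> multi_idx N k" "b \<in> multi_idx N k'"
proof
  show "i = take k i @ drop k i" by simp
  show "take k i \<in> multi_idx N k" "drop k i \<in> multi_idx N k'"
    using assms by (auto simp: multi_idx_def dest: in_set_takeD in_set_dropD)
qed

lemma sum_multi_idx_append:
  "(\<Sum>h\<in>multi_idx N (k + k'). f h) = (\<Sum>a\<in>multi_idx N k. \<Sum>b\<in>multi_idx N k'. f (a @ b))"
proof -
  have "(\<Sum>h\<in>multi_idx N (k + k'). f h) = (\<Sum>(a, b)\<in>multi_idx N k \<times> multi_idx N k'. f (a @ b))"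
    by (rule sum.reindex_bij_witness[where j = "\<lambda>h. (take k h, drop k h)" and i = "\<lambda>(a, b). a @ b"])
      (auto simp: multi_idx_def dest: in_set_takeD in_set_dropD)
  then show ?thesis by (simp add: sum.cartesian_product)
qed

text \<open>The interchange law, from the same law for Kronecker products: the middle index of a
  tensor product splits into two independent parts.\<close>

lemma ltensor_lcomp:
  assumes f: "f \<in> lparts k l" and g: "g \<in> lparts l m" and f': "f' \<in> lparts k' l'" and g': "g' \<in> lparts l' m'"
    and N: "2 \<le> N"
  shows "ltensor (lcomp N g f) (lcomp N g' f') = lcomp N (ltensor g g') (ltensor f f')"
proof (rule lfam_eqI[of "k + k'" "m + m'" "\<lambda>N. ltensor (lcomp N g f) (lcomp N g' f')"
      "\<lambda>N. lcomp N (ltensor g g') (ltensor f f')", OF _ _ N])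
  fix N i j assume "2 \<le> N" and ij: "i \<in> multi_idx N (k + k')" "j \<in> multi_idx N (m + m')"
  then obtain i1 i2 j1 j2 where i: "i = i1 @ i2" "i1 \<in> multi_idx N k" "i2 \<in> multi_idx N k'"
    and j: "j = j1 @ j2" "j1 \<in> multi_idx N m" "j2 \<in> multi_idx N m'" using multi_idx_append by metis
  have len: "length i1 = k" "length j1 = m" using i j by (auto simp: multi_idx_def)
  have "T_map (ltensor (lcomp N g f) (lcomp N g' f')) j i =
      (\<Sum>h\<in>multi_idx N l. T_map g j1 h * T_map f h i1) * (\<Sum>h\<in>multi_idx N l'. T_map g' j2 h * T_map f' h i2)"
    unfolding i(1) j(1) T_map_ltensor[OF lcomp_lparts[OF g f] len]
      T_map_lcomp[OF g f i(2) j(2)] T_map_lcomp[OF g' f' i(3) j(3)] ..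
  also have "\<dots> = (\<Sum>h\<in>multi_idx N l. \<Sum>h'\<in>multi_idx N l'.
       T_map (ltensor g g') (j1 @ j2) (h @ h') * T_map (ltensor f f') (h @ h') (i1 @ i2))"
    unfolding sum_product
    by (intro sum.cong refl) (auto simp: T_map_ltensor[OF g _ len(2)] T_map_ltensor[OF f len(1)] multi_idx_def)
  also have "\<dots> = T_map (lcomp N (ltensor g g') (ltensor f f')) j i"
    unfolding T_map_lcomp[OF ltensor_lparts[OF g g'] ltensor_lparts[OF f f'] ij]
    unfolding sum_multi_idx_append i(1) j(1) ..
  finally show "T_map (ltensor (lcomp N g f) (lcomp N g' f')) j i = T_map (lcomp N (ltensor g g') (ltensor f f')) j i" .
next
  show "lfam (parts (k + k') (m + m')) (\<lambda>N. ltensor (lcomp N g f) (lcomp N g' f'))"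
    by (intro lfam_ltensor lfam_lcomp[OF lfam_lparts[OF g] lfam_lparts[OF f]]
      lfam_lcomp[OF lfam_lparts[OF g'] lfam_lparts[OF f']])
  show "lfam (parts (k + k') (m + m')) (\<lambda>N. lcomp N (ltensor g g') (ltensor f f'))"
    by (intro lfam_lcomp[OF lfam_lparts[OF ltensor_lparts[OF g g']] lfam_lparts[OF ltensor_lparts[OF f f']]])
qed

lemma linv_lcomp:
  assumes f: "f \<in> lparts k l" and g: "g \<in> lparts l m" and N: "2 \<le> N"
  shows "linv (lcomp N g f) = lcomp N (linv f) (linv g)"
proof (rule lfam_eqI[of m k "\<lambda>N. linv (lcomp N g f)" "\<lambda>N. lcomp N (linv f) (linv g)", OF _ _ N])
  fix N i j assume "2 \<le> N" and i: "i \<in> multi_idx N m" and j: "j \<in> multi_idx N k"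
  show "T_map (linv (lcomp N g f)) j i = T_map (lcomp N (linv f) (linv g)) j i"
    unfolding T_map_linv T_map_lcomp[OF g f j i] T_map_lcomp[OF linv_lparts[OF f] linv_lparts[OF g] i j]
    by (simp add: mult.commute)
next
  show "lfam (parts m k) (\<lambda>N. linv (lcomp N g f))"
    by (intro lfam_linv lfam_lcomp[OF lfam_lparts[OF g] lfam_lparts[OF f]])
  show "lfam (parts m k) (\<lambda>N. lcomp N (linv f) (linv g))"
    by (intro lfam_lcomp[OF lfam_lparts[OF linv_lparts[OF f]] lfam_lparts[OF linv_lparts[OF g]]])
qed

declare One_nat_def [simp del]

section \<open>Tensor products of matrices\<close>

lemma sum_multi_idx_prod:
  fixes f :: "nat \<Rightarrow> nat \<Rightarrow> complex"
  shows "(\<Sum>h\<in>multi_idx N k. \<Prod>n<k. f n (h ! n)) = (\<Prod>n<k. \<Sum>b<N. f n b)"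
proof -
  have "(\<Sum>h\<in>multi_idx N k. \<Prod>n<k. f n (h ! n)) = (\<Sum>g\<in>{..<k} \<rightarrow>\<^sub>E {..<N}. \<Prod>n<k. f n (g n))"
  proof (rule sum.reindex_bij_witness[where j = "\<lambda>h. restrict ((!) h) {..<k}" and i = "\<lambda>g. map g [0..<k]"])
    fix h assume "h \<in> multi_idx N k"
    then show "map (restrict ((!) h) {..<k}) [0..<k] = h" "restrict ((!) h) {..<k} \<in> {..<k} \<rightarrow>\<^sub>E {..<N}"
      by (auto simp: multi_idx_nth multi_idx_def intro: nth_equalityI)
  next
    fix g assume g: "g \<in> {..<k} \<rightarrow>\<^sub>E {..<N}"
    show "restrict ((!) (map g [0..<k])) {..<k} = g"
      using g by (auto simp: fun_eq_iff PiE_def extensional_def)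
    show "map g [0..<k] \<in> multi_idx N k" using g by (intro multi_idxI) auto
  qed simp
  also have "\<dots> = (\<Prod>n<k. \<Sum>b<N. f n b)"
    by (rule prod_sum_PiE[symmetric]) auto
  finally show ?thesis .
qed

text \<open>Matrix entries of a partition after a matrix has been applied to each leg,
  \<open>mu\<close> and \<open>ml\<close> being the rows in use: the legs of one block share a
  single summation index. It is applied to the projections and to U.\<close>

lemma sum_delta_blocks:
  fixes mu ml :: "nat \<Rightarrow> nat \<Rightarrow> complex"
  assumes p: "p \<in> parts k l"
  shows "(\<Sum>a\<in>multi_idx N k. \<Sum>b\<in>multi_idx N l.
      (\<Prod>n<k. mu n (a ! n)) * (\<Prod>n<l. ml n (b ! n)) * delta p a b) =
    (\<Prod>B\<in>p. \<Sum>c<N. \<Prod>x\<in>B. case_sum mu ml x c)"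
proof -
  let ?X = "points k l" and ?m = "case_sum mu ml"
  have X: "(\<Prod>x\<in>?X. ?m x (e x)) = (\<Prod>n<k. mu n (e (Inl n))) * (\<Prod>n<l. ml n (e (Inr n)))"
    for e :: "point \<Rightarrow> nat"
    unfolding points_def by (subst prod.union_disjoint) (auto simp: prod.reindex)
  have "(\<Sum>a\<in>multi_idx N k. \<Sum>b\<in>multi_idx N l.
      (\<Prod>n<k. mu n (a ! n)) * (\<Prod>n<l. ml n (b ! n)) * delta p a b) =
    (\<Sum>(a, b)\<in>multi_idx N k \<times> multi_idx N l. of_bool (block_const p (label a b)) * (\<Prod>x\<in>?X. ?m x (label a b x)))"
    unfolding sum.cartesian_product X delta_block_const
    by (intro sum.cong refl) (auto simp: mult.commute)
  also have "\<dots> = (\<Sum>e\<in>?X \<rightarrow>\<^sub>E {..<N}. of_bool (block_const p e) * (\<Prod>x\<in>?X. ?m x (e x)))"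
  proof (rule sum.reindex_bij_witness[where j = "\<lambda>(a, b). restrict (label a b) ?X"
        and i = "\<lambda>e. (map (\<lambda>n. e (Inl n)) [0..<k], map (\<lambda>n. e (Inr n)) [0..<l])"])
    fix z assume "z \<in> multi_idx N k \<times> multi_idx N l"
    then obtain a b where z: "z = (a, b)" and ab: "a \<in> multi_idx N k" "b \<in> multi_idx N l" by auto
    show "(map (\<lambda>n. (case z of (a, b) \<Rightarrow> restrict (label a b) ?X) (Inl n)) [0..<k],
        map (\<lambda>n. (case z of (a, b) \<Rightarrow> restrict (label a b) ?X) (Inr n)) [0..<l]) = z"
      using ab unfolding z by (auto simp: multi_idx_def intro: nth_equalityI)
    show "(case z of (a, b) \<Rightarrow> restrict (label a b) ?X) \<in> ?X \<rightarrow>\<^sub>E {..<N}"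
      using ab multi_idx_nth unfolding z by (auto simp: points_def)
    have "block_const p (restrict (label a b) ?X) = block_const p (label a b)"
      by (rule block_const_cong) (use Union_parts[OF p] in auto)
    then show "of_bool (block_const p (case z of (a, b) \<Rightarrow> restrict (label a b) ?X)) *
         (\<Prod>x\<in>?X. ?m x ((case z of (a, b) \<Rightarrow> restrict (label a b) ?X) x)) =
         (case z of (a, b) \<Rightarrow> of_bool (block_const p (label a b)) * (\<Prod>x\<in>?X. ?m x (label a b x)))"
      unfolding z by (auto intro!: prod.cong)
  next
    fix e assume e: "e \<in> ?X \<rightarrow>\<^sub>E {..<N}"
    show "(case (map (\<lambda>n. e (Inl n)) [0..<k], map (\<lambda>n. e (Inr n)) [0..<l]) of
          (a, b) \<Rightarrow> restrict (label a b) ?X) = e"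
    proof
      fix x
      show "(case (map (\<lambda>n. e (Inl n)) [0..<k], map (\<lambda>n. e (Inr n)) [0..<l]) of
          (a, b) \<Rightarrow> restrict (label a b) ?X) x = e x"
        using e by (cases "x \<in> ?X") (auto simp: points_def PiE_def extensional_def)
    qed
    show "(map (\<lambda>n. e (Inl n)) [0..<k], map (\<lambda>n. e (Inr n)) [0..<l]) \<in> multi_idx N k \<times> multi_idx N l"
      using e by (auto intro!: multi_idxI)
  qed
  also have "\<dots> = (\<Prod>B\<in>p. \<Sum>c<N. \<Prod>x\<in>B. ?m x c)"
    by (rule sum_block_const) (use p in \<open>auto simp: parts_def\<close>)
  finally show ?thesis .
qed


section \<open>The projections and the orthogonal matrix\<close>

text \<open>The averaging projection onto the line of the vector of ones, and its
  complement.\<close>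

definition pi_mat :: "nat \<Rightarrow> letter \<Rightarrow> nat \<Rightarrow> nat \<Rightarrow> complex"
  where "pi_mat N a i j = (case a of Down \<Rightarrow> 1 / of_nat N | Dot \<Rightarrow> of_bool (i = j) - 1 / of_nat N)"

lemma multi_idx_0 [simp]: "multi_idx N 0 = {[]}"
  by (auto simp: multi_idx_def)

lemma singleton_part_parts: "singleton_part \<in> parts 0 1"
  by (rule partsI) (auto simp: singleton_part_def points_def)

lemma id_part_parts: "id_part \<in> parts 1 1"
  by (rule partsI) (auto simp: id_part_def points_def)

lemma pair_part_parts: "pair_part \<in> parts 0 2"
  by (rule partsI) (auto simp: pair_part_def points_def less_2_cases_iff)

lemma basis_elt_lparts [simp]: "basis_elt p \<in> lparts k l \<longleftrightarrow> p \<in> parts k l"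
  by (simp add: lparts_lspan)

lemma lsigma_lparts: "lsigma \<in> lparts 0 1"
  by (simp add: lsigma_def singleton_part_parts)

lemma pi_letter_lparts: "pi_letter N a \<in> lparts 1 1"
proof -
  have "lcomp N lsigma (linv lsigma) \<in> lparts 1 1"
    by (rule lcomp_lparts[OF lsigma_lparts linv_lparts[OF lsigma_lparts]])
  then show ?thesis
    using id_part_parts by (cases a) (auto simp: lparts_lspan intro!: lspan_pscale lspan_diff)
qed

lemma T_map_basis_elt [simp]: "T_map (basis_elt p) j i = delta p i j"
  by (simp add: T_map_lin)

lemma T_map_pi_letter:
  assumes "i < N" "j < N"
  shows "T_map (pi_letter N a) [j] [i] = pi_mat N a j i"
proof -
  have ij: "[i] \<in> multi_idx N 1" "[j] \<in> multi_idx N 1" using assms by (auto simp: multi_idx_def)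
  have "T_map (lcomp N lsigma (linv lsigma)) [j] [i] = 1"
    unfolding T_map_lcomp[OF lsigma_lparts linv_lparts[OF lsigma_lparts] ij] T_map_linv
    unfolding lsigma_def by (simp add: delta_def singleton_part_def)
  then show ?thesis
    by (cases a) (auto simp: T_map_lin lin_diff lin_pscale pi_mat_def delta_def id_part_def)
qed

lemma lfam_pi_letter: "lfam (parts 1 1) (\<lambda>N. pi_letter N a)"
proof -
  have s: "lfam (parts 1 1) (\<lambda>N. lcomp N lsigma (linv lsigma))"
    by (rule lfam_lcomp[OF lfam_lparts[OF lsigma_lparts] lfam_lparts[OF linv_lparts[OF lsigma_lparts]]])
  have r: "ratfam (\<lambda>N. 1 / of_nat N)"
    by (rule ratfam_divide) (auto intro: ratfam_of_nat)
  show ?thesis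
    using id_part_parts
    by (cases a) (auto intro!: lfam_diff lfam_pscale[OF r s] lfam_lparts)
qed

lemma pi_word_lparts: "pi_word N w \<in> lparts (length w) (length w)"
proof (induction w)
  case Nil
  have "{} \<in> parts 0 0" by (rule partsI) (auto simp: points_def)
  then show ?case by simp
next
  case (Cons a w)
  then show ?case using ltensor_lparts[OF pi_letter_lparts Cons] by (simp add: One_nat_def)
qed

lemma lfam_pi_word: "lfam (parts (length w) (length w)) (\<lambda>N. pi_word N w)"
proof (induction w)
  case Nil
  then show ?case using lfam_lparts[OF pi_word_lparts[of _ "[]"]] by simp
next
  case (Cons a w)
  then show ?case using lfam_ltensor[OF lfam_pi_letter Cons] by (simp add: One_nat_def)
qed

lemma multi_idx_Suc: "i \<in> multi_idx N (Suc k) \<longleftrightarrow> (\<exists>a i'. i = a # i' \<and> a < N \<and> i' \<in> multi_idx N k)"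
  by (cases i) (auto simp: multi_idx_def)

lemma T_map_pi_word:
  "i \<in> multi_idx N (length w) \<Longrightarrow> j \<in> multi_idx N (length w) \<Longrightarrow>
    T_map (pi_word N w) j i = (\<Prod>n<length w. pi_mat N (w ! n) (j ! n) (i ! n))"
proof (induction w arbitrary: i j)
  case Nil
  then show ?case by (simp add: delta_def)
next
  case (Cons a w)
  then obtain x i' y j' where i: "i = x # i'" "x < N" "i' \<in> multi_idx N (length w)"
    and j: "j = y # j'" "y < N" "j' \<in> multi_idx N (length w)" unfolding length_Cons multi_idx_Suc by blast
  have "T_map (pi_word N (a # w)) ([y] @ j') ([x] @ i') = T_map (pi_letter N a) [y] [x] * T_map (pi_word N w) j' i'"
    unfolding pi_word.simps by (rule T_map_ltensor[OF pi_letter_lparts]) auto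
  then show ?case using Cons.IH[OF i(3) j(3)] T_map_pi_letter[OF i(2) j(2)]
    by (simp add: i(1) j(1) prod.lessThan_Suc_shift del: prod.lessThan_Suc)
qed

lemma pi_mat_mult:
  assumes "i < N" "j < N"
  shows "(\<Sum>b<N. pi_mat N a i b * pi_mat N a' b j) = of_bool (a = a') * pi_mat N a i j"
proof -
  have N: "(of_nat N :: complex) \<noteq> 0" using assms by auto
  have d: "(\<Sum>b<N. of_bool (i = b) * f b) = f i" "(\<Sum>b<N. f b * of_bool (b = j)) = f j"
    for f :: "nat \<Rightarrow> complex"
    using assms by (simp_all add: of_bool_def if_distrib[of "\<lambda>x. x * _"] if_distrib[of "\<lambda>x. _ * x"] cong: if_cong)
  show ?thesis
    using N d[of "\<lambda>_. 1"] by (cases a; cases a') (auto simp: pi_mat_def algebra_simps sum.distrib sum_subtractf d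
      simp flip: sum_distrib_left sum_divide_distrib)
qed

lemma pi_mat_commute: "pi_mat N a i j = pi_mat N a j i"
  by (cases a) (auto simp: pi_mat_def)

lemma cnj_pi_mat: "cnj (pi_mat N a i j) = pi_mat N a i j"
  by (cases a) (auto simp: pi_mat_def of_bool_def)

text \<open>This projection kills the vector of ones; hence a block left with one dotted point
  contributes zero.\<close>

lemma pi_mat_row_sum: "i < N \<Longrightarrow> (\<Sum>c<N. pi_mat N Dot i c) = 0"
  by (simp add: pi_mat_def sum_subtractf of_bool_def)

section \<open>Orthogonality of U\<close>

lemma sum_lessThan_last:
  fixes N :: nat
  assumes N2: "2 \<le> N"
  shows "(\<Sum>b<N. f b) = (\<Sum>b<N - 1. f b) + (f (N - 1) :: real)"
proof -
  have "N = Suc (N - 1)" using N2 by simp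
  then show ?thesis using sum.lessThan_Suc[of f "N - 1"] by simp
qed

lemma sum_kronecker_const:
  fixes N :: nat and c :: real
  assumes "i < N - 1"
  shows "(\<Sum>b<N - 1. (of_bool (i = b) - c) * f b) = f i - c * (\<Sum>b<N - 1. f b :: real)"
    "(\<Sum>b<N - 1. (of_bool (b = i) - c) * f b) = f i - c * (\<Sum>b<N - 1. f b :: real)"
proof -
  have "(\<Sum>b<N - 1. of_bool (i = b) * f b) = f i"
    using assms by (simp add: of_bool_def if_distrib[of "\<lambda>x. x * _"] cong: if_cong)
  then show "(\<Sum>b<N - 1. (of_bool (i = b) - c) * f b) = f i - c * (\<Sum>b<N - 1. f b :: real)"
    by (simp add: left_diff_distrib sum_subtractf sum_distrib_left)
  then show "(\<Sum>b<N - 1. (of_bool (b = i) - c) * f b) = f i - c * (\<Sum>b<N - 1. f b :: real)"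
    by (simp add: eq_commute)
qed

context
  fixes N :: nat and s :: real
  assumes N2: "2 \<le> N" and s: "s = 1 \<or> s = - 1"
begin

text \<open>The entries of U are real; working over the reals keeps the manipulation of square roots
  free of coercions.\<close>

definition rU :: "nat \<Rightarrow> nat \<Rightarrow> real"
  where "rU i j = (if i = N - 1 then 1 / sqrt (real N)
     else if j = N - 1 then s / sqrt (real N) else of_bool (i = j) - U_const N s)"

lemma U_mat_rU: "U_mat N s i j = complex_of_real (rU i j)"
  by (simp add: U_mat_def rU_def of_bool_def)

lemma U_const_mult: "(real N - 1) * U_const N s = 1 + s / sqrt (real N)"
  using N2 by (simp add: U_const_def)

text \<open>U maps the vector of ones to sqrt N times the last unit vector. This is the purpose of
  U: the range of the averaging projection becomes the last coordinate line.\<close>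

lemma rU_row_sum: "i < N \<Longrightarrow> (\<Sum>b<N. rU i b) = (if i = N - 1 then sqrt (real N) else 0)"
proof (cases "i = N - 1")
  case True
  then show ?thesis using N2 by (simp add: rU_def real_div_sqrt)
next
  case False
  assume "i < N"
  then have i: "i < N - 1" using False by simp
  have "(\<Sum>b<N. rU i b) = (\<Sum>b<N - 1. (of_bool (i = b) - U_const N s) * 1) + s / sqrt (real N)"
    unfolding sum_lessThan_last[OF N2] using i by (simp add: rU_def)
  also have "\<dots> = 1 - (real N - 1) * U_const N s + s / sqrt (real N)"
    unfolding sum_kronecker_const(1)[OF i] using N2 by (simp add: of_nat_diff)
  also have "\<dots> = 0" unfolding U_const_mult by simp
  finally show ?thesis using False by simp
qed

lemma s_square: "s * s = 1" using s by auto

text \<open>Origin of the constant: that the first N - 1 rows are orthonormal comes down to (N - 1)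
  c^2 - 2 c + 1 / N = 0, whose roots are the values of \<open>U_const\<close> for the two signs.
  Multiplying by N - 1 leaves a polynomial in (N - 1) c = 1 + s / sqrt N.\<close>

lemma U_const_square: "(real N - 1) * U_const N s * U_const N s - 2 * U_const N s + 1 / real N = 0"
proof -
  define r where "r = 1 / sqrt (real N)"
  have r: "r * r = 1 / real N" using N2 by (simp add: r_def)
  have "(real N - 1) * ((real N - 1) * U_const N s * U_const N s - 2 * U_const N s + 1 / real N)
    = ((real N - 1) * U_const N s) * ((real N - 1) * U_const N s) - 2 * ((real N - 1) * U_const N s) + (real N - 1) / real N"
    by (simp add: algebra_simps)
  also have "\<dots> = (1 + s * r) * (1 + s * r) - 2 * (1 + s * r) + (1 - r * r)"
    unfolding U_const_mult r using N2 by (simp add: r_def field_simps)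
  also have "\<dots> = 0" using s_square by (simp add: algebra_simps)
  finally show ?thesis using N2 by simp
qed

text \<open>The upper left block of U is symmetric, and the last row and the last column both add 1
  / N. So this one computation serves rows and columns.\<close>

lemma rU_gram:
  assumes i: "i < N - 1" and j: "j < N - 1"
  shows "(\<Sum>b<N - 1. (of_bool (i = b) - U_const N s) * (of_bool (j = b) - U_const N s)) + 1 / real N = of_bool (i = j)"
proof -
  have "(\<Sum>b<N - 1. (of_bool (j = b) - U_const N s)) = 1 - (real N - 1) * U_const N s"
    using sum_kronecker_const(1)[OF j, of "U_const N s" "\<lambda>_. 1"] N2
    by (simp add: of_nat_diff algebra_simps)
  then show ?thesis unfolding sum_kronecker_const(1)[OF i] using U_const_square
    by (cases "i = j") (simp_all add: right_diff_distrib mult_ac)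
qed

lemma rU_sqrt: "1 / sqrt (real N) * (1 / sqrt (real N)) = 1 / real N"
  "s / sqrt (real N) * (s / sqrt (real N)) = 1 / real N"
  using N2 s by auto

lemma rU_mixed:
  assumes i: "i < N - 1"
  shows "(\<Sum>b<N - 1. (of_bool (i = b) - U_const N s)) = - s / sqrt (real N)"
  using sum_kronecker_const(1)[OF i, of "U_const N s" "\<lambda>_. 1"] U_const_mult N2
  by (simp add: of_nat_diff algebra_simps)

lemma rU_orthogonal_rows:
  assumes "i < N" "j < N"
  shows "(\<Sum>b<N. rU i b * rU j b) = of_bool (i = j)"
proof -
  \<comment> \<open>The last row is constant, so orthogonality to it is the vanishing of a row
    sum.\<close>
  have mixed: "(\<Sum>b<N. rU (N - 1) b * rU i b) = 0" if i: "i < N - 1" for i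
  proof -
    have "(\<Sum>b<N. rU (N - 1) b * rU i b) = 1 / sqrt (real N) * (\<Sum>b<N. rU i b)"
      by (simp add: rU_def sum_distrib_left)
    then show ?thesis using rU_row_sum[of i] i by simp
  qed
  consider "i = N - 1" "j = N - 1" | "i = N - 1" "j < N - 1" | "i < N - 1" "j = N - 1" | "i < N - 1" "j < N - 1"
    using assms by linarith
  then show ?thesis
  proof cases
    case 1
    have "(\<Sum>b<N. rU i b * rU j b) = (\<Sum>b<N. 1 / real N)"
      using 1 rU_sqrt by (intro sum.cong refl) (auto simp: rU_def)
    then show ?thesis using 1 N2 by simp
  next
    case 2 then show ?thesis using mixed[of j] by simp
  next
    case 3 then show ?thesis using mixed[of i] by (simp add: mult.commute)
  next
    case 4
    have "(\<Sum>b<N. rU i b * rU j b) = (\<Sum>b<N - 1. (of_bool (i = b) - U_const N s) * (of_bool (j = b) - U_const N s)) + 1 / real N"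
      unfolding sum_lessThan_last[OF N2] using 4 rU_sqrt by (simp add: rU_def)
    then show ?thesis using rU_gram 4 by simp
  qed
qed

lemma rU_orthogonal_columns:
  assumes "a < N" "b < N"
  shows "(\<Sum>i<N. rU i a * rU i b) = of_bool (a = b)"
proof -
  \<comment> \<open>The last column need not be constant: its last entry is 1 / sqrt N, the others
    are s / sqrt N. The upper part of column \<open>a\<close> sums to - s / sqrt N, so the two
    contributions are - 1 / N and 1 / N.\<close>
  have mixed: "(\<Sum>i<N. rU i a * rU i (N - 1)) = 0" if a: "a < N - 1" for a
  proof -
    have "(\<Sum>i<N - 1. rU i a * rU i (N - 1)) =
        (\<Sum>i<N - 1. (of_bool (a = i) - U_const N s) * (s / sqrt (real N)))"
      by (intro sum.cong refl) (use a in \<open>auto simp: rU_def\<close>)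
    then have "(\<Sum>i<N. rU i a * rU i (N - 1)) =
        (\<Sum>i<N - 1. (of_bool (a = i) - U_const N s)) * (s / sqrt (real N)) + 1 / real N"
      unfolding sum_lessThan_last[OF N2] sum_distrib_right[symmetric] using rU_sqrt by (simp add: rU_def)
    also have "\<dots> = 0" unfolding rU_mixed[OF a] using rU_sqrt(2) by simp
    finally show ?thesis .
  qed
  consider "a = N - 1" "b = N - 1" | "a = N - 1" "b < N - 1" | "a < N - 1" "b = N - 1" | "a < N - 1" "b < N - 1"
    using assms by linarith
  then show ?thesis
  proof cases
    case 1
    have "(\<Sum>i<N. rU i a * rU i b) = (\<Sum>i<N. 1 / real N)"
      using 1 rU_sqrt by (intro sum.cong refl) (auto simp: rU_def)
    then show ?thesis using 1 N2 by simp
  next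
    case 2 then show ?thesis using mixed[of b] by (simp add: mult.commute)
  next
    case 3 then show ?thesis using mixed[of a] by simp
  next
    case 4
    have "(\<Sum>i<N - 1. rU i a * rU i b) =
        (\<Sum>i<N - 1. (of_bool (a = i) - U_const N s) * (of_bool (b = i) - U_const N s))"
      by (intro sum.cong refl) (use 4 in \<open>auto simp: rU_def\<close>)
    then have "(\<Sum>i<N. rU i a * rU i b) = (\<Sum>i<N - 1. (of_bool (a = i) - U_const N s) * (of_bool (b = i) - U_const N s)) + 1 / real N"
      unfolding sum_lessThan_last[OF N2] using rU_sqrt by (simp add: rU_def)
    then show ?thesis using rU_gram 4 by simp
  qed
qed

lemma U_mat_rows: "i < N \<Longrightarrow> j < N \<Longrightarrow> (\<Sum>b<N. U_mat N s i b * U_mat N s j b) = of_bool (i = j)"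
  using rU_orthogonal_rows[of i j] unfolding U_mat_rU of_real_mult[symmetric] of_real_sum[symmetric] by simp

lemma U_mat_columns: "a < N \<Longrightarrow> b < N \<Longrightarrow> (\<Sum>i<N. U_mat N s i a * U_mat N s i b) = of_bool (a = b)"
  using rU_orthogonal_columns[of a b] unfolding U_mat_rU of_real_mult[symmetric] of_real_sum[symmetric] by simp

lemma U_mat_row_sum: "i < N \<Longrightarrow> (\<Sum>b<N. U_mat N s i b) = (if i = N - 1 then of_real (sqrt (real N)) else 0)"
  using rU_row_sum[of i] unfolding U_mat_rU of_real_sum[symmetric] by simp

lemma cnj_U_mat: "cnj (U_mat N s i j) = U_mat N s i j"
  by (simp add: U_mat_rU)

lemma adjoint_U_mat: "adjoint_mat (U_mat N s) i j = U_mat N s j i"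
  by (simp add: adjoint_mat_def cnj_U_mat)

text \<open>U carries the projection of a letter to the coordinate projection of its color. For
  \<open>Down\<close>, the average of a row of U is its sum divided by N, so it survives in the last
  row only, where it equals the constant entry; \<open>Dot\<close> is the complement.\<close>

lemma U_mat_pi:
  assumes i: "i < N" and c: "c < N"
  shows "(\<Sum>b<N. U_mat N s i b * pi_mat N a b c) = of_bool (i \<in> color_idx N (U_obj a)) * U_mat N s i c"
proof -
  have last: "of_real (sqrt (real N)) / of_nat N = U_mat N s i c" if "i = N - 1"
  proof -
    have "sqrt (real N) / real N = 1 / sqrt (real N)" using N2 by (simp add: frac_eq_eq)
    then have "complex_of_real (sqrt (real N) / real N) = of_real (1 / sqrt (real N))" by simp
    then show ?thesis using that by (simp add: U_mat_def)
  qed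
  have e: "(\<Sum>b<N. U_mat N s i b * (1 / of_nat N)) = of_bool (i = N - 1) * U_mat N s i c"
    unfolding sum_distrib_right[symmetric] U_mat_row_sum[OF i] using last by simp
  show ?thesis
  proof (cases a)
    case Down
    then show ?thesis using e by (simp add: pi_mat_def color_idx_def)
  next
    case Dot
    have "(\<Sum>b<N. U_mat N s i b * of_bool (b = c)) = U_mat N s i c"
      using c by (simp add: of_bool_def if_distrib[of "\<lambda>x. _ * x"] cong: if_cong)
    then have "(\<Sum>b<N. U_mat N s i b * pi_mat N a b c) = U_mat N s i c - of_bool (i = N - 1) * U_mat N s i c"
      using e Dot by (simp add: pi_mat_def right_diff_distrib sum_subtractf)
    then show ?thesis using Dot i by (auto simp: color_idx_def)
  qed
qed

end

section \<open>Corners of partitions\<close>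

definition down_points :: "letter list \<Rightarrow> letter list \<Rightarrow> point set"
  where "down_points w1 w2 = tri_points (map U_obj w1) (map U_obj w2)"

definition letter_of :: "letter list \<Rightarrow> letter list \<Rightarrow> point \<Rightarrow> letter"
  where "letter_of w1 w2 = case_sum ((!) w1) ((!) w2)"

lemma U_obj_Tri [simp]: "U_obj a = Tri \<longleftrightarrow> a = Down" and U_obj_Ell [simp]: "U_obj a = Ell \<longleftrightarrow> a = Dot"
  by (cases a; simp)+

lemma down_points_iff:
  "x \<in> down_points w1 w2 \<longleftrightarrow> x \<in> points (length w1) (length w2) \<and> letter_of w1 w2 x = Down"
  by (cases x) (auto simp: down_points_def tri_points_def color_of_def letter_of_def)

lemma down_points_subset: "down_points w1 w2 \<subseteq> points (length w1) (length w2)"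
  by (auto simp: down_points_iff)

text \<open>What compression by the projections of two words makes of a partition: a point in
  \<open>D\<close> carries the averaging projection, which detaches it from its block as a
  singleton.\<close>

definition split_part :: "point set \<Rightarrow> part \<Rightarrow> part"
  where "split_part D p = ((\<lambda>B. B - D) ` p - {{}}) \<union> (\<lambda>x. {x}) ` D"

text \<open>The weight produced by detaching the points of \<open>D\<close>. Each carries 1 / N; a
  block swallowed by \<open>D\<close> returns a factor N for its free common index; a block reduced
  to one dotted point is killed, as the complementary projection annihilates the vector of ones. For
  a singleton block in \<open>D\<close> the factors cancel.\<close>

definition split_factor :: "nat \<Rightarrow> point set \<Rightarrow> part \<Rightarrow> complex"
  where "split_factor N D p = (if \<exists>B\<in>p. card (B - D) = 1 then 0
    else \<Prod>B\<in>p. (1 / of_nat N) ^ card (B \<inter> D) * (if B \<subseteq> D then of_nat N else 1))"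

lemma split_part_parts:
  assumes p: "p \<in> parts k l" and D: "D \<subseteq> points k l"
  shows "split_part D p \<in> parts k l"
proof (rule partsI)
  show "\<Union>(split_part D p) = points k l"
  proof -
    have "\<Union>(split_part D p) = (\<Union>p - D) \<union> D" unfolding split_part_def by auto
    then show ?thesis using Union_parts[OF p] D by auto
  qed
  show "{} \<notin> split_part D p" by (auto simp: split_part_def)
  fix B C x assume BC: "B \<in> split_part D p" "C \<in> split_part D p" and x: "x \<in> B" "x \<in> C"
  have split: "(\<exists>B'\<in>p. B = B' - D) \<or> (\<exists>x\<in>D. B = {x})" if "B \<in> split_part D p" for B
    using that unfolding split_part_def by blast
  show "B = C"
  proof (cases "x \<in> D")
    case True
    then have "B = {x}" "C = {x}" using split[OF BC(1)] split[OF BC(2)] x by auto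
    then show ?thesis by simp
  next
    case False
    then obtain B' C' where "B' \<in> p" "B = B' - D" "C' \<in> p" "C = C' - D"
      using split[OF BC(1)] split[OF BC(2)] x by auto
    then show ?thesis using parts_block_unique[OF p, of B' C' x] x by auto
  qed
qed

lemma prod_split_part:
  fixes g :: "point set \<Rightarrow> complex"
  assumes p: "p \<in> parts k l" and D: "D \<subseteq> points k l"
  shows "(\<Prod>B\<in>split_part D p. g B) =
    (\<Prod>B\<in>p. (if B \<subseteq> D then 1 else g (B - D)) * (\<Prod>x\<in>B \<inter> D. g {x}))"
proof -
  let ?A = "(\<lambda>B. B - D) ` p - {{}}" and ?S = "(\<lambda>x. {x}) ` D"
  have fp: "finite p" using finite_parts_member[OF p] .
  have fD: "finite D" using finite_subset[OF D finite_points] .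
  have "prod g ?A = prod g ((\<lambda>B. B - D) ` {B \<in> p. \<not> B \<subseteq> D})"
    by (rule arg_cong[where f = "prod g"]) auto
  also have "\<dots> = (\<Prod>B\<in>{B \<in> p. \<not> B \<subseteq> D}. g (B - D))"
  proof (rule prod.reindex_cong[OF _ refl refl])
    show "inj_on (\<lambda>B. B - D) {B \<in> p. \<not> B \<subseteq> D}"
    proof (rule inj_onI)
      fix B C assume BC: "B \<in> {B \<in> p. \<not> B \<subseteq> D}" "C \<in> {B \<in> p. \<not> B \<subseteq> D}" and eq: "B - D = C - D"
      then obtain x where "x \<in> B - D" by blast
      then have "x \<in> B" "x \<in> C" using eq by blast+
      then show "B = C" using parts_block_unique[OF p] BC by blast
    qed
  qed
  also have "\<dots> = (\<Prod>B\<in>p. if B \<subseteq> D then 1 else g (B - D))"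
    by (rule prod.mono_neutral_cong_left) (use fp in auto)
  finally have 1: "prod g ?A = (\<Prod>B\<in>p. if B \<subseteq> D then 1 else g (B - D))" .
  have UD: "(\<Union>B\<in>p. B \<inter> D) = D" using Union_parts[OF p] D by blast
  have "prod g ?S = (\<Prod>x\<in>(\<Union>B\<in>p. B \<inter> D). g {x})" unfolding UD by (simp add: prod.reindex)
  also have "(\<Prod>x\<in>(\<Union>B\<in>p. B \<inter> D). g {x}) = (\<Prod>B\<in>p. \<Prod>x\<in>B \<inter> D. g {x})"
    by (rule prod.UNION_disjoint) (use fp fD parts_block_unique[OF p] in blast)+
  finally have 2: "prod g ?S = (\<Prod>B\<in>p. \<Prod>x\<in>B \<inter> D. g {x})" .
  have "prod g (split_part D p) = prod g ?A * prod g ?S"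
    unfolding split_part_def by (rule prod.union_disjoint) (use fp fD in auto)
  then show ?thesis unfolding 1 2 by (simp add: prod.distrib)
qed

text \<open>Rows that are constant on \<open>D\<close> and sum to zero elsewhere split in this way,
  and the value \<open>\<kappa>\<close> of the constant cancels. So the same factor appears for the
  rows of the projections, where \<open>\<kappa>\<close> is 1 / N, and for the rows of U, where it
  is 1 / sqrt N.\<close>

lemma prod_blocks_split:
  fixes M :: "point \<Rightarrow> nat \<Rightarrow> complex"
  assumes p: "p \<in> parts k l" and D: "D \<subseteq> points k l" and N: "0 < N"
    and const: "\<And>x c. x \<in> D \<Longrightarrow> c < N \<Longrightarrow> M x c = \<kappa>"
    and zero: "\<And>x. x \<in> points k l - D \<Longrightarrow> (\<Sum>c<N. M x c) = 0"
  shows "(\<Prod>B\<in>p. \<Sum>c<N. \<Prod>x\<in>B. M x c) =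
    split_factor N D p * (\<Prod>B\<in>split_part D p. \<Sum>c<N. \<Prod>x\<in>B. M x c)"
proof -
  define G where "G B = (\<Sum>c<N. \<Prod>x\<in>B. M x c)" for B
  have G: "G B = \<kappa> ^ card (B \<inter> D) * G (B - D)" if B: "B \<in> p" for B
  proof -
    have "(\<Prod>x\<in>B. M x c) = \<kappa> ^ card (B \<inter> D) * (\<Prod>x\<in>B - D. M x c)" if c: "c < N" for c
    proof -
      have "(\<Prod>x\<in>B. M x c) = (\<Prod>x\<in>B \<inter> D. M x c) * (\<Prod>x\<in>B - D. M x c)"
        using finite_block[OF p B] by (subst prod.union_disjoint[symmetric]) (auto simp: Int_Diff_Un)
      also have "(\<Prod>x\<in>B \<inter> D. M x c) = (\<Prod>x\<in>B \<inter> D. \<kappa>)"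
        by (rule prod.cong) (use const c in auto)
      finally show ?thesis by simp
    qed
    then show ?thesis unfolding G_def by (simp add: sum_distrib_left)
  qed
  show ?thesis
  proof (cases "\<exists>B\<in>p. card (B - D) = 1")
    case True
    then obtain B where B: "B \<in> p" "card (B - D) = 1" by blast
    then obtain x where x: "B - D = {x}" using card_1_singletonE by blast
    then have "x \<in> points k l - D" using parts_subset_points[OF p B(1)] by blast
    then have "G B = 0" using zero unfolding G[OF B(1)] x by (simp add: G_def)
    then have "(\<Prod>B\<in>p. G B) = 0" using B finite_parts_member[OF p] by auto
    then show ?thesis using True unfolding G_def split_factor_def by simp
  next
    case False
    have G1: "G {x} = of_nat N * \<kappa>" if "x \<in> D" for x
      using const[OF that] by (simp add: G_def)
    \<comment> \<open>Both sides contain \<open>\<kappa>\<close> to the power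
      \<open>card (B \<inter> D)\<close>: a detached singleton gives N times
      \<open>\<kappa>\<close>, and the excess N is cancelled by the 1 / N in
      \<open>split_factor\<close>.\<close>
    have "(\<Prod>B\<in>p. G B) = (\<Prod>B\<in>p. ((1 / of_nat N) ^ card (B \<inter> D) * (if B \<subseteq> D then of_nat N else 1)) *
        ((if B \<subseteq> D then 1 else G (B - D)) * (\<Prod>x\<in>B \<inter> D. G {x})))"
    proof (rule prod.cong[OF refl])
      fix B assume B: "B \<in> p"
      have "(\<Prod>x\<in>B \<inter> D. G {x}) = (of_nat N * \<kappa>) ^ card (B \<inter> D)" by (simp add: G1)
      moreover have "G (B - D) = of_nat N" if "B \<subseteq> D"
        using that by (simp add: G_def Diff_eq_empty_iff[THEN iffD2])
      ultimately show "G B = ((1 / of_nat N) ^ card (B \<inter> D) * (if B \<subseteq> D then of_nat N else 1)) *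
          ((if B \<subseteq> D then 1 else G (B - D)) * (\<Prod>x\<in>B \<inter> D. G {x}))"
        unfolding G[OF B] using N by (auto simp: power_mult_distrib power_divide)
    qed
    also have "\<dots> = split_factor N D p * (\<Prod>B\<in>split_part D p. G B)"
      unfolding prod.distrib[of _ "\<lambda>B. _ B * (\<Prod>x\<in>B \<inter> D. G {x})"] prod_split_part[OF p D, of G]
      using False by (simp add: split_factor_def prod.distrib)
    finally show ?thesis unfolding G_def .
  qed
qed

lemma ratfam_split_factor: "ratfam (\<lambda>N. split_factor N D p)"
proof -
  have 1: "ratfam (\<lambda>N. 1 / of_nat N)" by (rule ratfam_divide) (auto intro: ratfam_of_nat)
  have 2: "ratfam (\<lambda>N. if B \<subseteq> D then of_nat N else 1)" for B
    by (cases "B \<subseteq> D") (simp_all add: ratfam_of_nat)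
  have "ratfam (\<lambda>N. \<Prod>B\<in>p. (1 / of_nat N) ^ card (B \<inter> D) * (if B \<subseteq> D then of_nat N else 1))"
    by (intro ratfam_prod ratfam_mult ratfam_power 1 2)
  then show ?thesis by (cases "\<exists>B\<in>p. card (B - D) = 1") (auto simp: split_factor_def)
qed

lemma corner_lparts: "f \<in> lparts (length w1) (length w2) \<Longrightarrow> corner N w1 w2 f \<in> lparts (length w1) (length w2)"
  unfolding corner_def by (rule lcomp_lparts[OF pi_word_lparts lcomp_lparts[OF _ pi_word_lparts]])

lemma lfam_corner:
  "lfam (parts (length w1) (length w2)) F \<Longrightarrow> lfam (parts (length w1) (length w2)) (\<lambda>N. corner N w1 w2 (F N))"
  unfolding corner_def by (rule lfam_lcomp[OF lfam_pi_word lfam_lcomp[OF _ lfam_pi_word]])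

lemma T_map_corner:
  assumes f: "f \<in> lparts (length w1) (length w2)"
    and i: "i \<in> multi_idx N (length w1)" and j: "j \<in> multi_idx N (length w2)"
  shows "T_map (corner N w1 w2 f) j i = (\<Sum>a\<in>multi_idx N (length w1). \<Sum>b\<in>multi_idx N (length w2).
    (\<Prod>n<length w1. pi_mat N (w1 ! n) (i ! n) (a ! n)) * (\<Prod>n<length w2. pi_mat N (w2 ! n) (j ! n) (b ! n)) * T_map f b a)"
proof -
  have "T_map (corner N w1 w2 f) j i = (\<Sum>b\<in>multi_idx N (length w2). \<Sum>a\<in>multi_idx N (length w1).
      T_map (pi_word N w2) j b * (T_map f b a * T_map (pi_word N w1) a i))"
    unfolding corner_def T_map_lcomp[OF pi_word_lparts lcomp_lparts[OF f pi_word_lparts] i j]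
    by (intro sum.cong refl) (simp add: T_map_lcomp[OF f pi_word_lparts i] sum_distrib_left)
  also have "\<dots> = (\<Sum>b\<in>multi_idx N (length w2). \<Sum>a\<in>multi_idx N (length w1).
    (\<Prod>n<length w1. pi_mat N (w1 ! n) (i ! n) (a ! n)) * (\<Prod>n<length w2. pi_mat N (w2 ! n) (j ! n) (b ! n)) * T_map f b a)"
    by (intro sum.cong refl)
      (simp add: T_map_pi_word i j pi_mat_commute[of N _ "i ! _"] mult_ac)
  finally show ?thesis by (subst sum.swap)
qed

lemma T_map_corner_basis:
  assumes p: "p \<in> parts (length w1) (length w2)"
    and i: "i \<in> multi_idx N (length w1)" and j: "j \<in> multi_idx N (length w2)"
  shows "T_map (corner N w1 w2 (basis_elt p)) j i =
    (\<Prod>B\<in>p. \<Sum>c<N. \<Prod>x\<in>B. pi_mat N (letter_of w1 w2 x) (label i j x) c)"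
proof -
  have "case_sum (\<lambda>n. pi_mat N (w1 ! n) (i ! n)) (\<lambda>n. pi_mat N (w2 ! n) (j ! n)) x c =
      pi_mat N (letter_of w1 w2 x) (label i j x) c" for x c
    by (cases x) (simp_all add: letter_of_def)
  then show ?thesis
    using sum_delta_blocks[OF p, where mu = "\<lambda>n. pi_mat N (w1 ! n) (i ! n)" and ml = "\<lambda>n. pi_mat N (w2 ! n) (j ! n)"]
      p i j by (simp add: T_map_corner)
qed

lemma corner_split:
  assumes p: "p \<in> parts (length w1) (length w2)" and N: "2 \<le> N"
  shows "corner N w1 w2 (basis_elt p) = pscale (split_factor N (down_points w1 w2) p)
    (corner N w1 w2 (basis_elt (split_part (down_points w1 w2) p)))"
proof -
  let ?D = "down_points w1 w2"
  let ?q = "split_part ?D p"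
  have q: "?q \<in> parts (length w1) (length w2)" by (rule split_part_parts[OF p down_points_subset])
  show ?thesis
  proof (rule lfam_eqI[of _ _ "\<lambda>N. corner N w1 w2 (basis_elt p)"
        "\<lambda>N. pscale (split_factor N ?D p) (corner N w1 w2 (basis_elt ?q))", OF _ _ N])
    show "lfam (parts (length w1) (length w2)) (\<lambda>N. corner N w1 w2 (basis_elt p))"
      by (intro lfam_corner lfam_lparts) (simp add: p)
    show "lfam (parts (length w1) (length w2)) (\<lambda>N. pscale (split_factor N ?D p) (corner N w1 w2 (basis_elt ?q)))"
      by (intro lfam_pscale ratfam_split_factor lfam_corner lfam_lparts) (simp add: q)
    fix N i j assume N: "(2::nat) \<le> N" and i: "i \<in> multi_idx N (length w1)" and j: "j \<in> multi_idx N (length w2)"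
    have lab: "label i j x < N" if "x \<in> points (length w1) (length w2)" for x
      using that multi_idx_nth[OF i] multi_idx_nth[OF j] by (cases x) auto
    have "(\<Prod>B\<in>p. \<Sum>c<N. \<Prod>x\<in>B. pi_mat N (letter_of w1 w2 x) (label i j x) c) = split_factor N ?D p *
        (\<Prod>B\<in>?q. \<Sum>c<N. \<Prod>x\<in>B. pi_mat N (letter_of w1 w2 x) (label i j x) c)"
    proof (rule prod_blocks_split[OF p down_points_subset, where \<kappa> = "1 / of_nat N"])
      show "0 < N" using N by simp
      fix x assume "x \<in> points (length w1) (length w2) - ?D"
      then have "letter_of w1 w2 x = Dot" "label i j x < N"
        using lab letter.exhaust by (auto simp: down_points_iff)
      then show "(\<Sum>c<N. pi_mat N (letter_of w1 w2 x) (label i j x) c) = 0"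
        using pi_mat_row_sum by simp
    qed (auto simp: down_points_iff pi_mat_def)
    then show "T_map (corner N w1 w2 (basis_elt p)) j i =
        T_map (pscale (split_factor N ?D p) (corner N w1 w2 (basis_elt ?q))) j i"
      by (simp add: T_map_lin lin_pscale T_map_corner_basis[OF p i j, unfolded T_map_lin]
        T_map_corner_basis[OF q i j, unfolded T_map_lin])
  qed
qed

text \<open>If no remainder of a block is a single point, the singletons of the split partition are
  exactly the points of \<open>D\<close>, so its own words are the given ones and its corner is a
  dotted partition.\<close>

lemma split_words:
  assumes p: "p \<in> parts (length w1) (length w2)" and single: "\<And>B. B \<in> p \<Longrightarrow> card (B - down_points w1 w2) \<noteq> 1"
  shows "up_word (split_part (down_points w1 w2) p) = w1" "low_word (split_part (down_points w1 w2) p) = w2"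
proof -
  let ?D = "down_points w1 w2"
  let ?q = "split_part ?D p"
  have q: "?q \<in> parts (length w1) (length w2)" by (rule split_part_parts[OF p down_points_subset])
  have "{x} \<in> ?q \<longleftrightarrow> x \<in> ?D" for x
    using single by (auto simp: split_part_def) (metis is_singletonI is_singleton_altdef)
  moreover have "a \<noteq> Down \<Longrightarrow> Dot = a" for a by (cases a) auto
  ultimately show "up_word ?q = w1" "low_word ?q = w2"
    unfolding up_word_def low_word_def
    by (auto simp: n_up_parts[OF q] n_low_parts[OF q] down_points_iff letter_of_def intro!: nth_equalityI)
qed

text \<open>Expansion of a corner in the dotted basis, with at most one term. It makes
  \<open>U_map\<close>, known only on that basis, computable on every corner.\<close>

lemma corner_dotted:
  assumes p: "p \<in> parts (length w1) (length w2)" and N: "2 \<le> N"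
  shows "corner N w1 w2 (basis_elt p) = pscale (split_factor N (down_points w1 w2) p)
    (dotted N (split_part (down_points w1 w2) p))"
proof (cases "\<exists>B\<in>p. card (B - down_points w1 w2) = 1")
  \<comment> \<open>Here the split partition has further singletons and its dotted element belongs
    to other words, but the coefficient is zero.\<close>
  case True
  then have "split_factor N (down_points w1 w2) p = 0" by (simp add: split_factor_def)
  then show ?thesis unfolding corner_split[OF assms] by (simp only: plin.scale_zero_left)
next
  case False
  then show ?thesis using corner_split[OF assms] split_words[OF p] by (auto simp: dotted_def)
qed

lemma finite_words [simp]: "finite {w::letter list. length w = k}"
proof -
  have "(UNIV :: letter set) = {Dot, Down}" using letter.exhaust by blast
  then have "finite (UNIV :: letter set)" by (metis finite.emptyI finite.insertI)
  then show ?thesis using finite_lists_length_eq[of "UNIV :: letter set" k] by simp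
qed

lemma sum_words_prod:
  fixes F :: "nat \<Rightarrow> letter \<Rightarrow> complex"
  shows "(\<Sum>w\<in>{w. length w = k}. \<Prod>n<k. F n (w ! n)) = (\<Prod>n<k. F n Dot + F n Down)"
proof (induction k arbitrary: F)
  case 0
  then show ?case by simp
next
  case (Suc k)
  have eq: "{w::letter list. length w = Suc k} = (#) Dot ` {w. length w = k} \<union> (#) Down ` {w. length w = k}"
  proof -
    have "w \<in> (#) Dot ` {w. length w = k} \<union> (#) Down ` {w. length w = k}" if "length w = Suc k" for w
    proof -
      obtain a w' where "w = a # w'" "length w' = k" using \<open>length w = Suc k\<close> by (cases w) auto
      then show ?thesis by (cases a) auto
    qed
    then show ?thesis by auto
  qed
  have "(\<Sum>w\<in>{w. length w = Suc k}. \<Prod>n<Suc k. F n (w ! n)) =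
      F 0 Dot * (\<Sum>w\<in>{w. length w = k}. \<Prod>n<k. F (Suc n) (w ! n)) +
      F 0 Down * (\<Sum>w\<in>{w. length w = k}. \<Prod>n<k. F (Suc n) (w ! n))"
    unfolding eq
    by (subst sum.union_disjoint)
      (auto simp: sum.reindex prod.lessThan_Suc_shift sum_distrib_left simp del: prod.lessThan_Suc)
  also have "\<dots> = (\<Prod>n<Suc k. F n Dot + F n Down)"
    unfolding Suc.IH[of "\<lambda>n. F (Suc n)"] prod.lessThan_Suc_shift by (simp add: distrib_right)
  finally show ?case .
qed

lemma sum_kronecker:
  fixes f :: "'i \<Rightarrow> complex"
  assumes "finite S" "i \<in> S"
  shows "(\<Sum>a\<in>S. of_bool (i = a) * f a) = f i" "(\<Sum>a\<in>S. of_bool (a = i) * f a) = f i"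
proof -
  have "(\<Sum>a\<in>S. of_bool (i = a) * f a) = (\<Sum>a\<in>{i}. of_bool (i = a) * f a)"
    by (rule sum.mono_neutral_right) (use assms in auto)
  then show "(\<Sum>a\<in>S. of_bool (i = a) * f a) = f i" by simp
  then show "(\<Sum>a\<in>S. of_bool (a = i) * f a) = f i" by (simp add: eq_commute)
qed

lemma prod_kronecker:
  assumes "i \<in> multi_idx N k" "j \<in> multi_idx N k"
  shows "(\<Prod>n<k. of_bool (i ! n = j ! n) :: complex) = of_bool (i = j)"
proof -
  have "(\<Prod>n<k. of_bool (i ! n = j ! n) :: complex) = of_bool (\<forall>n\<in>{..<k}. i ! n = j ! n)"
    by (rule prod_of_bool) simp
  also have "(\<forall>n\<in>{..<k}. i ! n = j ! n) \<longleftrightarrow> i = j"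
    using assms by (auto simp: multi_idx_def list_eq_iff_nth_eq)
  finally show ?thesis .
qed

lemma sum_words_pi:
  assumes "i \<in> multi_idx N k" "j \<in> multi_idx N k"
  shows "(\<Sum>w\<in>{w. length w = k}. \<Prod>n<k. pi_mat N (w ! n) (i ! n) (j ! n)) = of_bool (i = j)"
proof -
  have "pi_mat N Dot a b + pi_mat N Down a b = of_bool (a = b)" for a b by (simp add: pi_mat_def)
  then show ?thesis
    unfolding sum_words_prod[of "\<lambda>n a. pi_mat N a (i ! n) (j ! n)" k] by (simp add: prod_kronecker[OF assms])
qed

text \<open>The two projections add up to the identity on each leg; expanding the tensor product
  gives one summand for each pair of words.\<close>

lemma sum_corners:
  assumes f: "f \<in> lparts k l" and N: "2 \<le> N"
  shows "(\<Sum>w1\<in>{w. length w = k}. \<Sum>w2\<in>{w. length w = l}. corner N w1 w2 f) = f"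
proof (rule lfam_eqI[of k l "\<lambda>N. \<Sum>w1\<in>{w. length w = k}. \<Sum>w2\<in>{w. length w = l}. corner N w1 w2 f"
      "\<lambda>N. f", OF _ _ N])
  show "lfam (parts k l) (\<lambda>N. \<Sum>w1\<in>{w. length w = k}. \<Sum>w2\<in>{w. length w = l}. corner N w1 w2 f)"
  proof (intro lfam_sum)
    fix w1 w2 :: "letter list" assume "w1 \<in> {w. length w = k}" "w2 \<in> {w. length w = l}"
    then show "lfam (parts k l) (\<lambda>N. corner N w1 w2 f)"
      using lfam_corner[OF lfam_lparts, of f w1 w2] f by auto
  qed
  show "lfam (parts k l) (\<lambda>N. f)" by (rule lfam_lparts[OF f])
  fix N i j assume i: "i \<in> multi_idx N k" and j: "j \<in> multi_idx N l"
  have "T_map (\<Sum>w1\<in>{w. length w = k}. \<Sum>w2\<in>{w. length w = l}. corner N w1 w2 f) j i =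
    (\<Sum>w1\<in>{w. length w = k}. \<Sum>w2\<in>{w. length w = l}. T_map (corner N w1 w2 f) j i)"
    by (simp add: T_map_lin lin_sum)
  also have "\<dots> = (\<Sum>w1\<in>{w. length w = k}. \<Sum>w2\<in>{w. length w = l}. \<Sum>a\<in>multi_idx N k. \<Sum>b\<in>multi_idx N l.
    (\<Prod>n<k. pi_mat N (w1 ! n) (i ! n) (a ! n)) * (\<Prod>n<l. pi_mat N (w2 ! n) (j ! n) (b ! n)) * T_map f b a)"
    by (intro sum.cong refl) (use f i j in \<open>auto simp: T_map_corner\<close>)
  also have "\<dots> = (\<Sum>a\<in>multi_idx N k. \<Sum>b\<in>multi_idx N l. \<Sum>w1\<in>{w. length w = k}. \<Sum>w2\<in>{w. length w = l}.
    (\<Prod>n<k. pi_mat N (w1 ! n) (i ! n) (a ! n)) * (\<Prod>n<l. pi_mat N (w2 ! n) (j ! n) (b ! n)) * T_map f b a)"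
    by (simp only: sum.swap[of _ "{w. length w = _}" "multi_idx N _"])
  also have "\<dots> = (\<Sum>a\<in>multi_idx N k. \<Sum>b\<in>multi_idx N l. of_bool (i = a) * of_bool (j = b) * T_map f b a)"
  proof (intro sum.cong refl)
    fix a b assume a: "a \<in> multi_idx N k" and b: "b \<in> multi_idx N l"
    show "(\<Sum>w1\<in>{w. length w = k}. \<Sum>w2\<in>{w. length w = l}.
      (\<Prod>n<k. pi_mat N (w1 ! n) (i ! n) (a ! n)) * (\<Prod>n<l. pi_mat N (w2 ! n) (j ! n) (b ! n)) * T_map f b a) =
      of_bool (i = a) * of_bool (j = b) * T_map f b a"
      unfolding sum_words_pi[OF i a, symmetric] sum_words_pi[OF j b, symmetric]
      unfolding sum_product unfolding sum_distrib_right ..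
  qed
  also have "\<dots> = T_map f j i"
    unfolding mult.assoc sum_distrib_left[symmetric] sum_kronecker(1)[OF finite_multi_idx j]
    by (rule sum_kronecker(1)[OF finite_multi_idx i])
  finally show "T_map (\<Sum>w1\<in>{w. length w = k}. \<Sum>w2\<in>{w. length w = l}. corner N w1 w2 f) j i = T_map f j i" .
qed


section \<open>The basis of dotted partitions\<close>

text \<open>A partition is the sum of its corners, and these are multiples of dotted partitions of
  the same points.\<close>

lemma basis_elt_span_dotted:
  assumes p: "p \<in> parts k l" and N: "2 \<le> N"
  shows "basis_elt p \<in> plin.span (dotted N ` parts k l)"
proof -
  have "corner N w1 w2 (basis_elt p) \<in> plin.span (dotted N ` parts k l)"
    if w: "length w1 = k" "length w2 = l" for w1 w2
  proof -
    have p': "p \<in> parts (length w1) (length w2)" using p w by simp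
    have "split_part (down_points w1 w2) p \<in> parts k l"
      using split_part_parts[OF p' down_points_subset] w by simp
    then show ?thesis unfolding corner_dotted[OF p' N]
      by (intro plin.span_scale plin.span_base) simp
  qed
  then have "(\<Sum>w1\<in>{w. length w = k}. \<Sum>w2\<in>{w. length w = l}. corner N w1 w2 (basis_elt p))
      \<in> plin.span (dotted N ` parts k l)"
    by (intro plin.span_sum) auto
  then show ?thesis using sum_corners[of "basis_elt p" k l N] p N by simp
qed

lemma inj_basis_elt: "inj basis_elt"
proof (rule injI)
  fix p q assume "basis_elt p = basis_elt q"
  then have "Poly_Mapping.keys (basis_elt p) = Poly_Mapping.keys (basis_elt q)" by simp
  then show "p = q" by simp
qed

lemma independent_basis_elt:
  assumes "finite A"
  shows "plin.independent (basis_elt ` A)"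
proof (rule plin.independent_if_scalars_zero)
  show "finite (basis_elt ` A)" using assms by simp
  fix u x assume z: "(\<Sum>v\<in>basis_elt ` A. pscale (u v) v) = 0" and "x \<in> basis_elt ` A"
  then obtain p where p: "p \<in> A" "x = basis_elt p" by blast
  have "(\<Sum>q\<in>A. pscale (u (basis_elt q)) (basis_elt q)) = 0"
    using z by (simp add: sum.reindex inj_on_subset[OF inj_basis_elt])
  then have "Poly_Mapping.lookup (\<Sum>q\<in>A. pscale (u (basis_elt q)) (basis_elt q)) p = 0" by simp
  then have "(\<Sum>q\<in>A. u (basis_elt q) * of_bool (q = p)) = 0"
    by (simp add: lookup_sum lookup_basis_elt)
  then show "u x = 0"
    using p assms by (simp add: of_bool_def if_distrib[of "\<lambda>x. _ * x"] cong: if_cong)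
qed

text \<open>A dimension count: the partitions in \<open>A\<close> are independent, lie in the span
  of their dotted versions, and these are no more numerous. The truncation to a finite
  \<open>A\<close> makes counting possible, and letting \<open>A\<close> mix different numbers of
  points gives injectivity across all sizes at once.\<close>

lemma dotted_basis_finite:
  assumes N: "2 \<le> N" and A: "A = (\<Union>k<n. \<Union>l<n. parts k l)"
  shows "inj_on (dotted N) A \<and> plin.independent (dotted N ` A)"
proof -
  have fin: "finite A" unfolding A by simp
  have span: "basis_elt ` A \<subseteq> plin.span (dotted N ` A)"
  proof
    fix f assume "f \<in> basis_elt ` A"
    then obtain k l p where p: "p \<in> parts k l" "k < n" "l < n" "f = basis_elt p" unfolding A by blast
    have "dotted N ` parts k l \<subseteq> dotted N ` A" using p unfolding A by blast
    then show "f \<in> plin.span (dotted N ` A)"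
      using basis_elt_span_dotted[OF p(1) N] plin.span_mono p(4) by blast
  qed
  have bound: "card A \<le> card T" if "finite T" "basis_elt ` A \<subseteq> plin.span T" for T
    using plin.independent_span_bound[OF that(1) independent_basis_elt[OF fin] that(2)]
    by (simp add: card_image inj_on_subset[OF inj_basis_elt])
  have card: "card (dotted N ` A) = card A"
    using bound[OF _ span] card_image_le[OF fin, of "dotted N"] fin by (simp add: le_antisym)
  have "plin.independent (dotted N ` A)"
  proof
    assume "plin.dependent (dotted N ` A)"
    then obtain f where f: "f \<in> dotted N ` A" "f \<in> plin.span (dotted N ` A - {f})"
      unfolding plin.dependent_def by blast
    have "plin.span (dotted N ` A) = plin.span (dotted N ` A - {f})"
      using plin.span_redundant[OF f(2)] f(1) by (simp add: insert_absorb)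
    then have "card A \<le> card (dotted N ` A - {f})" using span fin by (intro bound) auto
    also have "\<dots> < card (dotted N ` A)" by (rule card_Diff1_less) (use fin f in auto)
    finally show False using card by simp
  qed
  then show ?thesis using eq_card_imp_inj_on[OF fin card] by blast
qed

lemma finite_all_parts_bound:
  assumes "finite S" "S \<subseteq> all_parts"
  shows "\<exists>n. S \<subseteq> (\<Union>k<n. \<Union>l<n. parts k l)"
proof -
  have "S \<subseteq> (\<Union>k<n. \<Union>l<n. parts k l)" if n: "n = Suc (Max (insert 0 (n_up ` S \<union> n_low ` S)))" for n
  proof
    fix p assume p: "p \<in> S"
    then obtain k l where kl: "p \<in> parts k l" using assms unfolding all_parts_def by blast
    have "n_up p \<le> Max (insert 0 (n_up ` S \<union> n_low ` S))" "n_low p \<le> Max (insert 0 (n_up ` S \<union> n_low ` S))"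
      using p assms(1) by (auto intro!: Max_ge)
    then have "k < n" "l < n" using kl n by (simp_all add: less_Suc_eq_le)
    then show "p \<in> (\<Union>k<n. \<Union>l<n. parts k l)" using kl by blast
  qed
  then show ?thesis by blast
qed

lemma inj_on_dotted: "2 \<le> N \<Longrightarrow> inj_on (dotted N) all_parts"
proof (rule inj_onI)
  fix p q assume N: "2 \<le> N" and pq: "p \<in> all_parts" "q \<in> all_parts" "dotted N p = dotted N q"
  then obtain n where "{p, q} \<subseteq> (\<Union>k<n. \<Union>l<n. parts k l)" using finite_all_parts_bound[of "{p, q}"] by auto
  then show "p = q" using dotted_basis_finite[OF N refl, of n] pq(3) by (meson inj_onD insert_subset)
qed

lemma independent_dotted: "2 \<le> N \<Longrightarrow> plin.independent (dotted N ` all_parts)"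
  unfolding plin.independent_explicit_finite_subsets
proof (intro allI impI)
  fix S u assume N: "2 \<le> N" and S: "S \<subseteq> dotted N ` all_parts" "finite S" "(\<Sum>v\<in>S. pscale (u v) v) = 0"
  then obtain S' where S': "S' \<subseteq> all_parts" "finite S'" "S = dotted N ` S'"
    using finite_subset_image[OF S(2,1)] by auto
  obtain n where "S' \<subseteq> (\<Union>k<n. \<Union>l<n. parts k l)" using finite_all_parts_bound[OF S'(2,1)] ..
  then have "S \<subseteq> dotted N ` (\<Union>k<n. \<Union>l<n. parts k l)" using S' by blast
  then have "plin.independent S"
    using dotted_basis_finite[OF N refl, of n] plin.independent_mono by blast
  then have indep: "finite S \<longrightarrow> (\<forall>u. (\<Sum>v\<in>S. pscale (u v) v) = 0 \<longrightarrow> (\<forall>v\<in>S. u v = 0))"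
    unfolding plin.independent_explicit_finite_subsets by (rule allE[of _ S]) simp
  show "\<forall>v\<in>S. u v = 0" by (intro ballI) (rule indep[rule_format, OF S(2,3)])
qed

lemma U_map_linear: "2 \<le> N \<Longrightarrow> Vector_Spaces.linear pscale pscale (U_map N s)"
  unfolding U_map_def by (rule plin2.linear_construct[OF independent_dotted])

lemma U_map_add: "2 \<le> N \<Longrightarrow> U_map N s (f + g) = U_map N s f + U_map N s g"
  and U_map_pscale: "2 \<le> N \<Longrightarrow> U_map N s (pscale c f) = pscale c (U_map N s f)"
  using U_map_linear[of N s] unfolding Vector_Spaces.linear_iff by blast+

lemma U_map_zero: "2 \<le> N \<Longrightarrow> U_map N s 0 = 0"
  using U_map_pscale[of N s 0 0] by (simp only: plin.scale_zero_left)

lemma U_map_sum: "2 \<le> N \<Longrightarrow> U_map N s (\<Sum>i\<in>I. F i) = (\<Sum>i\<in>I. U_map N s (F i))"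
  by (induction I rule: infinite_finite_induct) (simp_all add: U_map_zero U_map_add)

lemma U_map_dotted: "2 \<le> N \<Longrightarrow> p \<in> parts k l \<Longrightarrow> U_map N s (dotted N p) = U_dotted N s p"
proof -
  assume N: "2 \<le> N" and p: "p \<in> parts k l"
  have "p \<in> all_parts" using p by (auto simp: all_parts_def)
  then show ?thesis unfolding U_map_def
    using plin2.construct_basis[OF independent_dotted[OF N], of "dotted N p"]
      the_inv_into_f_f[OF inj_on_dotted[OF N]] by simp
qed

section \<open>The images of dotted partitions\<close>

lemma delta_one_block:
  "delta (one_block B S) i j = of_bool (\<forall>x\<in>S. \<forall>y\<in>S. label i j x = label i j y)"
  unfolding delta_def one_block_def by auto

lemma one_block_partition: "S \<subseteq> B \<Longrightarrow> partition_on B (one_block B S)"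
  unfolding one_block_def by (intro partition_onI) (auto simp: disjnt_iff split: if_splits)

text \<open>A bound on the support that does not depend on N. The parametrization by subsets is not
  injective: every one-element \<open>S\<close> and the empty \<open>S\<close> give the partition
  into singletons, so their coefficients add up.\<close>

lemma keys_U_block:
  assumes "finite B" "B \<noteq> {}"
  shows "Poly_Mapping.keys (U_block N s B) \<subseteq> one_block B ` Pow B"
proof -
  have "U_block N s B \<in> lspan (one_block B ` Pow B)"
  proof (cases "card B = 1")
    case True
    then obtain x where "B = {x}" using card_1_singletonE by blast
    then have "{B} = one_block B B" by (auto simp: one_block_def)
    then have "{B} \<in> one_block B ` Pow B" by blast
    then show ?thesis using True by (simp add: U_block_def lspan_pscale)
  next
    case False
    then show ?thesis
      by (auto simp: U_block_def Let_def intro!: lspan_add lspan_sum lspan_pscale)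
  qed
  then show ?thesis by (simp add: lspan_def)
qed

lemma ratfam_U_const: "ratfam (\<lambda>N. of_real (U_const N s))"
proof -
  have 1: "ratfam (\<lambda>N. 1 / (of_nat N - 1))"
    by (intro ratfam_divide ratfam_diff ratfam_of_nat) auto
  have 2: "ratfam (\<lambda>N. of_real s / of_real (sqrt (real N)))"
    by (intro ratfam_divide ratfam_sqrt) auto
  have "ratfam (\<lambda>N. 1 / (of_nat N - 1) * (1 + of_real s / of_real (sqrt (real N))))"
    by (intro ratfam_mult 1 ratfam_add 2) simp
  then show ?thesis by (simp add: U_const_def)
qed

lemma lfam_U_block:
  assumes "finite B" "B \<noteq> {}"
  shows "lfam (one_block B ` Pow B) (\<lambda>N. U_block N s B)"
proof -
  let ?K = "one_block B ` Pow B"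
  have 1: "ratfam (\<lambda>N. of_real ((- U_const N s) ^ n))" for n
    using ratfam_power[OF ratfam_uminus[OF ratfam_U_const]] by simp
  have 2: "ratfam (\<lambda>N. of_real ((s / sqrt (real N)) ^ n))" for n
    using ratfam_power[OF ratfam_divide[OF ratfam_const ratfam_sqrt], of "of_real s"] by simp
  have 3: "ratfam (\<lambda>N. of_real (real N - 1))"
    using ratfam_diff[OF ratfam_of_nat ratfam_const, of 1] by simp
  have "lfam ?K (\<lambda>N. (\<Sum>S\<in>Pow B - {{}}. pscale (of_real ((- U_const N s) ^ (card B - card S))) (basis_elt (one_block B S)))
        + pscale (of_real ((real N - 1) * (- U_const N s) ^ card B + (s / sqrt (real N)) ^ card B))
            (basis_elt (one_block B {})))"
    unfolding of_real_add of_real_mult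
    by (intro lfam_add lfam_sum lfam_pscale ratfam_add ratfam_mult 1 2 3 lfam_const) auto
  moreover have "lfam ?K (\<lambda>N. pscale (of_real (sqrt (real N))) (basis_elt {B}))" if one: "card B = 1"
  proof -
    obtain x where "B = {x}" using card_1_singletonE[OF one] by blast
    then have "{B} = one_block B B" by (auto simp: one_block_def)
    then have "{B} \<in> ?K" by blast
    then show ?thesis by (intro lfam_pscale ratfam_sqrt lfam_const) simp
  qed
  ultimately show ?thesis by (cases "card B = 1") (simp_all add: U_block_def Let_def)
qed

text \<open>Origin of the coefficients. For a summation index a < N - 1 the product over the block
  consists of factors \<delta> - c; expanding over the set \<open>S\<close> of points that
  contribute \<delta> gives \<open>one_block B S\<close>, weighted by - c for every other point. The
  empty \<open>S\<close> leaves all N - 1 values of a free, and a = N - 1 adds a power of s / sqrt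
  N: together the coefficient of the partition into singletons. A singleton block carries the label
  N - 1, whose row of U sums to sqrt N.\<close>

lemma T_map_U_block:
  assumes N: "2 \<le> N" and B: "finite B" "B \<noteq> {}"
    and single: "card B = 1 \<Longrightarrow> (\<And>x. x \<in> B \<Longrightarrow> label i j x = N - 1)"
    and large: "card B \<noteq> 1 \<Longrightarrow> (\<And>x. x \<in> B \<Longrightarrow> label i j x < N - 1)"
  shows "T_map (U_block N s B) j i = (\<Sum>c<N. \<Prod>x\<in>B. U_mat N s (label i j x) c)"
proof (cases "card B = 1")
  case True
  then obtain x where x: "B = {x}" using card_1_singletonE by blast
  have "sqrt (real N) = real N * (1 / sqrt (real N))" by (simp add: real_div_sqrt)
  then have "complex_of_real (sqrt (real N)) = of_nat N * of_real (1 / sqrt (real N))"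
    by (metis of_real_mult of_real_of_nat_eq)
  then show ?thesis
    using single[OF True] by (simp add: U_block_def T_map_lin lin_pscale x delta_def U_mat_def)
next
  case False
  let ?c = "complex_of_real (U_const N s)" and ?l = "label i j"
  have lab: "?l x < N - 1" if "x \<in> B" for x using large[OF False that] .
  have "(\<Sum>a<N - 1. \<Prod>x\<in>B. U_mat N s (?l x) a) =
      (\<Sum>a<N - 1. \<Prod>x\<in>B. of_bool (?l x = a) + - ?c)"
    by (intro sum.cong prod.cong refl) (use lab in \<open>force simp: U_mat_def\<close>)
  also have "\<dots> = (\<Sum>a<N - 1. \<Sum>S\<in>Pow B. (\<Prod>x\<in>S. of_bool (?l x = a)) * (- ?c) ^ (card B - card S))"
    unfolding prod_add[OF B(1)] prod_constant
    by (intro sum.cong refl) (simp add: card_Diff_subset finite_subset[OF _ B(1)])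
  also have "\<dots> = (\<Sum>S\<in>Pow B. (\<Sum>a<N - 1. \<Prod>x\<in>S. of_bool (?l x = a)) * (- ?c) ^ (card B - card S))"
    by (subst sum.swap) (simp add: sum_distrib_right)
  also have "\<dots> = (\<Sum>S\<in>Pow B - {{}}. (\<Sum>a<N - 1. \<Prod>x\<in>S. of_bool (?l x = a)) * (- ?c) ^ (card B - card S))
      + of_nat (N - 1) * (- ?c) ^ card B"
    using B by (subst sum.remove[of _ "{}"]) auto
  \<comment> \<open>For nonempty \<open>S\<close> the common label of its points is the only index
    that contributes, and it is below N - 1.\<close>
  also have "(\<Sum>S\<in>Pow B - {{}}. (\<Sum>a<N - 1. \<Prod>x\<in>S. of_bool (?l x = a)) * (- ?c) ^ (card B - card S)) =
      (\<Sum>S\<in>Pow B - {{}}. of_bool (\<forall>x\<in>S. \<forall>y\<in>S. ?l x = ?l y) * (- ?c) ^ (card B - card S))"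
  proof (intro sum.cong refl arg_cong[where f = "\<lambda>z. z * _"])
    fix S assume S: "S \<in> Pow B - {{}}"
    then obtain x0 where x0: "x0 \<in> S" by blast
    have fS: "finite S" using S B finite_subset by blast
    have "(\<Sum>a<N - 1. \<Prod>x\<in>S. of_bool (?l x = a) :: complex) =
        (\<Sum>a<N - 1. of_bool (?l x0 = a) * of_bool (\<forall>x\<in>S. \<forall>y\<in>S. ?l x = ?l y))"
      unfolding prod_of_bool[OF fS] of_bool_conj[symmetric]
      by (intro sum.cong refl arg_cong[where f = of_bool]) (use x0 in metis)
    also have "\<dots> = of_bool (\<forall>x\<in>S. \<forall>y\<in>S. ?l x = ?l y)"
      by (rule sum_kronecker) (use lab[of x0] x0 S in auto)
    finally show "(\<Sum>a<N - 1. \<Prod>x\<in>S. of_bool (?l x = a) :: complex) = of_bool (\<forall>x\<in>S. \<forall>y\<in>S. ?l x = ?l y)" .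
  qed
  finally have 1: "(\<Sum>a<N - 1. \<Prod>x\<in>B. U_mat N s (?l x) a) =
    (\<Sum>S\<in>Pow B - {{}}. of_bool (\<forall>x\<in>S. \<forall>y\<in>S. ?l x = ?l y) * (- ?c) ^ (card B - card S))
      + of_nat (N - 1) * (- ?c) ^ card B" .
  have "N = Suc (N - 1)" using N by simp
  then have "(\<Sum>a<N. \<Prod>x\<in>B. U_mat N s (?l x) a) =
      (\<Sum>a<N - 1. \<Prod>x\<in>B. U_mat N s (?l x) a) + (\<Prod>x\<in>B. U_mat N s (?l x) (N - 1))"
    using sum.lessThan_Suc[of "\<lambda>a. \<Prod>x\<in>B. U_mat N s (?l x) a" "N - 1"] by simp
  also have "(\<Prod>x\<in>B. U_mat N s (?l x) (N - 1)) = (\<Prod>x\<in>B. of_real (s / sqrt (real N)))"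
    by (intro prod.cong refl) (use lab in \<open>force simp: U_mat_def\<close>)
  finally show ?thesis unfolding 1
    using False N by (simp add: U_block_def Let_def T_map_lin lin_add lin_pscale lin_sum delta_one_block
      of_nat_diff mult.commute)
qed

text \<open>Choices outside the support have coefficient zero, so the sum may range over a set of
  choices independent of N.\<close>

lemma U_dotted_expand:
  assumes q: "q \<in> parts k l"
  shows "lin \<phi> (U_dotted N s q) = (\<Sum>g\<in>(\<Pi>\<^sub>E B\<in>q. one_block B ` Pow B).
    (\<Prod>B\<in>q. Poly_Mapping.lookup (U_block N s B) (g B)) * \<phi> (\<Union>B\<in>q. g B))"
proof -
  have fq: "finite q" using finite_parts_member[OF q] .
  have sub: "Poly_Mapping.keys (U_block N s B) \<subseteq> one_block B ` Pow B" if "B \<in> q" for B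
    using keys_U_block[OF finite_block[OF q that] parts_nonempty[OF q that]] .
  have fin: "finite (one_block B ` Pow B)" if "B \<in> q" for B using finite_block[OF q that] by simp
  have "lin \<phi> (U_dotted N s q) = (\<Sum>g\<in>(\<Pi>\<^sub>E B\<in>q. Poly_Mapping.keys (U_block N s B)).
    (\<Prod>B\<in>q. Poly_Mapping.lookup (U_block N s B) (g B)) * \<phi> (\<Union>B\<in>q. g B))"
    unfolding U_dotted_def lin_sum lin_pscale lin_basis_elt ..
  also have "\<dots> = (\<Sum>g\<in>(\<Pi>\<^sub>E B\<in>q. one_block B ` Pow B).
    (\<Prod>B\<in>q. Poly_Mapping.lookup (U_block N s B) (g B)) * \<phi> (\<Union>B\<in>q. g B))"
  proof (rule sum.mono_neutral_left)
    show "finite (\<Pi>\<^sub>E B\<in>q. one_block B ` Pow B)" using fq fin by (intro finite_PiE) auto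
    show "(\<Pi>\<^sub>E B\<in>q. Poly_Mapping.keys (U_block N s B)) \<subseteq> (\<Pi>\<^sub>E B\<in>q. one_block B ` Pow B)"
      using sub by (intro PiE_mono) auto
    show "\<forall>g\<in>(\<Pi>\<^sub>E B\<in>q. one_block B ` Pow B) - (\<Pi>\<^sub>E B\<in>q. Poly_Mapping.keys (U_block N s B)).
      (\<Prod>B\<in>q. Poly_Mapping.lookup (U_block N s B) (g B)) * \<phi> (\<Union>B\<in>q. g B) = 0"
    proof
      fix g assume g: "g \<in> (\<Pi>\<^sub>E B\<in>q. one_block B ` Pow B) - (\<Pi>\<^sub>E B\<in>q. Poly_Mapping.keys (U_block N s B))"
      then obtain B where "B \<in> q" "g B \<notin> Poly_Mapping.keys (U_block N s B)" by (auto simp: PiE_def Pi_def)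
      then show "(\<Prod>B\<in>q. Poly_Mapping.lookup (U_block N s B) (g B)) * \<phi> (\<Union>B\<in>q. g B) = 0"
        using fq by (auto simp: in_keys_iff)
    qed
  qed
  finally show ?thesis .
qed

text \<open>The delta of a union of partitions of the blocks is the product of their deltas, so the
  multilinear expansion folds back into a product over the blocks.\<close>

lemma T_map_U_dotted:
  assumes q: "q \<in> parts k l"
  shows "T_map (U_dotted N s q) j i = (\<Prod>B\<in>q. T_map (U_block N s B) j i)"
proof -
  have fq: "finite q" using finite_parts_member[OF q] .
  have fin: "finite (one_block B ` Pow B)" if "B \<in> q" for B using finite_block[OF q that] by simp
  have "delta (\<Union>B\<in>q. g B) i j = (\<Prod>B\<in>q. delta (g B) i j)" for g
    unfolding delta_def prod_of_bool[OF fq] by simp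
  then have "T_map (U_dotted N s q) j i = (\<Sum>g\<in>(\<Pi>\<^sub>E B\<in>q. one_block B ` Pow B).
     \<Prod>B\<in>q. Poly_Mapping.lookup (U_block N s B) (g B) * delta (g B) i j)"
    unfolding T_map_lin U_dotted_expand[OF q] by (simp add: prod.distrib)
  also have "\<dots> = (\<Prod>B\<in>q. \<Sum>r\<in>one_block B ` Pow B. Poly_Mapping.lookup (U_block N s B) r * delta r i j)"
    by (rule prod_sum_PiE[symmetric]) (use fq fin in auto)
  also have "\<dots> = (\<Prod>B\<in>q. T_map (U_block N s B) j i)"
    unfolding T_map_lin
    by (intro prod.cong refl lin_superset[symmetric] fin keys_U_block finite_block[OF q] parts_nonempty[OF q])
  finally show ?thesis .
qed

lemma lfam_U_dotted:
  assumes q: "q \<in> tparts v w"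
  shows "lfam (tparts v w) (\<lambda>N. U_dotted N s q)"
  unfolding lfam_def
proof (intro conjI allI impI)
  note qp = tparts_parts[OF q]
  fix r
  have "ratfam (\<lambda>N. Poly_Mapping.lookup (U_block N s B) r)" if "B \<in> q" for B r
    using lfam_U_block[OF finite_block[OF qp that] parts_nonempty[OF qp that]] by (simp add: lfam_def)
  then show "ratfam (\<lambda>N. Poly_Mapping.lookup (U_dotted N s q) r)"
    unfolding lookup_eq_lin[of "U_dotted _ s q"] U_dotted_expand[OF qp]
    by (intro ratfam_sum ratfam_mult ratfam_prod) auto
next
  note qp = tparts_parts[OF q]
  fix N :: nat
  have "(\<Union>B\<in>q. g B) \<in> tparts v w" if g: "g \<in> (\<Pi>\<^sub>E B\<in>q. Poly_Mapping.keys (U_block N s B))" for g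
  proof -
    have part: "partition_on B (g B)" if B: "B \<in> q" for B
    proof -
      have "g B \<in> one_block B ` Pow B"
        using g B keys_U_block[OF finite_block[OF qp B] parts_nonempty[OF qp B], of N s] by (auto simp: PiE_def Pi_def)
      then show ?thesis using one_block_partition by auto
    qed
    have U: "\<Union>(g B) = B" if "B \<in> q" for B using part[OF that] by (simp add: partition_on_def)
    have "(\<Union>B\<in>q. g B) \<in> parts (length v) (length w)"
    proof (rule partsI)
      have "\<Union>(\<Union>B\<in>q. g B) = (\<Union>B\<in>q. \<Union>(g B))" by blast
      also have "\<dots> = \<Union>q" using U by auto
      finally show "\<Union>(\<Union>B\<in>q. g B) = points (length v) (length w)" using Union_parts[OF qp] by simp
      show "{} \<notin> (\<Union>B\<in>q. g B)" using part by (auto simp: partition_on_def)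
      fix C D x assume "C \<in> (\<Union>B\<in>q. g B)" "D \<in> (\<Union>B\<in>q. g B)" and x: "x \<in> C" "x \<in> D"
      then obtain B B' where B: "B \<in> q" "C \<in> g B" "B' \<in> q" "D \<in> g B'" by blast
      then have "x \<in> B" "x \<in> B'" using U x by blast+
      then have "B = B'" using parts_block_unique[OF qp] B by blast
      then have "C \<in> g B" "D \<in> g B" using B by auto
      then show "C = D" using part[OF B(1)] x unfolding partition_on_def pairwise_def disjnt_iff
        by metis
    qed
    \<comment> \<open>A triangle point is a block of \<open>q\<close>, and a one-point set has only
      one partition.\<close>
    moreover have "{x} \<in> (\<Union>B\<in>q. g B)" if x: "x \<in> tri_points v w" for x
    proof -
      have xq: "{x} \<in> q" using q x by (simp add: tparts_def)
      have "g {x} \<subseteq> Pow {x}" "{} \<notin> g {x}" "\<Union>(g {x}) = {x}"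
        using part[OF xq] by (auto simp: partition_on_def)
      then have "{x} \<in> g {x}" by (auto simp: subset_singleton_iff Pow_insert)
      then show ?thesis using xq by blast
    qed
    ultimately show ?thesis by (simp add: tparts_def)
  qed
  then show "U_dotted N s q \<in> lspan (tparts v w)"
    unfolding U_dotted_def by (intro lspan_sum lspan_pscale) simp
qed


section \<open>The functor on corners\<close>

text \<open>The second factor \<open>basis_elt {}\<close> is a dummy that makes this linear extension a bilinear one.\<close>

definition U_corner :: "nat \<Rightarrow> real \<Rightarrow> letter list \<Rightarrow> letter list \<Rightarrow> lpart \<Rightarrow> lpart"
  where "U_corner N s w1 w2 f = bilinear_ext (\<lambda>p _. pscale (split_factor N (down_points w1 w2) p)
    (U_dotted N s (split_part (down_points w1 w2) p))) f (basis_elt {})"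

lemma bilinear_ext_sum_left:
  "bilinear_ext h (\<Sum>i\<in>I. pscale (c i) (F i)) g = (\<Sum>i\<in>I. pscale (c i) (bilinear_ext h (F i) g))"
  by (rule poly_mapping_eqI) (simp only: lookup_eq_lin lin_bilinear_ext lin_sum lin_pscale)

lemma bilinear_ext_sum_right:
  "bilinear_ext h f (\<Sum>i\<in>I. pscale (c i) (F i)) = (\<Sum>i\<in>I. pscale (c i) (bilinear_ext h f (F i)))"
  by (rule poly_mapping_eqI)
    (simp only: lookup_eq_lin lin_bilinear_ext lin_sum lin_pscale lin_sum_functional lin_const_mult)

text \<open>\<open>U_map\<close> is built on a basis that depends on N, which hides how its values
  vary. \<open>U_corner\<close> gives them by a formula with rational coefficients, as interpolation
  requires.\<close>

lemma U_map_corner: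
  assumes f: "f \<in> lparts (length w1) (length w2)" and N: "2 \<le> N"
  shows "U_map N s (corner N w1 w2 f) = U_corner N s w1 w2 f"
proof -
  let ?K = "Poly_Mapping.keys f" and ?c = "Poly_Mapping.lookup f" and ?D = "down_points w1 w2"
  have f_eq: "f = (\<Sum>p\<in>?K. pscale (?c p) (basis_elt p))" by (rule basis_expansion) auto
  have "corner N w1 w2 f = corner N w1 w2 (\<Sum>p\<in>?K. pscale (?c p) (basis_elt p))"
    using f_eq by simp
  also have "\<dots> = (\<Sum>p\<in>?K. pscale (?c p) (corner N w1 w2 (basis_elt p)))"
    unfolding corner_def lcomp_def bilinear_ext_sum_left bilinear_ext_sum_right ..
  finally have 1: "corner N w1 w2 f = (\<Sum>p\<in>?K. pscale (?c p) (corner N w1 w2 (basis_elt p)))" .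
  have "U_map N s (corner N w1 w2 (basis_elt p)) = U_corner N s w1 w2 (basis_elt p)" if "p \<in> ?K" for p
  proof -
    have p: "p \<in> parts (length w1) (length w2)" using keys_lparts[OF f that] .
    show ?thesis unfolding corner_dotted[OF p N] U_map_pscale[OF N]
        U_map_dotted[OF N split_part_parts[OF p down_points_subset]]
      by (simp add: U_corner_def)
  qed
  then have "U_map N s (corner N w1 w2 f) = (\<Sum>p\<in>?K. pscale (?c p) (U_corner N s w1 w2 (basis_elt p)))"
    unfolding 1 by (simp add: U_map_sum[OF N] U_map_pscale[OF N])
  also have "\<dots> = U_corner N s w1 w2 (\<Sum>p\<in>?K. pscale (?c p) (basis_elt p))"
    unfolding U_corner_def bilinear_ext_sum_left ..
  finally show ?thesis using f_eq by simp
qed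

lemma split_part_tparts:
  assumes p: "p \<in> parts (length w1) (length w2)"
  shows "split_part (down_points w1 w2) p \<in> tparts (map U_obj w1) (map U_obj w2)"
  using split_part_parts[OF p down_points_subset]
  by (auto simp: tparts_def split_part_def down_points_def)

lemma lfam_U_corner:
  assumes "lfam (parts (length w1) (length w2)) F"
  shows "lfam (tparts (map U_obj w1) (map U_obj w2)) (\<lambda>N. U_corner N s w1 w2 (F N))"
  unfolding U_corner_def
proof (rule lfam_bilinear_ext[where S' = "{{}}"])
  show "lfam (parts (length w1) (length w2)) F" by fact
  show "lfam {{}} (\<lambda>N. basis_elt {})" by (rule lfam_const) simp
qed (auto intro!: lfam_pscale ratfam_split_factor lfam_U_dotted split_part_tparts)

lemma U_corner_ltparts:
  assumes "f \<in> lparts (length w1) (length w2)" "2 \<le> N"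
  shows "U_corner N s w1 w2 f \<in> ltparts (map U_obj w1) (map U_obj w2)"
  using lfam_U_corner[OF lfam_lparts[OF assms(1)], of s] assms(2)
  unfolding lfam_def ltparts_lspan by blast

text \<open>Entry of the conjugate of \<open>T_map f\<close> by tensor powers of U; as U is real,
  its adjoint enters as U with exchanged indices.\<close>

definition conj_T :: "nat \<Rightarrow> real \<Rightarrow> nat \<Rightarrow> nat \<Rightarrow> lpart \<Rightarrow> nat list \<Rightarrow> nat list \<Rightarrow> complex"
  where "conj_T N s k l f j i = (\<Sum>a\<in>multi_idx N k. \<Sum>b\<in>multi_idx N l.
    tensor_power (U_mat N s) k i a * tensor_power (U_mat N s) l j b * T_map f b a)"

text \<open>Both sides become products over blocks of sums of rows of U.
  \<open>prod_blocks_split\<close> detaches the triangle points with the very factor in the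
  definition of \<open>U_corner\<close>, and \<open>T_map_U_block\<close> recognizes what is
  left.\<close>

lemma T_map_U_corner:
  assumes N: "2 \<le> N" and s: "s = 1 \<or> s = - 1" and f: "f \<in> lparts (length w1) (length w2)"
    and i: "i \<in> word_idx N (map U_obj w1)" and j: "j \<in> word_idx N (map U_obj w2)"
  shows "T_map (U_corner N s w1 w2 f) j i = conj_T N s (length w1) (length w2) f j i"
proof -
  let ?D = "down_points w1 w2" and ?X = "points (length w1) (length w2)"
  have lab: "label i j x \<in> color_idx N (U_obj (letter_of w1 w2 x))" if "x \<in> ?X" for x
    using that word_idx_nth[OF i] word_idx_nth[OF j] by (cases x) (auto simp: letter_of_def)
  have labD: "label i j x = N - 1" if "x \<in> ?D" for x
    using lab[of x] that by (simp add: down_points_iff color_idx_def)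
  have labE: "label i j x < N - 1" if "x \<in> ?X - ?D" for x
  proof -
    have "letter_of w1 w2 x = Dot" using that letter.exhaust by (auto simp: down_points_iff)
    then show ?thesis using lab[of x] that by (simp add: color_idx_def)
  qed
  have key: "split_factor N ?D p * T_map (U_dotted N s (split_part ?D p)) j i =
     (\<Sum>a\<in>multi_idx N (length w1). \<Sum>b\<in>multi_idx N (length w2).
    tensor_power (U_mat N s) (length w1) i a * tensor_power (U_mat N s) (length w2) j b * delta p a b)"
    if p: "p \<in> parts (length w1) (length w2)" for p
  proof -
    let ?q = "split_part ?D p"
    have q: "?q \<in> parts (length w1) (length w2)" by (rule split_part_parts[OF p down_points_subset])
    have ex: "case_sum (\<lambda>n. U_mat N s (i ! n)) (\<lambda>n. U_mat N s (j ! n)) x c = U_mat N s (label i j x) c" for x c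
      by (cases x) simp_all
    have "(\<Sum>a\<in>multi_idx N (length w1). \<Sum>b\<in>multi_idx N (length w2).
        tensor_power (U_mat N s) (length w1) i a * tensor_power (U_mat N s) (length w2) j b * delta p a b) =
      (\<Prod>B\<in>p. \<Sum>c<N. \<Prod>x\<in>B. U_mat N s (label i j x) c)"
      using sum_delta_blocks[OF p, where mu = "\<lambda>n. U_mat N s (i ! n)" and ml = "\<lambda>n. U_mat N s (j ! n)"]
      unfolding ex tensor_power_def .
    also have "\<dots> = split_factor N ?D p * (\<Prod>B\<in>?q. \<Sum>c<N. \<Prod>x\<in>B. U_mat N s (label i j x) c)"
    proof (rule prod_blocks_split[OF p down_points_subset, where \<kappa> = "of_real (1 / sqrt (real N))"])
      show "0 < N" using N by simp
      show "U_mat N s (label i j x) c = of_real (1 / sqrt (real N))" if "x \<in> ?D" for x c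
        using labD[OF that] by (simp add: U_mat_def)
      show "(\<Sum>c<N. U_mat N s (label i j x) c) = 0" if "x \<in> ?X - ?D" for x
        using U_mat_row_sum[OF N s, of "label i j x"] labE[OF that] by simp
    qed
    also have "\<dots> = split_factor N ?D p * T_map (U_dotted N s ?q) j i"
    proof (cases "\<exists>B\<in>p. card (B - ?D) = 1")
      case True
      then show ?thesis by (simp add: split_factor_def)
    next
      case False
      have "T_map (U_block N s B) j i = (\<Sum>c<N. \<Prod>x\<in>B. U_mat N s (label i j x) c)" if B: "B \<in> ?q" for B
      proof (rule T_map_U_block[OF N finite_block[OF q B] parts_nonempty[OF q B]])
        show "label i j x = N - 1" if "card B = 1" "x \<in> B" for x
        proof -
          have "B \<in> (\<lambda>x. {x}) ` ?D" using B False \<open>card B = 1\<close> by (auto simp: split_part_def)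
          then show ?thesis using labD \<open>x \<in> B\<close> by auto
        qed
        show "label i j x < N - 1" if "card B \<noteq> 1" "x \<in> B" for x
        proof -
          obtain B' where "B' \<in> p" "B = B' - ?D" using B \<open>card B \<noteq> 1\<close> by (auto simp: split_part_def)
          then show ?thesis using labE[of x] \<open>x \<in> B\<close> parts_subset_points[OF p] by auto
        qed
      qed
      then show ?thesis unfolding T_map_U_dotted[OF q] by simp
    qed
    finally show ?thesis ..
  qed
  have "T_map (U_corner N s w1 w2 f) j i =
      lin (\<lambda>p. split_factor N ?D p * T_map (U_dotted N s (split_part ?D p)) j i) f"
    unfolding U_corner_def T_map_lin lin_bilinear_ext lin_pscale lin_basis_elt ..
  also have "\<dots> = lin (\<lambda>p. \<Sum>a\<in>multi_idx N (length w1). \<Sum>b\<in>multi_idx N (length w2).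
    tensor_power (U_mat N s) (length w1) i a * tensor_power (U_mat N s) (length w2) j b * delta p a b) f"
    by (rule lin_cong) (rule key[OF keys_lparts[OF f]])
  finally show ?thesis unfolding conj_T_def T_map_lin
    by (simp only: lin_sum_functional lin_const_mult)
qed

section \<open>Functoriality\<close>

lemma word_idx_filter:
  "0 < N \<Longrightarrow> word_idx N v = {m \<in> multi_idx N (length v). \<forall>n<length v. m ! n \<in> color_idx N (v ! n)}"
  using word_idx_subset[of N v] by (auto simp: word_idx_def multi_idx_def)

lemma sum_word_idx_prod:
  fixes f :: "nat \<Rightarrow> nat \<Rightarrow> complex"
  assumes N: "0 < N"
  shows "(\<Sum>m\<in>word_idx N v. \<Prod>n<length v. f n (m ! n)) =
    (\<Prod>n<length v. \<Sum>b<N. of_bool (b \<in> color_idx N (v ! n)) * f n b)"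
proof -
  have "(\<Sum>m\<in>word_idx N v. \<Prod>n<length v. f n (m ! n)) =
      (\<Sum>m\<in>multi_idx N (length v). \<Prod>n<length v. of_bool (m ! n \<in> color_idx N (v ! n)) * f n (m ! n))"
    unfolding word_idx_filter[OF N]
  proof (rule sum.mono_neutral_cong_left)
    show "\<forall>m\<in>multi_idx N (length v) -
         {m \<in> multi_idx N (length v). \<forall>n<length v. m ! n \<in> color_idx N (v ! n)}.
       (\<Prod>n<length v. of_bool (m ! n \<in> color_idx N (v ! n)) * f n (m ! n)) = 0" by auto
  qed auto
  also have "\<dots> = (\<Prod>n<length v. \<Sum>b<N. of_bool (b \<in> color_idx N (v ! n)) * f n b)"
    by (rule sum_multi_idx_prod)
  finally show ?thesis .
qed

lemma sum_swap3:
  "(\<Sum>a\<in>A. \<Sum>b\<in>B. \<Sum>c\<in>C. t a b c) = (\<Sum>c\<in>C. \<Sum>a\<in>A. \<Sum>b\<in>B. t a b c)"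
proof -
  have "(\<Sum>a\<in>A. \<Sum>b\<in>B. \<Sum>c\<in>C. t a b c) = (\<Sum>a\<in>A. \<Sum>c\<in>C. \<Sum>b\<in>B. t a b c)"
    by (intro sum.cong refl sum.swap)
  also have "\<dots> = (\<Sum>c\<in>C. \<Sum>a\<in>A. \<Sum>b\<in>B. t a b c)" by (rule sum.swap)
  finally show ?thesis .
qed

lemma sum_swap4:
  "(\<Sum>a\<in>A. \<Sum>b\<in>B. \<Sum>c\<in>C. \<Sum>d\<in>D. t a b c d) = (\<Sum>c\<in>C. \<Sum>d\<in>D. \<Sum>a\<in>A. \<Sum>b\<in>B. t a b c d)"
proof -
  have "(\<Sum>a\<in>A. \<Sum>b\<in>B. \<Sum>c\<in>C. \<Sum>d\<in>D. t a b c d) = (\<Sum>c\<in>C. \<Sum>a\<in>A. \<Sum>b\<in>B. \<Sum>d\<in>D. t a b c d)"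
    by (rule sum_swap3)
  also have "\<dots> = (\<Sum>c\<in>C. \<Sum>d\<in>D. \<Sum>a\<in>A. \<Sum>b\<in>B. t a b c d)"
    by (intro sum.cong refl sum_swap3)
  finally show ?thesis .
qed

text \<open>Brings out the Gram matrix of \<open>u\<close> over the restricted middle index, which
  \<open>word_gram\<close> evaluates.\<close>

lemma sum_gram:
  fixes u :: "'m \<Rightarrow> 'h \<Rightarrow> complex"
  shows "(\<Sum>m\<in>M. (\<Sum>h\<in>H. u m h * X h) * (\<Sum>h\<in>H. u m h * Y h)) =
    (\<Sum>h\<in>H. \<Sum>h'\<in>H. (\<Sum>m\<in>M. u m h * u m h') * (X h * Y h'))"
proof -
  have "(\<Sum>m\<in>M. (\<Sum>h\<in>H. u m h * X h) * (\<Sum>h\<in>H. u m h * Y h)) =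
      (\<Sum>m\<in>M. \<Sum>h\<in>H. \<Sum>h'\<in>H. (u m h * u m h') * (X h * Y h'))"
    unfolding sum_product by (simp add: mult_ac)
  also have "\<dots> = (\<Sum>h\<in>H. \<Sum>h'\<in>H. \<Sum>m\<in>M. (u m h * u m h') * (X h * Y h'))"
    by (rule sum_swap3[symmetric])
  finally show ?thesis by (simp only: sum_distrib_right)
qed

lemma tensor_power_append:
  assumes "length i1 = k" "length a1 = k"
  shows "tensor_power M (k + k') (i1 @ i2) (a1 @ a2) = tensor_power M k i1 a1 * tensor_power M k' i2 a2"
proof -
  have "tensor_power M (k + k') (i1 @ i2) (a1 @ a2) =
      (\<Prod>n<k. M ((i1 @ i2) ! n) ((a1 @ a2) ! n)) * (\<Prod>n<k'. M ((i1 @ i2) ! (k + n)) ((a1 @ a2) ! (k + n)))"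
    unfolding tensor_power_def by (induction k') (simp_all add: mult.assoc)
  then show ?thesis using assms by (simp add: tensor_power_def nth_append)
qed

lemma word_idx_append:
  assumes "i \<in> word_idx N (v @ v')"
  obtains a b where "i = a @ b" "a \<in> word_idx N v" "b \<in> word_idx N v'"
proof
  show "i = take (length v) i @ drop (length v) i" by simp
  show "take (length v) i \<in> word_idx N v" "drop (length v) i \<in> word_idx N v'"
    using assms by (auto simp: word_idx_def nth_append split: if_splits)
      (metis add_diff_cancel_left' nat_add_left_cancel_less not_add_less1)
qed

section \<open>Projections of words and the morphism spaces they cut out\<close>

lemma pi_word_idem:
  assumes N: "2 \<le> N"
  shows "lcomp N (pi_word N w) (pi_word N w) = pi_word N w"
proof (rule lfam_eqI[of "length w" "length w" "\<lambda>N. lcomp N (pi_word N w) (pi_word N w)"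
      "\<lambda>N. pi_word N w", OF _ lfam_pi_word N])
  show "lfam (parts (length w) (length w)) (\<lambda>N. lcomp N (pi_word N w) (pi_word N w))"
    by (rule lfam_lcomp[OF lfam_pi_word lfam_pi_word])
  fix N i j assume i: "i \<in> multi_idx N (length w)" and j: "j \<in> multi_idx N (length w)"
  have "T_map (lcomp N (pi_word N w) (pi_word N w)) j i =
      (\<Sum>h\<in>multi_idx N (length w). \<Prod>n<length w. pi_mat N (w ! n) (j ! n) (h ! n) * pi_mat N (w ! n) (h ! n) (i ! n))"
    unfolding T_map_lcomp[OF pi_word_lparts pi_word_lparts i j]
    by (intro sum.cong refl) (simp add: T_map_pi_word i j prod.distrib)
  also have "\<dots> = (\<Prod>n<length w. pi_mat N (w ! n) (j ! n) (i ! n))"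
    unfolding sum_multi_idx_prod[where f = "\<lambda>n h. pi_mat N (w ! n) (j ! n) h * pi_mat N (w ! n) h (i ! n)"]
    by (intro prod.cong refl) (simp add: pi_mat_mult multi_idx_nth[OF i] multi_idx_nth[OF j])
  finally show "T_map (lcomp N (pi_word N w) (pi_word N w)) j i = T_map (pi_word N w) j i"
    by (simp add: T_map_pi_word i j)
qed

lemma linv_pi_word:
  assumes N: "2 \<le> N"
  shows "linv (pi_word N w) = pi_word N w"
proof (rule lfam_eqI[of "length w" "length w" "\<lambda>N. linv (pi_word N w)" "\<lambda>N. pi_word N w", OF _ lfam_pi_word N])
  show "lfam (parts (length w) (length w)) (\<lambda>N. linv (pi_word N w))"
    by (rule lfam_linv[OF lfam_pi_word])
  fix N i j assume i: "i \<in> multi_idx N (length w)" and j: "j \<in> multi_idx N (length w)"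
  have "cnj (\<Prod>n<length w. pi_mat N (w ! n) (i ! n) (j ! n)) = (\<Prod>n<length w. pi_mat N (w ! n) (j ! n) (i ! n))"
    unfolding cnj_prod by (intro prod.cong refl) (simp add: cnj_pi_mat pi_mat_commute)
  then show "T_map (linv (pi_word N w)) j i = T_map (pi_word N w) j i"
    by (simp add: T_map_linv T_map_pi_word i j)
qed

lemma pi_word_append:
  assumes N: "2 \<le> N"
  shows "pi_word N (w @ w') = ltensor (pi_word N w) (pi_word N w')"
proof (rule lfam_eqI[of "length w + length w'" "length w + length w'" "\<lambda>N. pi_word N (w @ w')"
      "\<lambda>N. ltensor (pi_word N w) (pi_word N w')", OF _ _ N])
  show "lfam (parts (length w + length w') (length w + length w')) (\<lambda>N. pi_word N (w @ w'))"
    using lfam_pi_word[of "w @ w'"] by simp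
  show "lfam (parts (length w + length w') (length w + length w')) (\<lambda>N. ltensor (pi_word N w) (pi_word N w'))"
    by (intro lfam_ltensor lfam_pi_word)
  fix N i j assume ij: "i \<in> multi_idx N (length w + length w')" "j \<in> multi_idx N (length w + length w')"
  then obtain i1 i2 j1 j2 where i: "i = i1 @ i2" "i1 \<in> multi_idx N (length w)" "i2 \<in> multi_idx N (length w')"
    and j: "j = j1 @ j2" "j1 \<in> multi_idx N (length w)" "j2 \<in> multi_idx N (length w')" using multi_idx_append by metis
  have len: "length i1 = length w" "length j1 = length w" using i j by (auto simp: multi_idx_def)
  have "(\<Prod>n<length w + m. pi_mat N ((w @ w') ! n) ((j1 @ j2) ! n) ((i1 @ i2) ! n)) =
      (\<Prod>n<length w. pi_mat N (w ! n) (j1 ! n) (i1 ! n)) * (\<Prod>n<m. pi_mat N (w' ! n) (j2 ! n) (i2 ! n))" for m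
    by (induction m) (auto simp: nth_append len mult.assoc)
  then show "T_map (pi_word N (w @ w')) j i = T_map (ltensor (pi_word N w) (pi_word N w')) j i"
    unfolding i(1) j(1) T_map_ltensor[OF pi_word_lparts len]
    using T_map_pi_word[of "i1 @ i2" N "w @ w'" "j1 @ j2"] ij i j by (simp add: T_map_pi_word)
qed

lemma lin_add_functional: "lin (\<lambda>p. \<phi> p + \<psi> p) f = lin \<phi> f + lin \<psi> f"
  by (simp add: lin_def algebra_simps sum.distrib)

lemma bilinear_ext_add_left: "bilinear_ext h (f + f') g = bilinear_ext h f g + bilinear_ext h f' g"
  and bilinear_ext_add_right: "bilinear_ext h g (f + f') = bilinear_ext h g f + bilinear_ext h g f'"
  and bilinear_ext_pscale_left: "bilinear_ext h (pscale c f) g = pscale c (bilinear_ext h f g)"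
  and bilinear_ext_pscale_right: "bilinear_ext h g (pscale c f) = pscale c (bilinear_ext h g f)"
  by (rule poly_mapping_eqI, simp only: lookup_eq_lin lin_bilinear_ext lin_add lin_add_functional lin_pscale lin_const_mult)+

lemma corner_add: "corner N w1 w2 (f + g) = corner N w1 w2 f + corner N w1 w2 g"
  and corner_pscale: "corner N w1 w2 (pscale c f) = pscale c (corner N w1 w2 f)"
  unfolding corner_def lcomp_def
  by (simp_all only: bilinear_ext_add_left bilinear_ext_add_right bilinear_ext_pscale_left bilinear_ext_pscale_right)

lemma dhom_lparts: "f \<in> dhom N w1 w2 \<Longrightarrow> f \<in> lparts (length w1) (length w2)"
  by (simp add: dhom_def)

lemma dhom_corner: "f \<in> dhom N w1 w2 \<Longrightarrow> corner N w1 w2 f = f"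
  by (simp add: dhom_def)

text \<open>By idempotence the compression condition splits into one condition on each side; these
  are easier to carry through composition, tensor product and involution.\<close>

lemma dhom_iff:
  assumes N: "2 \<le> N" and f: "f \<in> lparts (length w1) (length w2)"
  shows "f \<in> dhom N w1 w2 \<longleftrightarrow> lcomp N (pi_word N w2) f = f \<and> lcomp N f (pi_word N w1) = f"
proof
  note P = pi_word_lparts[of N]
  note fP = lcomp_lparts[OF f P, of N]
  assume "f \<in> dhom N w1 w2"
  then have eq: "f = lcomp N (pi_word N w2) (lcomp N f (pi_word N w1))" by (simp add: dhom_def corner_def)
  have 1: "lcomp N (pi_word N w2) f = f"
  proof -
    have "lcomp N (pi_word N w2) f =
        lcomp N (pi_word N w2) (lcomp N (pi_word N w2) (lcomp N f (pi_word N w1)))" using eq by simp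
    also have "\<dots> = f"
      unfolding lcomp_assoc[OF fP P P N] pi_word_idem[OF N] by (rule eq[symmetric])
    finally show ?thesis .
  qed
  have "lcomp N f (pi_word N w1) = lcomp N (lcomp N (pi_word N w2) (lcomp N f (pi_word N w1))) (pi_word N w1)"
    using eq by simp
  also have "\<dots> = lcomp N (pi_word N w2) (lcomp N f (lcomp N (pi_word N w1) (pi_word N w1)))"
    unfolding lcomp_assoc[OF P P f N] lcomp_assoc[OF P fP P N, symmetric] ..
  also have "\<dots> = f" unfolding pi_word_idem[OF N] by (rule eq[symmetric])
  finally show "lcomp N (pi_word N w2) f = f \<and> lcomp N f (pi_word N w1) = f" using 1 by simp
next
  assume "lcomp N (pi_word N w2) f = f \<and> lcomp N f (pi_word N w1) = f"
  then show "f \<in> dhom N w1 w2" using f by (simp add: dhom_def corner_def)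
qed

lemma corner_dhom:
  assumes N: "2 \<le> N" and f: "f \<in> lparts (length w1) (length w2)"
  shows "corner N w1 w2 f \<in> dhom N w1 w2"
proof -
  note P = pi_word_lparts[of N]
  note fP = lcomp_lparts[OF f P, of N]
  have "lcomp N (pi_word N w2) (corner N w1 w2 f) = corner N w1 w2 f"
    unfolding corner_def lcomp_assoc[OF fP P P N] pi_word_idem[OF N] ..
  moreover have "lcomp N (corner N w1 w2 f) (pi_word N w1) = corner N w1 w2 f"
    unfolding corner_def lcomp_assoc[OF P fP P N, symmetric] lcomp_assoc[OF P P f N, symmetric]
      pi_word_idem[OF N] ..
  ultimately show ?thesis using dhom_iff[OF N corner_lparts[OF f]] by simp
qed

lemma pi_word_dhom: "2 \<le> N \<Longrightarrow> pi_word N w \<in> dhom N w w"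
  by (simp add: dhom_iff pi_word_lparts pi_word_idem)

lemma lcomp_dhom:
  assumes N: "2 \<le> N" and p: "p \<in> dhom N w1 w2" and q: "q \<in> dhom N w2 w3"
  shows "lcomp N q p \<in> dhom N w1 w3"
proof -
  note p' = dhom_lparts[OF p] and q' = dhom_lparts[OF q]
  show ?thesis
    unfolding dhom_iff[OF N lcomp_lparts[OF q' p']] lcomp_assoc[OF p' q' pi_word_lparts N]
      lcomp_assoc[OF pi_word_lparts p' q' N, symmetric]
    using p q by (simp add: dhom_iff[OF N p'] dhom_iff[OF N q'])
qed

lemma ltensor_dhom:
  assumes N: "2 \<le> N" and p: "p \<in> dhom N w1 w2" and q: "q \<in> dhom N w1' w2'"
  shows "ltensor p q \<in> dhom N (w1 @ w1') (w2 @ w2')"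
proof -
  note p' = dhom_lparts[OF p] and q' = dhom_lparts[OF q]
  have "ltensor p q \<in> lparts (length (w1 @ w1')) (length (w2 @ w2'))"
    using ltensor_lparts[OF p' q'] by simp
  then show ?thesis
    unfolding dhom_iff[OF N \<open>ltensor p q \<in> _\<close>] pi_word_append[OF N]
      ltensor_lcomp[OF p' pi_word_lparts q' pi_word_lparts N, symmetric]
      ltensor_lcomp[OF pi_word_lparts p' pi_word_lparts q' N, symmetric]
    using p q by (simp add: dhom_iff[OF N p'] dhom_iff[OF N q'])
qed

lemma linv_dhom:
  assumes N: "2 \<le> N" and p: "p \<in> dhom N w1 w2"
  shows "linv p \<in> dhom N w2 w1"
proof -
  note p' = dhom_lparts[OF p]
  have "linv (lcomp N (pi_word N w2) p) = lcomp N (linv p) (pi_word N w2)"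
    "linv (lcomp N p (pi_word N w1)) = lcomp N (pi_word N w1) (linv p)"
    unfolding linv_lcomp[OF p' pi_word_lparts N] linv_lcomp[OF pi_word_lparts p' N] linv_pi_word[OF N] by simp_all
  then show ?thesis
    using p unfolding dhom_iff[OF N linv_lparts[OF p']] dhom_iff[OF N p'] by simp
qed

lemma subspace_dhom: "plin.subspace (dhom N w1 w2)"
proof (rule plin.subspaceI)
  have "corner N w1 w2 0 = 0" using corner_pscale[of N w1 w2 0 0] by (simp only: plin.scale_zero_left)
  then show "0 \<in> dhom N w1 w2" by (simp add: dhom_def lparts_lspan)
qed (auto simp: dhom_def lparts_lspan corner_add corner_pscale intro: lspan_add lspan_pscale)

lemma U_map_dhom: "2 \<le> N \<Longrightarrow> f \<in> dhom N w1 w2 \<Longrightarrow> U_map N s f = U_corner N s w1 w2 f"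
  using U_map_corner[OF dhom_lparts, of f N w1 w2 N s] by (simp add: dhom_corner)

section \<open>Identities on colored words\<close>

lemma id_color_ltparts: "id_color a \<in> ltparts [a] [a]"
proof (cases a)
  case Ell
  have "tri_points [Ell] [Ell] = {}"
    by (auto simp: tri_points_def color_of_def points_def)
  then show ?thesis using id_part_parts by (simp add: Ell ltparts_lspan tparts_def id_part_def One_nat_def)
next
  case Tri
  have pts: "points 1 1 = {Inl 0, Inr 0}" by (auto simp: points_def)
  have p: "{{Inl 0}, {Inr 0}} \<in> parts 1 1"
    by (rule partsI) (auto simp: pts)
  have "tri_points [Tri] [Tri] \<subseteq> {Inl 0, Inr 0}" unfolding tri_points_def using pts by (auto simp: One_nat_def)
  then show ?thesis using p by (auto simp: Tri ltparts_lspan tparts_def One_nat_def)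
qed

lemma id_word_ltparts: "id_word v \<in> ltparts v v"
proof (induction v)
  case Nil
  have "{} \<in> tparts [] []" by (auto simp: tparts_def points_def tri_points_def intro!: partsI)
  then show ?case by (simp add: ltparts_lspan)
next
  case (Cons a v)
  then show ?case using ltensor_ltparts[OF id_color_ltparts Cons] by simp
qed

lemma word_idx_Cons:
  "i \<in> word_idx N (a # v) \<longleftrightarrow> (\<exists>x i'. i = x # i' \<and> x \<in> color_idx N a \<and> i' \<in> word_idx N v)"
  by (cases i) (auto simp: word_idx_def All_less_Suc2)

lemma T_map_id_word:
  "i \<in> word_idx N v \<Longrightarrow> j \<in> word_idx N v \<Longrightarrow> T_map (id_word v) j i = of_bool (i = j)"
proof (induction v arbitrary: i j)
  case Nil
  then show ?case by (simp add: word_idx_def delta_def)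
next
  case (Cons a v)
  obtain x i' where i: "i = x # i'" "x \<in> color_idx N a" "i' \<in> word_idx N v"
    using Cons.prems(1) unfolding word_idx_Cons by blast
  obtain y j' where j: "j = y # j'" "y \<in> color_idx N a" "j' \<in> word_idx N v"
    using Cons.prems(2) unfolding word_idx_Cons by blast
  have "id_color a \<in> lparts 1 1" using ltparts_lparts[OF id_color_ltparts[of a]] by (simp add: One_nat_def)
  then have "T_map (id_word (a # v)) ([y] @ j') ([x] @ i') = T_map (id_color a) [y] [x] * T_map (id_word v) j' i'"
    unfolding id_word.simps by (rule T_map_ltensor) auto
  moreover have "T_map (id_color a) [y] [x] = of_bool (x = y)"
    using i(2) j(2) by (cases a) (auto simp: delta_def color_idx_def)
  ultimately show ?case using Cons.IH[OF i(3) j(3)] by (simp add: i(1) j(1))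
qed

context
  fixes s :: real
  assumes s: "s = 1 \<or> s = - 1"
begin

text \<open>Transposed U times a coordinate projection times U is the projection of the letter, by
  \<open>U_mat_pi\<close> and the orthogonality of the columns. So a sum restricted to one color
  yields a projection instead of the identity.\<close>

lemma U_mat_gram:
  assumes N: "2 \<le> N" and c: "c < N" "c' < N"
  shows "(\<Sum>b<N. of_bool (b \<in> color_idx N (U_obj a)) * (U_mat N s b c * U_mat N s b c')) = pi_mat N a c c'"
proof -
  have "(\<Sum>b<N. of_bool (b \<in> color_idx N (U_obj a)) * (U_mat N s b c * U_mat N s b c')) =
      (\<Sum>b<N. \<Sum>d<N. U_mat N s b d * U_mat N s b c' * pi_mat N a d c)"
  proof (intro sum.cong refl)
    fix b assume "b \<in> {..<N}"
    then have "of_bool (b \<in> color_idx N (U_obj a)) * U_mat N s b c = (\<Sum>d<N. U_mat N s b d * pi_mat N a d c)"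
      using U_mat_pi[OF N s _ c(1), of b a] by simp
    then have "of_bool (b \<in> color_idx N (U_obj a)) * (U_mat N s b c * U_mat N s b c') =
        (\<Sum>d<N. U_mat N s b d * pi_mat N a d c) * U_mat N s b c'" by (simp only: mult.assoc[symmetric])
    then show "of_bool (b \<in> color_idx N (U_obj a)) * (U_mat N s b c * U_mat N s b c') =
        (\<Sum>d<N. U_mat N s b d * U_mat N s b c' * pi_mat N a d c)"
      unfolding sum_distrib_right by (simp only: mult_ac)
  qed
  also have "\<dots> = (\<Sum>d<N. of_bool (d = c') * pi_mat N a d c)"
  proof (subst sum.swap, intro sum.cong refl)
    fix d assume "d \<in> {..<N}"
    then show "(\<Sum>b<N. U_mat N s b d * U_mat N s b c' * pi_mat N a d c) = of_bool (d = c') * pi_mat N a d c"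
      unfolding sum_distrib_right[symmetric] using U_mat_columns[OF N s _ c(2), of d] by simp
  qed
  also have "\<dots> = pi_mat N a c' c" by (rule sum_kronecker) (use c in auto)
  finally show ?thesis by (simp add: pi_mat_commute)
qed

lemma word_gram:
  assumes N: "2 \<le> N" and h: "h \<in> multi_idx N (length w)" "h' \<in> multi_idx N (length w)"
  shows "(\<Sum>m\<in>word_idx N (map U_obj w). tensor_power (U_mat N s) (length w) m h * tensor_power (U_mat N s) (length w) m h') =
    T_map (pi_word N w) h h'"
proof -
  have "0 < N" using N by simp
  from sum_word_idx_prod[OF this, where v = "map U_obj w" and f = "\<lambda>n b. U_mat N s b (h ! n) * U_mat N s b (h' ! n)"]
  have "(\<Sum>m\<in>word_idx N (map U_obj w). tensor_power (U_mat N s) (length w) m h * tensor_power (U_mat N s) (length w) m h') =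
    (\<Prod>n<length w. \<Sum>b<N. of_bool (b \<in> color_idx N (map U_obj w ! n)) * (U_mat N s b (h ! n) * U_mat N s b (h' ! n)))"
    by (simp add: tensor_power_def prod.distrib)
  also have "\<dots> = (\<Prod>n<length w. pi_mat N (w ! n) (h ! n) (h' ! n))"
  proof (intro prod.cong refl)
    fix n assume "n \<in> {..<length w}"
    then have "map U_obj w ! n = U_obj (w ! n)" "h ! n < N" "h' ! n < N"
      using multi_idx_nth[OF h(1)] multi_idx_nth[OF h(2)] by auto
    then show "(\<Sum>b<N. of_bool (b \<in> color_idx N (map U_obj w ! n)) * (U_mat N s b (h ! n) * U_mat N s b (h' ! n))) =
        pi_mat N (w ! n) (h ! n) (h' ! n)" by (simp only: U_mat_gram[OF N])
  qed
  finally show ?thesis by (simp add: T_map_pi_word h)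
qed

text \<open>The inserted projection has its origin in the middle row: composing images sums over the
  indices of the word only, and \<open>word_gram\<close> turns this partial sum into the matrix of
  \<open>pi_word N w2\<close>. Morphisms between dotted words absorb it.\<close>

lemma U_corner_lcomp:
  assumes N: "2 \<le> N" and p: "p \<in> lparts (length w1) (length w2)" and q: "q \<in> lparts (length w2) (length w3)"
  shows "tcomp N (map U_obj w2) (U_corner N s w2 w3 q) (U_corner N s w1 w2 p) =
    U_corner N s w1 w3 (lcomp N q (lcomp N (pi_word N w2) p))"
proof (rule lfam_eqI_tri[of "map U_obj w1" "map U_obj w3"
      "\<lambda>N. tcomp N (map U_obj w2) (U_corner N s w2 w3 q) (U_corner N s w1 w2 p)"
      "\<lambda>N. U_corner N s w1 w3 (lcomp N q (lcomp N (pi_word N w2) p))", OF _ _ N])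
  show "lfam (tparts (map U_obj w1) (map U_obj w3))
      (\<lambda>N. tcomp N (map U_obj w2) (U_corner N s w2 w3 q) (U_corner N s w1 w2 p))"
    by (intro lfam_tcomp[OF lfam_U_corner[OF lfam_lparts[OF q]] lfam_U_corner[OF lfam_lparts[OF p]]])
  show "lfam (tparts (map U_obj w1) (map U_obj w3)) (\<lambda>N. U_corner N s w1 w3 (lcomp N q (lcomp N (pi_word N w2) p)))"
    by (intro lfam_U_corner lfam_lcomp[OF lfam_lparts[OF q] lfam_lcomp[OF lfam_pi_word lfam_lparts[OF p]]])
  fix N i j assume N: "(2::nat) \<le> N" and i: "i \<in> word_idx N (map U_obj w1)" and j: "j \<in> word_idx N (map U_obj w3)"
  let ?k = "length w1" and ?l = "length w2" and ?m = "length w3"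
  let ?U = "tensor_power (U_mat N s)" and ?I = "multi_idx N"
  have N0: "0 < N" using N by simp
  have rs: "lcomp N q (lcomp N (pi_word N w2) p) \<in> lparts ?k ?m"
    by (rule lcomp_lparts[OF q lcomp_lparts[OF pi_word_lparts p]])
  have "T_map (tcomp N (map U_obj w2) (U_corner N s w2 w3 q) (U_corner N s w1 w2 p)) j i =
     (\<Sum>m\<in>word_idx N (map U_obj w2). (\<Sum>h\<in>?I ?l. ?U ?l m h * (\<Sum>b\<in>?I ?m. ?U ?m j b * T_map q b h)) *
       (\<Sum>h\<in>?I ?l. ?U ?l m h * (\<Sum>a\<in>?I ?k. ?U ?k i a * T_map p h a)))"
  proof -
    have "T_map (U_corner N s w1 w2 p) m i = (\<Sum>h\<in>?I ?l. ?U ?l m h * (\<Sum>a\<in>?I ?k. ?U ?k i a * T_map p h a))"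
      if "m \<in> word_idx N (map U_obj w2)" for m
      unfolding T_map_U_corner[OF N s p i that] conj_T_def
      by (subst sum.swap) (simp add: sum_distrib_left mult_ac)
    moreover have "T_map (U_corner N s w2 w3 q) j m = (\<Sum>h\<in>?I ?l. ?U ?l m h * (\<Sum>b\<in>?I ?m. ?U ?m j b * T_map q b h))"
      if "m \<in> word_idx N (map U_obj w2)" for m
      unfolding T_map_U_corner[OF N s q that j] conj_T_def by (simp add: sum_distrib_left mult_ac)
    ultimately show ?thesis
      unfolding T_map_tcomp[OF U_corner_ltparts[OF q N] U_corner_ltparts[OF p N] N0 i j] by simp
  qed
  also have "\<dots> = (\<Sum>h\<in>?I ?l. \<Sum>h'\<in>?I ?l. (\<Sum>m\<in>word_idx N (map U_obj w2). ?U ?l m h * ?U ?l m h') *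
       ((\<Sum>b\<in>?I ?m. ?U ?m j b * T_map q b h) * (\<Sum>a\<in>?I ?k. ?U ?k i a * T_map p h' a)))"
    by (rule sum_gram)
  also have "\<dots> = (\<Sum>h\<in>?I ?l. \<Sum>h'\<in>?I ?l. T_map (pi_word N w2) h h' *
       ((\<Sum>b\<in>?I ?m. ?U ?m j b * T_map q b h) * (\<Sum>a\<in>?I ?k. ?U ?k i a * T_map p h' a)))"
    by (intro sum.cong refl) (simp only: word_gram[OF N])
  also have "\<dots> = (\<Sum>h\<in>?I ?l. \<Sum>h'\<in>?I ?l. \<Sum>b\<in>?I ?m. \<Sum>a\<in>?I ?k.
      ?U ?k i a * ?U ?m j b * (T_map q b h * (T_map (pi_word N w2) h h' * T_map p h' a)))"
    by (simp only: sum_product sum_distrib_left mult_ac)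
  also have "\<dots> = (\<Sum>b\<in>?I ?m. \<Sum>a\<in>?I ?k. \<Sum>h\<in>?I ?l. \<Sum>h'\<in>?I ?l.
      ?U ?k i a * ?U ?m j b * (T_map q b h * (T_map (pi_word N w2) h h' * T_map p h' a)))"
    by (rule sum_swap4)
  also have "\<dots> = (\<Sum>a\<in>?I ?k. \<Sum>b\<in>?I ?m. ?U ?k i a * ?U ?m j b * (\<Sum>h\<in>?I ?l. T_map q b h * (\<Sum>h'\<in>?I ?l. T_map (pi_word N w2) h h' * T_map p h' a)))"
    by (subst sum.swap) (simp only: sum_distrib_left)
  also have "\<dots> = (\<Sum>a\<in>?I ?k. \<Sum>b\<in>?I ?m. ?U ?k i a * ?U ?m j b * T_map (lcomp N q (lcomp N (pi_word N w2) p)) b a)"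
    by (intro sum.cong refl)
      (simp add: T_map_lcomp[OF q lcomp_lparts[OF pi_word_lparts p]] T_map_lcomp[OF pi_word_lparts p])
  also have "\<dots> = T_map (U_corner N s w1 w3 (lcomp N q (lcomp N (pi_word N w2) p))) j i"
    unfolding T_map_U_corner[OF N s rs i j] conj_T_def ..
  finally show "T_map (tcomp N (map U_obj w2) (U_corner N s w2 w3 q) (U_corner N s w1 w2 p)) j i =
      T_map (U_corner N s w1 w3 (lcomp N q (lcomp N (pi_word N w2) p))) j i" .
qed

lemma U_corner_ltensor:
  assumes N: "2 \<le> N" and p: "p \<in> lparts (length w1) (length w2)" and q: "q \<in> lparts (length w1') (length w2')"
  shows "ltensor (U_corner N s w1 w2 p) (U_corner N s w1' w2' q) = U_corner N s (w1 @ w1') (w2 @ w2') (ltensor p q)"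
proof (rule lfam_eqI_tri[of "map U_obj w1 @ map U_obj w1'" "map U_obj w2 @ map U_obj w2'"
      "\<lambda>N. ltensor (U_corner N s w1 w2 p) (U_corner N s w1' w2' q)"
      "\<lambda>N. U_corner N s (w1 @ w1') (w2 @ w2') (ltensor p q)", OF _ _ N])
  have pq: "ltensor p q \<in> lparts (length (w1 @ w1')) (length (w2 @ w2'))"
    using ltensor_lparts[OF p q] by simp
  show "lfam (tparts (map U_obj w1 @ map U_obj w1') (map U_obj w2 @ map U_obj w2'))
      (\<lambda>N. ltensor (U_corner N s w1 w2 p) (U_corner N s w1' w2' q))"
    by (intro lfam_ltensor_tri lfam_U_corner lfam_lparts p q)
  show "lfam (tparts (map U_obj w1 @ map U_obj w1') (map U_obj w2 @ map U_obj w2'))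
      (\<lambda>N. U_corner N s (w1 @ w1') (w2 @ w2') (ltensor p q))"
    using lfam_U_corner[OF lfam_lparts[OF pq], of s] by simp
  fix N i j assume N: "(2::nat) \<le> N" and ij: "i \<in> word_idx N (map U_obj w1 @ map U_obj w1')"
    "j \<in> word_idx N (map U_obj w2 @ map U_obj w2')"
  then obtain i1 i2 j1 j2 where i: "i = i1 @ i2" "i1 \<in> word_idx N (map U_obj w1)" "i2 \<in> word_idx N (map U_obj w1')"
    and j: "j = j1 @ j2" "j1 \<in> word_idx N (map U_obj w2)" "j2 \<in> word_idx N (map U_obj w2')"
    using word_idx_append by metis
  let ?k = "length w1" and ?l = "length w2" and ?k' = "length w1'" and ?l' = "length w2'"
  let ?U = "tensor_power (U_mat N s)" and ?I = "multi_idx N"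
  have len: "length i1 = ?k" "length j1 = ?l" using i j by (auto simp: word_idx_def)
  have "T_map (ltensor (U_corner N s w1 w2 p) (U_corner N s w1' w2' q)) j i =
      conj_T N s ?k ?l p j1 i1 * conj_T N s ?k' ?l' q j2 i2"
    using T_map_ltensor[OF ltparts_lparts[OF U_corner_ltparts[OF p N]], of i1 j1] len
    by (simp add: i(1) j(1) T_map_U_corner[OF N s p i(2) j(2)] T_map_U_corner[OF N s q i(3) j(3)])
  also have "\<dots> = (\<Sum>a\<in>?I ?k. \<Sum>a'\<in>?I ?k'. \<Sum>b\<in>?I ?l. \<Sum>b'\<in>?I ?l'.
      ?U (?k + ?k') (i1 @ i2) (a @ a') * ?U (?l + ?l') (j1 @ j2) (b @ b') * T_map (ltensor p q) (b @ b') (a @ a'))"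
    unfolding conj_T_def sum_product
  proof (intro sum.cong refl)
    fix a a' b b' assume "a \<in> ?I ?k" "b \<in> ?I ?l"
    then have "length a = ?k" "length b = ?l" by (auto simp: multi_idx_def)
    then show "?U ?k i1 a * ?U ?l j1 b * T_map p b a * (?U ?k' i2 a' * ?U ?l' j2 b' * T_map q b' a') =
        ?U (?k + ?k') (i1 @ i2) (a @ a') * ?U (?l + ?l') (j1 @ j2) (b @ b') * T_map (ltensor p q) (b @ b') (a @ a')"
      using len by (simp add: tensor_power_append T_map_ltensor[OF p])
  qed
  also have "\<dots> = conj_T N s (length (w1 @ w1')) (length (w2 @ w2')) (ltensor p q) j i"
    unfolding conj_T_def length_append sum_multi_idx_append i(1) j(1) ..
  also have "\<dots> = T_map (U_corner N s (w1 @ w1') (w2 @ w2') (ltensor p q)) j i"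
    by (rule T_map_U_corner[OF N s pq, symmetric]) (use ij in simp_all)
  finally show "T_map (ltensor (U_corner N s w1 w2 p) (U_corner N s w1' w2' q)) j i =
      T_map (U_corner N s (w1 @ w1') (w2 @ w2') (ltensor p q)) j i" .
qed

lemma U_corner_linv:
  assumes N: "2 \<le> N" and p: "p \<in> lparts (length w1) (length w2)"
  shows "linv (U_corner N s w1 w2 p) = U_corner N s w2 w1 (linv p)"
proof (rule lfam_eqI_tri[of "map U_obj w2" "map U_obj w1" "\<lambda>N. linv (U_corner N s w1 w2 p)"
      "\<lambda>N. U_corner N s w2 w1 (linv p)", OF _ _ N])
  show "lfam (tparts (map U_obj w2) (map U_obj w1)) (\<lambda>N. linv (U_corner N s w1 w2 p))"
    by (intro lfam_linv_tri lfam_U_corner lfam_lparts p)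
  show "lfam (tparts (map U_obj w2) (map U_obj w1)) (\<lambda>N. U_corner N s w2 w1 (linv p))"
    by (intro lfam_U_corner lfam_lparts linv_lparts p)
  fix N i j assume N: "(2::nat) \<le> N" and i: "i \<in> word_idx N (map U_obj w2)" and j: "j \<in> word_idx N (map U_obj w1)"
  have "cnj (tensor_power (U_mat N s) k a b) = tensor_power (U_mat N s) k a b" for k a b
    unfolding tensor_power_def cnj_prod cnj_U_mat[OF N s] ..
  then show "T_map (linv (U_corner N s w1 w2 p)) j i = T_map (U_corner N s w2 w1 (linv p)) j i"
    unfolding T_map_linv T_map_U_corner[OF N s p j i] T_map_U_corner[OF N s linv_lparts[OF p] i j] conj_T_def
    by (subst sum.swap) (simp add: T_map_linv mult_ac)
qed

text \<open>U conjugates the projection of the word to a coordinate projection, and the latter is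
  the identity on the indices of the word.\<close>

lemma U_corner_pi_word:
  assumes N: "2 \<le> N"
  shows "U_corner N s w w (pi_word N w) = id_word (map U_obj w)"
proof (rule lfam_eqI_tri[of "map U_obj w" "map U_obj w" "\<lambda>N. U_corner N s w w (pi_word N w)"
      "\<lambda>N. id_word (map U_obj w)", OF _ _ N])
  show "lfam (tparts (map U_obj w) (map U_obj w)) (\<lambda>N. U_corner N s w w (pi_word N w))"
    by (intro lfam_U_corner lfam_pi_word)
  show "lfam (tparts (map U_obj w) (map U_obj w)) (\<lambda>N. id_word (map U_obj w))"
    using lfam_const id_word_ltparts by (simp add: ltparts_lspan)
  fix N i j assume N: "(2::nat) \<le> N" and i: "i \<in> word_idx N (map U_obj w)" and j: "j \<in> word_idx N (map U_obj w)"
  have ij: "i \<in> multi_idx N (length w)" "j \<in> multi_idx N (length w)"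
    using i j word_idx_subset[of N "map U_obj w"] N by auto
  have "conj_T N s (length w) (length w) (pi_word N w) j i =
      (\<Sum>a\<in>multi_idx N (length w). \<Sum>b\<in>multi_idx N (length w). \<Prod>n<length w.
        U_mat N s (i ! n) (a ! n) * (U_mat N s (j ! n) (b ! n) * pi_mat N (w ! n) (b ! n) (a ! n)))"
    unfolding conj_T_def by (intro sum.cong refl) (simp add: T_map_pi_word tensor_power_def prod.distrib)
  also have "\<dots> = (\<Sum>a\<in>multi_idx N (length w). \<Prod>n<length w. \<Sum>b<N.
        U_mat N s (i ! n) (a ! n) * (U_mat N s (j ! n) b * pi_mat N (w ! n) b (a ! n)))"
    by (intro sum.cong refl sum_multi_idx_prod)
  also have "\<dots> = (\<Prod>n<length w. \<Sum>a<N. \<Sum>b<N.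
        U_mat N s (i ! n) a * (U_mat N s (j ! n) b * pi_mat N (w ! n) b a))"
    by (rule sum_multi_idx_prod)
  also have "\<dots> = (\<Prod>n<length w. of_bool (i ! n = j ! n))"
  proof (intro prod.cong refl)
    fix n assume n: "n \<in> {..<length w}"
    have jn: "j ! n \<in> color_idx N (U_obj (w ! n))" using word_idx_nth[OF j, of n] n by simp
    have ijn: "i ! n < N" "j ! n < N" using multi_idx_nth[OF ij(1)] multi_idx_nth[OF ij(2)] n by auto
    show "(\<Sum>a<N. \<Sum>b<N. U_mat N s (i ! n) a * (U_mat N s (j ! n) b * pi_mat N (w ! n) b a)) = of_bool (i ! n = j ! n)"
      unfolding sum_distrib_left[symmetric] using jn ijn U_mat_rows[OF N s ijn]
      by (simp add: U_mat_pi[OF N s])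
  qed
  also have "\<dots> = of_bool (i = j)" by (rule prod_kronecker[OF ij])
  finally show "T_map (U_corner N s w w (pi_word N w)) j i = T_map (id_word (map U_obj w)) j i"
    using T_map_U_corner[OF N s pi_word_lparts i j] T_map_id_word[OF i j] by simp
qed

lemma U_map_functor:
  assumes N: "2 \<le> N"
  shows "monoidal_unitary_functor N U_obj (U_map N s)"
  unfolding monoidal_unitary_functor_def
proof (intro conjI allI ballI)
  show "U_map N s f \<in> ltparts (map U_obj w1) (map U_obj w2)" if "f \<in> dhom N w1 w2" for f w1 w2
    using U_corner_ltparts[OF dhom_lparts[OF that] N] U_map_dhom[OF N that] by simp
  show "U_map N s (pi_word N w) = id_word (map U_obj w)" for w
    using U_map_dhom[OF N pi_word_dhom[OF N]] U_corner_pi_word[OF N] by simp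
  show "ltensor (U_map N s p) (U_map N s q) = U_map N s (ltensor p q)"
    if "p \<in> dhom N w1 w2" "q \<in> dhom N w1' w2'" for p q w1 w2 w1' w2'
    using U_corner_ltensor[OF N dhom_lparts[OF that(1)] dhom_lparts[OF that(2)]]
    by (simp add: U_map_dhom[OF N that(1)] U_map_dhom[OF N that(2)] U_map_dhom[OF N ltensor_dhom[OF N that]])
  show "tcomp N (map U_obj w2) (U_map N s q) (U_map N s p) = U_map N s (lcomp N q p)"
    if p: "p \<in> dhom N w1 w2" and q: "q \<in> dhom N w2 w3" for p q w1 w2 w3
  proof -
    have "lcomp N (pi_word N w2) p = p" using p dhom_iff[OF N dhom_lparts[OF p]] by simp
    then show ?thesis
      using U_corner_lcomp[OF N dhom_lparts[OF p] dhom_lparts[OF q]]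
      by (simp add: U_map_dhom[OF N p] U_map_dhom[OF N q] U_map_dhom[OF N lcomp_dhom[OF N p q]])
  qed
  show "linv (U_map N s p) = U_map N s (linv p)" if p: "p \<in> dhom N w1 w2" for p w1 w2
    using U_corner_linv[OF N dhom_lparts[OF p]] by (simp add: U_map_dhom[OF N p] U_map_dhom[OF N linv_dhom[OF N p]])
qed

lemma tT_map_U_corner:
  assumes N: "2 \<le> N" and f: "f \<in> lparts (length w1) (length w2)"
  shows "tT_map N (map U_obj w1) (map U_obj w2) (U_corner N s w1 w2 f) j i =
    of_bool (i \<in> word_idx N (map U_obj w1)) * (of_bool (j \<in> word_idx N (map U_obj w2)) *
      conj_T N s (length w1) (length w2) f j i)"
  by (auto simp: tT_map_T_map[OF U_corner_ltparts[OF f N]] T_map_U_corner[OF N s f])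

text \<open>Each index tuple belongs to exactly one word: \<open>Down\<close> at the positions with
  index N - 1 and \<open>Dot\<close> elsewhere.\<close>

lemma sum_words_idx:
  assumes N: "2 \<le> N" and i: "i \<in> multi_idx N k"
  shows "(\<Sum>w\<in>{w. length w = k}. of_bool (i \<in> word_idx N (map U_obj w)) :: complex) = 1"
proof -
  have "(\<Sum>w\<in>{w. length w = k}. of_bool (i \<in> word_idx N (map U_obj w)) :: complex) =
      (\<Sum>w\<in>{w. length w = k}. \<Prod>n<k. of_bool (i ! n \<in> color_idx N (U_obj (w ! n))))"
    by (intro sum.cong refl) (use i in \<open>auto simp: prod_of_bool word_idx_def multi_idx_def\<close>)
  also have "\<dots> = (\<Prod>n<k. of_bool (i ! n \<in> color_idx N Ell) + of_bool (i ! n \<in> color_idx N Tri))"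
    by (subst sum_words_prod[where F = "\<lambda>n a. of_bool (i ! n \<in> color_idx N (U_obj a))"]) simp
  also have "\<dots> = 1"
  proof (rule prod.neutral, rule ballI)
    fix n assume "n \<in> {..<k}"
    then have "i ! n < N" using multi_idx_nth[OF i] by simp
    then show "of_bool (i ! n \<in> color_idx N Ell) + of_bool (i ! n \<in> color_idx N Tri) = (1 :: complex)"
      by (auto simp: color_idx_def)
  qed
  finally show ?thesis .
qed

text \<open>The components all give entries of one and the same matrix, cut down to the index ranges
  of pairs of words. These ranges are disjoint and cover everything.\<close>

lemma T_U_map_conj_T:
  assumes N: "2 \<le> N" and f: "f \<in> lparts k l" and i: "i \<in> multi_idx N k" and j: "j \<in> multi_idx N l"
  shows "T_U_map N s k l f j i = conj_T N s k l f j i"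
proof -
  have "T_U_map N s k l f j i = (\<Sum>w1\<in>{w. length w = k}. \<Sum>w2\<in>{w. length w = l}.
     of_bool (i \<in> word_idx N (map U_obj w1)) * (of_bool (j \<in> word_idx N (map U_obj w2)) * conj_T N s k l f j i))"
    unfolding T_U_map_def
  proof (intro sum.cong refl)
    fix w1 w2 :: "letter list" assume "w1 \<in> {w. length w = k}" "w2 \<in> {w. length w = l}"
    then have w: "length w1 = k" "length w2 = l" by auto
    then have f': "f \<in> lparts (length w1) (length w2)" using f by simp
    show "tT_map N (map U_obj w1) (map U_obj w2) (U_map N s (corner N w1 w2 f)) j i =
      of_bool (i \<in> word_idx N (map U_obj w1)) * (of_bool (j \<in> word_idx N (map U_obj w2)) * conj_T N s k l f j i)"
      unfolding U_map_corner[OF f' N] tT_map_U_corner[OF N f'] w ..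
  qed
  also have "\<dots> = conj_T N s k l f j i"
    unfolding sum_distrib_left[symmetric] sum_distrib_right[symmetric] sum_words_idx[OF N i] sum_words_idx[OF N j]
    by simp
  finally show ?thesis .
qed

lemma conj_T_mat_prod:
  assumes N: "2 \<le> N"
  shows "mat_prod (multi_idx N l) (tensor_power (U_mat N s) l)
    (mat_prod (multi_idx N k) (T_map f) (tensor_power (adjoint_mat (U_mat N s)) k)) j i = conj_T N s k l f j i"
proof -
  have "tensor_power (adjoint_mat (U_mat N s)) k a i = tensor_power (U_mat N s) k i a" for a
    unfolding tensor_power_def adjoint_U_mat[OF N s] ..
  then show ?thesis
    unfolding mat_prod_def conj_T_def by (subst sum.swap) (simp add: sum_distrib_left mult_ac)
qed

end

section \<open>Images of linear categories\<close>

lemma sum_multi_idx_1: "(\<Sum>h\<in>multi_idx N 1. f h) = (\<Sum>x<N. f [x])"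
  by (rule sum.reindex_bij_witness[where i = "\<lambda>x. [x]" and j = hd])
    (auto simp: multi_idx_def One_nat_def length_Suc_conv)

lemma sum_multi_idx_2: "(\<Sum>h\<in>multi_idx N 2. f h) = (\<Sum>x<N. \<Sum>y<N. f [x, y])"
  using sum_multi_idx_append[of f N 1 1] unfolding sum_multi_idx_1 by simp

lemma T_map_pair_part: "T_map (basis_elt pair_part) [x, y] [] = of_bool (x = y)"
  by (auto simp: delta_def pair_part_def One_nat_def)

lemma T_map_id_part: "T_map (basis_elt id_part) [x] [y] = of_bool (x = y)"
  by (auto simp: delta_def id_part_def)

lemma T_map_lsigma: "T_map lsigma j i = 1"
  by (auto simp: delta_def lsigma_def singleton_part_def)

lemma multi_idx_1: "i \<in> multi_idx N 1 \<Longrightarrow> \<exists>x<N. i = [x]"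
  by (auto simp: multi_idx_def One_nat_def length_Suc_conv)

text \<open>Bending one of the two lower singletons upwards with a pair turns \<sigma> \<otimes>
  \<sigma> into \<sigma> \<sigma>*, from which the projections are built.\<close>

lemma sigma_rotation:
  assumes N: "2 \<le> N"
  shows "lcomp N (ltensor (basis_elt id_part) (linv (basis_elt pair_part)))
      (ltensor (ltensor lsigma lsigma) (basis_elt id_part)) = lcomp N lsigma (linv lsigma)"
proof (rule lfam_eqI[of 1 1 "\<lambda>N. lcomp N (ltensor (basis_elt id_part) (linv (basis_elt pair_part)))
      (ltensor (ltensor lsigma lsigma) (basis_elt id_part))" "\<lambda>N. lcomp N lsigma (linv lsigma)", OF _ _ N])
  let ?B = "ltensor (basis_elt id_part) (linv (basis_elt pair_part))"
  let ?A = "ltensor (ltensor lsigma lsigma) (basis_elt id_part)"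
  have id: "basis_elt id_part \<in> lparts 1 1" by (simp add: id_part_parts)
  have pair: "basis_elt pair_part \<in> lparts 0 2" by (simp add: pair_part_parts)
  have ss: "ltensor lsigma lsigma \<in> lparts 0 2" using ltensor_lparts[OF lsigma_lparts lsigma_lparts] by simp
  have A: "?A \<in> lparts 1 3" using ltensor_lparts[OF ss id] by simp
  have B: "?B \<in> lparts 3 1" using ltensor_lparts[OF id linv_lparts[OF pair]] by simp
  show "lfam (parts 1 1) (\<lambda>N. lcomp N ?B ?A)" by (rule lfam_lcomp[OF lfam_lparts[OF B] lfam_lparts[OF A]])
  show "lfam (parts 1 1) (\<lambda>N. lcomp N lsigma (linv lsigma))"
    by (rule lfam_lcomp[OF lfam_lparts[OF lsigma_lparts] lfam_lparts[OF linv_lparts[OF lsigma_lparts]]])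
  fix N i j assume i: "i \<in> multi_idx N 1" and j: "j \<in> multi_idx N 1"
  obtain i0 j0 where ij: "i = [i0]" "i0 < N" "j = [j0]" "j0 < N" using multi_idx_1[OF i] multi_idx_1[OF j] by blast
  have TA: "T_map ?A [x, y, z] [i0] = of_bool (z = i0)" for x y z
    using T_map_ltensor[OF ss, of "[]" "[x, y]" "basis_elt id_part" "[z]" "[i0]"]
      T_map_ltensor[OF lsigma_lparts, of "[]" "[x]" lsigma "[y]" "[]"]
    by (simp add: T_map_lsigma T_map_id_part del: T_map_basis_elt)
  have TB: "T_map ?B [j0] [x, y, z] = of_bool (j0 = x) * of_bool (y = z)" for x y z
    using T_map_ltensor[OF id, of "[x]" "[j0]" "linv (basis_elt pair_part)" "[]" "[y, z]"]
    by (simp add: T_map_linv T_map_id_part T_map_pair_part del: T_map_basis_elt)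
  have "T_map (lcomp N ?B ?A) j i = (\<Sum>h\<in>multi_idx N (1 + 2). T_map ?B j h * T_map ?A h i)"
    using T_map_lcomp[OF B A i j] by simp
  also have "\<dots> = (\<Sum>x<N. \<Sum>y<N. \<Sum>z<N. of_bool (j0 = x) * of_bool (y = z) * of_bool (z = i0))"
    unfolding sum_multi_idx_append sum_multi_idx_1 sum_multi_idx_2 ij by (simp only: append.simps TA TB)
  also have "\<dots> = (\<Sum>x<N. of_bool (j0 = x) * (\<Sum>y<N. \<Sum>z<N. of_bool (y = z) * of_bool (z = i0)))"
    by (simp only: sum_distrib_left mult.assoc)
  also have "\<dots> = (\<Sum>y<N. \<Sum>z<N. of_bool (y = z) * of_bool (z = i0))"
    by (rule sum_kronecker) (use ij in auto)
  also have "\<dots> = (\<Sum>y<N. of_bool (y = i0) * 1)"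
    by (intro sum.cong refl) (simp add: sum_kronecker)
  also have "\<dots> = 1" by (rule sum_kronecker) (use ij in auto)
  also have "1 = T_map (lcomp N lsigma (linv lsigma)) j i"
    unfolding T_map_lcomp[OF lsigma_lparts linv_lparts[OF lsigma_lparts] i j]
    by (simp add: T_map_linv T_map_lsigma)
  finally show "T_map (lcomp N ?B ?A) j i = T_map (lcomp N lsigma (linv lsigma)) j i" .
qed

text \<open>Supplies the empty partition, which is the projection of the empty word: the loop formed
  by a pair is N times it, and N is invertible.\<close>

lemma pair_loop:
  assumes N: "2 \<le> N"
  shows "lcomp N (linv (basis_elt pair_part)) (basis_elt pair_part) = pscale (of_nat N) (basis_elt {})"
proof (rule lfam_eqI[of 0 0 "\<lambda>N. lcomp N (linv (basis_elt pair_part)) (basis_elt pair_part)"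
      "\<lambda>N. pscale (of_nat N) (basis_elt {})", OF _ _ N])
  have pair: "basis_elt pair_part \<in> lparts 0 2" by (simp add: pair_part_parts)
  show "lfam (parts 0 0) (\<lambda>N. lcomp N (linv (basis_elt pair_part)) (basis_elt pair_part))"
    by (rule lfam_lcomp[OF lfam_lparts[OF linv_lparts[OF pair]] lfam_lparts[OF pair]])
  show "lfam (parts 0 0) (\<lambda>N. pscale (of_nat N) (basis_elt {}))"
    using pi_word_lparts[of _ "[]"] by (intro lfam_pscale ratfam_of_nat lfam_lparts) simp
  fix N i j assume ij: "i \<in> multi_idx N 0" "j \<in> multi_idx N 0"
  have "T_map (lcomp N (linv (basis_elt pair_part)) (basis_elt pair_part)) j i = (\<Sum>x<N. \<Sum>y<N. of_bool (x = y) * of_bool (x = y))"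
    unfolding T_map_lcomp[OF linv_lparts[OF pair] pair ij] sum_multi_idx_2 using ij
    by (simp add: T_map_linv T_map_pair_part del: T_map_basis_elt)
  also have "\<dots> = (\<Sum>x<N. of_bool (x = x))" by (intro sum.cong refl sum_kronecker) auto
  finally show "T_map (lcomp N (linv (basis_elt pair_part)) (basis_elt pair_part)) j i =
      T_map (pscale (of_nat N) (basis_elt {})) j i"
    by (simp add: T_map_lin lin_pscale delta_def)
qed

text \<open>This is where \<sigma> \<otimes> \<sigma> enters: with it the category contains the
  projections of all words and is therefore closed under passing to components.\<close>

lemma linear_category_corner:
  assumes N: "2 \<le> N" and K: "linear_category N K" and sigma: "ltensor lsigma lsigma \<in> K 0 2"
    and f: "f \<in> K (length w1) (length w2)"
  shows "corner N w1 w2 f \<in> K (length w1) (length w2)" "pi_word N w1 \<in> K (length w1) (length w1)"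
proof -
  have sub: "plin.subspace (K k l)" for k l using K by (simp add: linear_category_def)
  have tensor: "ltensor f g \<in> K (k + k') (l + l')" if "f \<in> K k l" "g \<in> K k' l'" for f g k l k' l'
    using K that unfolding linear_category_def by blast
  have comp: "lcomp N g f \<in> K k m" if "f \<in> K k l" "g \<in> K l m" for f g k l m
    using K that unfolding linear_category_def by blast
  have inv: "linv f \<in> K l k" if "f \<in> K k l" for f k l
    using K that unfolding linear_category_def by blast
  have id: "basis_elt id_part \<in> K 1 1" and pair: "basis_elt pair_part \<in> K 0 2"
    using K unfolding linear_category_def by blast+
  have "ltensor (ltensor lsigma lsigma) (basis_elt id_part) \<in> K 1 3" using tensor[OF sigma id] by simp
  moreover have "ltensor (basis_elt id_part) (linv (basis_elt pair_part)) \<in> K 3 1"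
    using tensor[OF id inv[OF pair]] by simp
  ultimately have ss: "lcomp N lsigma (linv lsigma) \<in> K 1 1"
    using comp sigma_rotation[OF N] by metis
  have letter: "pi_letter N a \<in> K 1 1" for a
    using id ss by (cases a) (auto intro: plin.subspace_scale[OF sub] plin.subspace_diff[OF sub])
  have empty: "basis_elt {} \<in> K 0 0"
  proof -
    have "pscale (of_nat N) (basis_elt {}) \<in> K 0 0" using comp[OF pair inv[OF pair]] pair_loop[OF N] by simp
    then have "pscale (1 / of_nat N) (pscale (of_nat N) (basis_elt {})) \<in> K 0 0"
      by (rule plin.subspace_scale[OF sub])
    then show ?thesis using N by (simp add: plin.scale_scale)
  qed
  have word: "pi_word N w \<in> K (length w) (length w)" for w
  proof (induction w)
    case (Cons a w)
    then show ?case using tensor[OF letter Cons] by (simp add: One_nat_def)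
  qed (simp add: empty)
  show "corner N w1 w2 f \<in> K (length w1) (length w2)"
    unfolding corner_def by (rule comp[OF comp[OF word f] word])
  show "pi_word N w1 \<in> K (length w1) (length w1)" by (rule word)
qed

lemma color_word: "\<exists>w. v = map U_obj w"
proof -
  have "\<exists>a. U_obj a = c" for c by (metis U_obj.simps color.exhaust)
  then obtain g where g: "U_obj (g c) = c" for c by metis
  then have "v = map U_obj (map g v)" by (simp add: comp_def)
  then show ?thesis ..
qed

lemma inj_map_U_obj: "map U_obj w = map U_obj w' \<longleftrightarrow> w = w'"
proof -
  have "inj U_obj" by (rule injI) (metis U_obj.simps color.distinct(1) letter.exhaust)
  then show ?thesis by (simp add: inj_map_eq_map)
qed

text \<open>Colored words determine the dotted words they come from, so the existential over words
  in the definition disappears.\<close>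

lemma U_cat_eq: "U_cat N s K (map U_obj w1) (map U_obj w2) = U_map N s ` (K (length w1) (length w2) \<inter> dhom N w1 w2)"
  unfolding U_cat_def inj_map_U_obj by blast

context
  fixes s :: real
  assumes s: "s = 1 \<or> s = - 1"
begin

text \<open>The entries are inner products of two rows of U, so orthonormality gives back a pair:
  the pair vector is fixed by U \<otimes> U. In color \<open>Tri\<close> the only index is N - 1 at
  both points, and the two extra singletons describe the resulting entry 1.\<close>

lemma U_corner_pair:
  assumes N: "2 \<le> N"
  shows "U_corner N s [] [Dot, Dot] (basis_elt pair_part) = basis_elt {{Inr 0, Inr 1}}"
    "U_corner N s [] [Down, Down] (basis_elt pair_part) = basis_elt {{Inr 0}, {Inr 1}}"
proof -
  have pair: "basis_elt pair_part \<in> lparts (length ([] :: letter list)) (length [a, b])" for a b :: letter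
    using pair_part_parts by (simp add: numeral_2_eq_2)
  have pts: "points 0 2 = {Inr 0, Inr 1}" by (auto simp: points_def less_2_cases_iff)
  have E: "{{Inr 0, Inr 1}} \<in> tparts [] [Ell, Ell]"
  proof -
    have "tri_points [] [Ell, Ell] = {}"
      by (auto simp: tri_points_def points_def color_of_def less_Suc_eq)
    then show ?thesis using pair_part_parts by (simp add: tparts_def pair_part_def numeral_2_eq_2)
  qed
  have T: "{{Inr 0}, {Inr 1}} \<in> tparts [] [Tri, Tri]"
  proof -
    have "{{Inr 0}, {Inr 1}} \<in> parts 0 2" by (rule partsI) (auto simp: pts)
    moreover have "tri_points [] [Tri, Tri] \<subseteq> {Inr 0, Inr 1}"
      unfolding tri_points_def using pts by (auto simp: numeral_2_eq_2)
    ultimately show ?thesis by (auto simp: tparts_def numeral_2_eq_2)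
  qed
  have key: "T_map (U_corner N s [] [a, b] (basis_elt pair_part)) [j0, j1] [] = of_bool (j0 = j1)"
    if N: "2 \<le> N" and j: "j0 \<in> color_idx N (U_obj a)" "j1 \<in> color_idx N (U_obj b)" for N j0 j1 a b
  proof -
    have i: "[] \<in> word_idx N (map U_obj [])" by (simp add: word_idx_def)
    have jj: "[j0, j1] \<in> word_idx N (map U_obj [a, b])" using j by (auto simp: word_idx_def less_Suc_eq)
    have jN: "j0 < N" "j1 < N" using j N by (auto simp: color_idx_def split: color.splits)
    have "T_map (U_corner N s [] [a, b] (basis_elt pair_part)) [j0, j1] [] = conj_T N s 0 2 (basis_elt pair_part) [j0, j1] []"
      using T_map_U_corner[OF N s pair i jj] by (simp add: numeral_2_eq_2)
    also have "\<dots> = (\<Sum>x<N. \<Sum>y<N. of_bool (x = y) * (U_mat N s j0 x * U_mat N s j1 y))"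
      unfolding conj_T_def sum_multi_idx_2
      by (simp add: tensor_power_def numeral_2_eq_2 T_map_pair_part mult_ac del: T_map_basis_elt)
    also have "\<dots> = (\<Sum>x<N. U_mat N s j0 x * U_mat N s j1 x)"
      by (intro sum.cong refl sum_kronecker) auto
    finally show ?thesis using U_mat_rows[OF N s jN] by simp
  qed
  have J: "\<exists>j0 j1. j = [j0, j1] \<and> j0 \<in> color_idx N c \<and> j1 \<in> color_idx N d" if "j \<in> word_idx N [c, d]" for N j c d
    using that unfolding word_idx_Cons by (auto simp: word_idx_def)
  have I: "i = []" if "i \<in> word_idx N []" for N i using that by (simp add: word_idx_def)
  show "U_corner N s [] [Dot, Dot] (basis_elt pair_part) = basis_elt {{Inr 0, Inr 1}}"
  proof (rule lfam_eqI_tri[of "[]" "[Ell, Ell]" "\<lambda>N. U_corner N s [] [Dot, Dot] (basis_elt pair_part)"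
        "\<lambda>N. basis_elt {{Inr 0, Inr 1}}", OF _ _ N])
    show "lfam (tparts [] [Ell, Ell]) (\<lambda>N. U_corner N s [] [Dot, Dot] (basis_elt pair_part))"
      using lfam_U_corner[OF lfam_lparts[OF pair[of Dot Dot]], of s] by simp
    show "lfam (tparts [] [Ell, Ell]) (\<lambda>N. basis_elt {{Inr 0, Inr 1}})" by (rule lfam_const) (simp add: E)
    fix N i j assume N: "(2::nat) \<le> N" and i: "i \<in> word_idx N []" and "j \<in> word_idx N [Ell, Ell]"
    then obtain j0 j1 where j: "j = [j0, j1]" "j0 \<in> color_idx N Ell" "j1 \<in> color_idx N Ell" using J by metis
    show "T_map (U_corner N s [] [Dot, Dot] (basis_elt pair_part)) j i = T_map (basis_elt {{Inr 0, Inr 1}}) j i"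
      using key[OF N, of j0 Dot j1 Dot] j I[OF i] T_map_pair_part[of j0 j1] by (simp add: pair_part_def)
  qed
  show "U_corner N s [] [Down, Down] (basis_elt pair_part) = basis_elt {{Inr 0}, {Inr 1}}"
  proof (rule lfam_eqI_tri[of "[]" "[Tri, Tri]" "\<lambda>N. U_corner N s [] [Down, Down] (basis_elt pair_part)"
        "\<lambda>N. basis_elt {{Inr 0}, {Inr 1}}", OF _ _ N])
    show "lfam (tparts [] [Tri, Tri]) (\<lambda>N. U_corner N s [] [Down, Down] (basis_elt pair_part))"
      using lfam_U_corner[OF lfam_lparts[OF pair[of Down Down]], of s] by simp
    show "lfam (tparts [] [Tri, Tri]) (\<lambda>N. basis_elt {{Inr 0}, {Inr 1}})" by (rule lfam_const) (simp add: T)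
    fix N i j assume N: "(2::nat) \<le> N" and i: "i \<in> word_idx N []" and "j \<in> word_idx N [Tri, Tri]"
    then obtain j0 j1 where j: "j = [j0, j1]" "j0 \<in> color_idx N Tri" "j1 \<in> color_idx N Tri" using J by metis
    show "T_map (U_corner N s [] [Down, Down] (basis_elt pair_part)) j i = T_map (basis_elt {{Inr 0}, {Inr 1}}) j i"
      using key[OF N, of j0 Down j1 Down] j I[OF i] by (simp add: color_idx_def delta_def)
  qed
qed

lemma U_cat_tri_linear_category:
  assumes N: "2 \<le> N" and K: "linear_category N K" and sigma: "ltensor lsigma lsigma \<in> K 0 2"
  shows "tri_linear_category N (U_cat N s K)"
proof -
  note F = U_map_functor[OF s N, unfolded monoidal_unitary_functor_def]
  have sub: "plin.subspace (K k l)" for k l using K by (simp add: linear_category_def)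
  have tensor: "ltensor f g \<in> K (k + k') (l + l')" if "f \<in> K k l" "g \<in> K k' l'" for f g k l k' l'
    using K that unfolding linear_category_def by blast
  have comp: "lcomp N g f \<in> K k m" if "f \<in> K k l" "g \<in> K l m" for f g k l m
    using K that unfolding linear_category_def by blast
  have inv: "linv f \<in> K l k" if "f \<in> K k l" for f k l
    using K that unfolding linear_category_def by blast
  have id: "basis_elt id_part \<in> K 1 1" and pair: "basis_elt pair_part \<in> K 0 2"
    using K unfolding linear_category_def by blast+
  have sp: "U_cat N s K v1 v2 \<subseteq> ltparts v1 v2 \<and> plin.subspace (U_cat N s K v1 v2)" for v1 v2
  proof -
    obtain w1 w2 where v: "v1 = map U_obj w1" "v2 = map U_obj w2" using color_word by metis
    have 1: "U_cat N s K v1 v2 \<subseteq> ltparts v1 v2" unfolding v U_cat_eq using F by blast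
    have S: "plin.subspace (K (length w1) (length w2) \<inter> dhom N w1 w2)" (is "plin.subspace ?S")
      by (rule plin.subspace_inter[OF sub subspace_dhom])
    have "plin.subspace (U_map N s ` ?S)"
    proof (rule plin.subspaceI)
      show "0 \<in> U_map N s ` ?S" by (rule image_eqI[of _ _ 0]) (use plin.subspace_0[OF S] U_map_zero[OF N] in simp_all)
      show "x + y \<in> U_map N s ` ?S" if xy: "x \<in> U_map N s ` ?S" "y \<in> U_map N s ` ?S" for x y
      proof -
        obtain f g where "f \<in> ?S" "x = U_map N s f" "g \<in> ?S" "y = U_map N s g" using xy by blast
        then show ?thesis
          by (intro image_eqI[of _ _ "f + g"] plin.subspace_add[OF S]) (simp_all only: U_map_add[OF N])
      qed
      show "pscale c x \<in> U_map N s ` ?S" if x: "x \<in> U_map N s ` ?S" for c x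
      proof -
        obtain f where "f \<in> ?S" "x = U_map N s f" using x by blast
        then show ?thesis
          by (intro image_eqI[of _ _ "pscale c f"] plin.subspace_scale[OF S]) (simp_all only: U_map_pscale[OF N])
      qed
    qed
    then have "plin.subspace (U_cat N s K v1 v2)" unfolding v U_cat_eq .
    then show ?thesis using 1 by blast
  qed
  have mult: "ltensor f g \<in> U_cat N s K (v1 @ v1') (v2 @ v2')"
    if f: "f \<in> U_cat N s K v1 v2" and g: "g \<in> U_cat N s K v1' v2'" for f g v1 v2 v1' v2'
  proof -
    obtain w1 w2 w1' w2' where v: "v1 = map U_obj w1" "v2 = map U_obj w2" "v1' = map U_obj w1'" "v2' = map U_obj w2'"
      using color_word by metis
    obtain p q where p: "p \<in> K (length w1) (length w2)" "p \<in> dhom N w1 w2" "f = U_map N s p"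
      and q: "q \<in> K (length w1') (length w2')" "q \<in> dhom N w1' w2'" "g = U_map N s q"
      using f g unfolding v U_cat_eq by blast
    have "ltensor f g = U_map N s (ltensor p q)" using F p q by blast
    moreover have "ltensor p q \<in> K (length (w1 @ w1')) (length (w2 @ w2')) \<inter> dhom N (w1 @ w1') (w2 @ w2')"
      using tensor[OF p(1) q(1)] ltensor_dhom[OF N p(2) q(2)] by simp
    ultimately show ?thesis unfolding v map_append[symmetric] U_cat_eq by blast
  qed
  have compose: "tcomp N v2 g f \<in> U_cat N s K v1 v3"
    if f: "f \<in> U_cat N s K v1 v2" and g: "g \<in> U_cat N s K v2 v3" for f g v1 v2 v3
  proof -
    obtain w1 w2 w3 where v: "v1 = map U_obj w1" "v2 = map U_obj w2" "v3 = map U_obj w3"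
      using color_word by metis
    obtain p q where p: "p \<in> K (length w1) (length w2)" "p \<in> dhom N w1 w2" "f = U_map N s p"
      and q: "q \<in> K (length w2) (length w3)" "q \<in> dhom N w2 w3" "g = U_map N s q"
      using f g unfolding v U_cat_eq by blast
    have "tcomp N v2 g f = U_map N s (lcomp N q p)" using F p q v by blast
    then show ?thesis unfolding v U_cat_eq using comp[OF p(1) q(1)] lcomp_dhom[OF N p(2) q(2)] by blast
  qed
  have involution: "linv f \<in> U_cat N s K v2 v1" if f: "f \<in> U_cat N s K v1 v2" for f v1 v2
  proof -
    obtain w1 w2 where v: "v1 = map U_obj w1" "v2 = map U_obj w2" using color_word by metis
    obtain p where p: "p \<in> K (length w1) (length w2)" "p \<in> dhom N w1 w2" "f = U_map N s p"
      using f unfolding v U_cat_eq by blast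
    have "linv f = U_map N s (linv p)" using F p by blast
    then show ?thesis unfolding v U_cat_eq using inv[OF p(1)] linv_dhom[OF N p(2)] by blast
  qed
  \<comment> \<open>The identity of a color is the image of the projection of a one-letter
    word.\<close>
  have identity: "id_color (U_obj a) \<in> U_cat N s K [U_obj a] [U_obj a]" for a
  proof -
    have "pi_word N [a] \<in> K (length [a]) (length [a])"
      using linear_category_corner(2)[OF N K sigma, of _ "[a]" "[a]"] id by (simp add: One_nat_def)
    then have "U_map N s (pi_word N [a]) \<in> U_cat N s K (map U_obj [a]) (map U_obj [a])"
      unfolding U_cat_eq using pi_word_dhom[OF N] by blast
    moreover have "U_map N s (pi_word N [a]) = id_word (map U_obj [a])" using F by blast
    moreover have "id_word [c] = id_color c" for c
    proof -
      have "ltensor (basis_elt p) (basis_elt {}) = basis_elt p" for p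
        by (simp add: ltensor_def ptensor_def)
      then show ?thesis by (cases c) simp_all
    qed
    ultimately show ?thesis by simp
  qed
  \<comment> \<open>The pair partition does not lie over a single word; its components over the
    words \<open>[Dot, Dot]\<close> and \<open>[Down, Down]\<close> are mapped to the two required
    pairs.\<close>
  have pairs: "U_corner N s [] [a, b] (basis_elt pair_part) \<in> U_cat N s K [] [U_obj a, U_obj b]" for a b
  proof -
    have pair': "basis_elt pair_part \<in> K (length ([] :: letter list)) (length [a, b])"
      using pair by (simp add: numeral_2_eq_2)
    have lp: "basis_elt pair_part \<in> lparts (length ([] :: letter list)) (length [a, b])"
      using pair_part_parts by (simp add: numeral_2_eq_2)
    have "U_map N s (corner N [] [a, b] (basis_elt pair_part)) \<in> U_cat N s K (map U_obj []) (map U_obj [a, b])"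
      unfolding U_cat_eq using linear_category_corner(1)[OF N K sigma pair'] corner_dhom[OF N lp] by blast
    then show ?thesis unfolding U_map_corner[OF lp N] by simp
  qed
  show ?thesis
    unfolding tri_linear_category_def
    using sp mult compose involution identity[of Dot] identity[of Down] pairs[of Dot Dot] pairs[of Down Down]
    unfolding U_corner_pair[OF N] by simp
qed

end

section \<open>Linear combinations in C*-algebras\<close>

text \<open>Keeps the scalar coefficients apart from the algebra elements, so that matrix identities
  are proved over the complex numbers and only then inserted.\<close>

definition lincomb :: "'a cstar \<Rightarrow> 'i set \<Rightarrow> ('i \<Rightarrow> complex) \<Rightarrow> ('i \<Rightarrow> 'a) \<Rightarrow> 'a"
  where "lincomb A I c X = (\<Oplus>\<^bsub>A\<^esub>i\<in>I. cscale A (c i) (X i))"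

text \<open>V times X times transposed V, written as one sum over pairs so that
  \<open>lincomb_lincomb\<close> can merge it with further scalar matrices. For real V it agrees
  with \<open>conjugate\<close>.\<close>

definition conj_rep :: "'a cstar \<Rightarrow> 'i set \<Rightarrow> ('i \<Rightarrow> 'i \<Rightarrow> complex) \<Rightarrow> ('i \<Rightarrow> 'i \<Rightarrow> 'a) \<Rightarrow> 'i \<Rightarrow> 'i \<Rightarrow> 'a"
  where "conj_rep A I V X i j = lincomb A (I \<times> I) (\<lambda>(a, b). V i a * V j b) (\<lambda>(a, b). X a b)"

lemma intertwines_lincomb:
  "intertwines A I J T X Y \<longleftrightarrow> (\<forall>j\<in>J. \<forall>i\<in>I.
    lincomb A I (T j) (\<lambda>i'. X i' i) = lincomb A J (\<lambda>j'. T j' i) (Y j))"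
  by (simp add: intertwines_def lincomb_def)

context cstar_algebra
begin

lemma scale_zero_left: "x \<in> carrier A \<Longrightarrow> cscale A 0 x = \<zero>"
proof -
  assume x: "x \<in> carrier A"
  have "cscale A 0 x \<oplus> cscale A 0 x = cscale A 0 x" using add_scale[OF x, of 0 0] by simp
  then show ?thesis using scale_closed[OF x] add.r_cancel_one' by metis
qed

lemma scale_zero_right: "cscale A a \<zero> = \<zero>"
  using scale_scale[of \<zero> a 0] scale_zero_left[of \<zero>] by simp

lemma adj_zero: "cadj A \<zero> = \<zero>"
  using adj_scale[of \<zero> 0] scale_zero_left[of \<zero>] scale_zero_left[OF adj_closed, of \<zero>] by simp

lemma lincomb_closed [simp, intro]: "(\<And>i. i \<in> I \<Longrightarrow> X i \<in> carrier A) \<Longrightarrow> lincomb A I c X \<in> carrier A"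
  unfolding lincomb_def by (rule finsum_closed) (auto intro: scale_closed)

lemma lincomb_empty [simp]: "lincomb A {} c X = \<zero>"
  by (simp add: lincomb_def)

lemma lincomb_insert:
  "finite I \<Longrightarrow> i \<notin> I \<Longrightarrow> X i \<in> carrier A \<Longrightarrow> (\<And>k. k \<in> I \<Longrightarrow> X k \<in> carrier A) \<Longrightarrow>
    lincomb A (insert i I) c X = cscale A (c i) (X i) \<oplus> lincomb A I c X"
  unfolding lincomb_def by (rule finsum_insert) (auto intro: scale_closed)

lemma lincomb_cong:
  "I = J \<Longrightarrow> (\<And>i. i \<in> J \<Longrightarrow> c i = d i) \<Longrightarrow> (\<And>i. i \<in> J \<Longrightarrow> X i = Y i) \<Longrightarrow> (\<And>i. i \<in> J \<Longrightarrow> Y i \<in> carrier A) \<Longrightarrow>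
    lincomb A I c X = lincomb A J d Y"
  unfolding lincomb_def by (rule finsum_cong') (auto intro: scale_closed)

lemma lincomb_add:
  assumes "\<And>i. i \<in> I \<Longrightarrow> X i \<in> carrier A"
  shows "lincomb A I c X \<oplus> lincomb A I d X = lincomb A I (\<lambda>i. c i + d i) X"
proof -
  have "lincomb A I (\<lambda>i. c i + d i) X = (\<Oplus>i\<in>I. cscale A (c i) (X i) \<oplus> cscale A (d i) (X i))"
    unfolding lincomb_def by (rule finsum_cong') (auto simp: add_scale assms intro!: scale_closed a_closed)
  also have "\<dots> = lincomb A I c X \<oplus> lincomb A I d X"
    unfolding lincomb_def by (rule finsum_addf) (auto intro: scale_closed assms)
  finally show ?thesis by simp
qed

lemma lincomb_neutral:
  assumes "\<And>i. i \<in> I \<Longrightarrow> X i \<in> carrier A" "\<And>i. i \<in> I \<Longrightarrow> c i = 0 \<or> X i = \<zero>"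
  shows "lincomb A I c X = \<zero>"
  unfolding lincomb_def using assms
  by (intro add.finprod_one_eqI) (metis scale_zero_left scale_zero_right)

lemma scale_lincomb:
  assumes "finite I" "\<And>i. i \<in> I \<Longrightarrow> X i \<in> carrier A"
  shows "cscale A a (lincomb A I c X) = lincomb A I (\<lambda>i. a * c i) X"
  using assms
proof (induction I rule: finite_induct)
  case empty
  then show ?case by (simp add: scale_zero_right)
next
  case (insert i I)
  then show ?case
    by (simp add: lincomb_insert[OF insert.hyps] scale_add scale_scale scale_closed lincomb_closed)
qed

text \<open>All inner combinations use the same elements, so only coefficients get multiplied; this
  is how a product of scalar matrices acts.\<close>

lemma lincomb_lincomb:
  assumes "finite I" "finite J" "\<And>j. j \<in> J \<Longrightarrow> X j \<in> carrier A"
  shows "lincomb A I c (\<lambda>i. lincomb A J (d i) X) = lincomb A J (\<lambda>j. \<Sum>i\<in>I. c i * d i j) X"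
  using assms(1)
proof (induction I rule: finite_induct)
  case empty
  have "lincomb A J (\<lambda>j. 0) X = \<zero>" by (rule lincomb_neutral) (use assms in auto)
  then show ?case by simp
next
  case (insert i I)
  have "lincomb A (insert i I) c (\<lambda>i. lincomb A J (d i) X) =
      cscale A (c i) (lincomb A J (d i) X) \<oplus> lincomb A I c (\<lambda>i. lincomb A J (d i) X)"
    by (rule lincomb_insert) (use insert assms in auto)
  also have "\<dots> = lincomb A J (\<lambda>j. c i * d i j) X \<oplus> lincomb A J (\<lambda>j. \<Sum>i\<in>I. c i * d i j) X"
    using insert.IH scale_lincomb[OF assms(2), of X] assms(3) by simp
  also have "\<dots> = lincomb A J (\<lambda>j. \<Sum>i\<in>insert i I. c i * d i j) X"
    using lincomb_add[of J X] assms(3) insert by simp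
  finally show ?case .
qed

lemma lincomb_mono_neutral:
  assumes "finite J" "I \<subseteq> J" "\<And>j. j \<in> J \<Longrightarrow> X j \<in> carrier A" "\<And>j. j \<in> J - I \<Longrightarrow> c j = 0 \<or> X j = \<zero>"
  shows "lincomb A I c X = lincomb A J c X"
proof -
  have z: "cscale A (c j) (X j) = \<zero>" if "j \<in> J - I" for j
    using assms(3)[of j] assms(4)[OF that] that scale_zero_left scale_zero_right by auto
  show ?thesis unfolding lincomb_def
    by (rule add.finprod_mono_neutral_cong_left) (use assms z in \<open>auto intro: scale_closed\<close>)
qed

lemma lincomb_reindex:
  assumes "inj_on h I" "\<And>i. i \<in> I \<Longrightarrow> X (h i) \<in> carrier A"
  shows "lincomb A (h ` I) c X = lincomb A I (c \<circ> h) (X \<circ> h)"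
  unfolding lincomb_def using assms by (subst finsum_reindex) (auto intro: scale_closed)

lemma lincomb_single:
  assumes "finite I" "i \<in> I" "\<And>i. i \<in> I \<Longrightarrow> X i \<in> carrier A"
  shows "lincomb A I (\<lambda>k. of_bool (k = i)) X = X i"
proof -
  have "lincomb A {i} (\<lambda>k. of_bool (k = i)) X = lincomb A I (\<lambda>k. of_bool (k = i)) X"
    by (rule lincomb_mono_neutral) (use assms in auto)
  then show ?thesis using lincomb_insert[of "{}" i X] assms by (simp add: scale_one)
qed

lemma lincomb_union:
  assumes "finite I" "finite J" "I \<inter> J = {}" "\<And>i. i \<in> I \<union> J \<Longrightarrow> X i \<in> carrier A"
  shows "lincomb A (I \<union> J) c X = lincomb A I c X \<oplus> lincomb A J c X"
  unfolding lincomb_def by (rule finsum_Un_disjoint) (use assms in \<open>auto intro: scale_closed\<close>)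

lemma lincomb_Times:
  assumes "finite I" "finite J" "\<And>i j. i \<in> I \<Longrightarrow> j \<in> J \<Longrightarrow> X i j \<in> carrier A"
  shows "lincomb A I c (\<lambda>i. lincomb A J (d i) (X i)) =
    lincomb A (I \<times> J) (\<lambda>(i, j). c i * d i j) (\<lambda>(i, j). X i j)"
  using assms(1,3)
proof (induction I rule: finite_induct)
  case (insert i I)
  let ?c = "\<lambda>(i, j). c i * d i j" and ?X = "\<lambda>(i, j). X i j"
  have cl: "X k j \<in> carrier A" if "k \<in> insert i I" "j \<in> J" for k j using insert.prems that by blast
  have "lincomb A (insert i I) c (\<lambda>i. lincomb A J (d i) (X i)) =
      cscale A (c i) (lincomb A J (d i) (X i)) \<oplus> lincomb A I c (\<lambda>i. lincomb A J (d i) (X i))"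
    by (rule lincomb_insert) (use insert cl in auto)
  also have "cscale A (c i) (lincomb A J (d i) (X i)) = lincomb A (Pair i ` J) ?c ?X"
    using lincomb_reindex[of "Pair i" J ?X ?c] scale_lincomb[OF assms(2), of "X i"] cl
    by (simp add: inj_on_def comp_def)
  also have "lincomb A I c (\<lambda>i. lincomb A J (d i) (X i)) = lincomb A (I \<times> J) ?c ?X"
    by (rule insert.IH) (use cl in auto)
  also have "lincomb A (Pair i ` J) ?c ?X \<oplus> lincomb A (I \<times> J) ?c ?X = lincomb A (Pair i ` J \<union> I \<times> J) ?c ?X"
    by (rule lincomb_union[symmetric]) (use insert cl assms(2) in auto)
  also have "Pair i ` J \<union> I \<times> J = insert i I \<times> J" by auto
  finally show ?case .
qed simp

lemma lincomb_mult_right: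
  assumes "finite I" "\<And>i. i \<in> I \<Longrightarrow> X i \<in> carrier A" "y \<in> carrier A"
  shows "lincomb A I c X \<otimes> y = lincomb A I c (\<lambda>i. X i \<otimes> y)"
  using assms(1,2)
proof (induction I rule: finite_induct)
  case (insert i I)
  then show ?case using assms(3)
    by (simp add: lincomb_insert l_distr scale_mult_left scale_closed)
qed (simp add: assms)

lemma lincomb_mult_left:
  assumes "finite I" "\<And>i. i \<in> I \<Longrightarrow> X i \<in> carrier A" "y \<in> carrier A"
  shows "y \<otimes> lincomb A I c X = lincomb A I c (\<lambda>i. y \<otimes> X i)"
  using assms(1,2)
proof (induction I rule: finite_induct)
  case (insert i I)
  then show ?case using assms(3)
    by (simp add: lincomb_insert r_distr scale_mult_right scale_closed)
qed (simp add: assms)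

lemma lincomb_mult:
  assumes "finite I" "finite J" "\<And>i. i \<in> I \<Longrightarrow> X i \<in> carrier A" "\<And>j. j \<in> J \<Longrightarrow> Y j \<in> carrier A"
  shows "lincomb A I c X \<otimes> lincomb A J d Y = lincomb A (I \<times> J) (\<lambda>(i, j). c i * d j) (\<lambda>(i, j). X i \<otimes> Y j)"
proof -
  have "lincomb A I c X \<otimes> lincomb A J d Y = lincomb A I c (\<lambda>i. lincomb A J d (\<lambda>j. X i \<otimes> Y j))"
  proof -
    have "lincomb A I c X \<otimes> lincomb A J d Y = lincomb A I c (\<lambda>i. X i \<otimes> lincomb A J d Y)"
      by (rule lincomb_mult_right) (use assms in auto)
    also have "\<dots> = lincomb A I c (\<lambda>i. lincomb A J d (\<lambda>j. X i \<otimes> Y j))"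
      by (rule lincomb_cong) (use assms in \<open>auto intro: lincomb_mult_left\<close>)
    finally show ?thesis .
  qed
  also have "\<dots> = lincomb A (I \<times> J) (\<lambda>(i, j). c i * d j) (\<lambda>(i, j). X i \<otimes> Y j)"
    by (rule lincomb_Times) (use assms in auto)
  finally show ?thesis .
qed

lemma adj_lincomb:
  assumes "finite I" "\<And>i. i \<in> I \<Longrightarrow> X i \<in> carrier A"
  shows "cadj A (lincomb A I c X) = lincomb A I (\<lambda>i. cnj (c i)) (\<lambda>i. cadj A (X i))"
  using assms
proof (induction I rule: finite_induct)
  case empty
  then show ?case by (simp add: adj_zero)
next
  case (insert i I)
  then show ?case by (simp add: lincomb_insert adj_add adj_scale scale_closed adj_closed)
qed

lemma conj_rep_closed:
  "(\<And>i j. i \<in> I \<Longrightarrow> j \<in> I \<Longrightarrow> X i j \<in> carrier A) \<Longrightarrow> conj_rep A I V X i j \<in> carrier A"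
  unfolding conj_rep_def by (rule lincomb_closed) auto

lemma conj_rep_inverse:
  assumes fin: "finite I" and X: "\<And>i j. i \<in> I \<Longrightarrow> j \<in> I \<Longrightarrow> X i j \<in> carrier A"
    and inv: "\<And>i a. i \<in> I \<Longrightarrow> a \<in> I \<Longrightarrow> (\<Sum>m\<in>I. W i m * V m a) = of_bool (i = a)"
    and ij: "i \<in> I" "j \<in> I"
  shows "conj_rep A I W (conj_rep A I V X) i j = X i j"
proof -
  let ?X = "\<lambda>(a, b). X a b"
  have "conj_rep A I W (conj_rep A I V X) i j =
      lincomb A (I \<times> I) (\<lambda>(m, n). W i m * W j n) (\<lambda>mn. lincomb A (I \<times> I) (\<lambda>(a, b). V (fst mn) a * V (snd mn) b) ?X)"
    unfolding conj_rep_def by (simp add: case_prod_unfold)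
  also have "\<dots> = lincomb A (I \<times> I)
      (\<lambda>ab. \<Sum>mn\<in>I \<times> I. (case mn of (m, n) \<Rightarrow> W i m * W j n) * (case ab of (a, b) \<Rightarrow> V (fst mn) a * V (snd mn) b)) ?X"
    by (rule lincomb_lincomb) (use fin X in auto)
  also have "\<dots> = lincomb A (I \<times> I) (\<lambda>ab. of_bool (ab = (i, j))) ?X"
  proof (rule lincomb_cong)
    fix ab assume "ab \<in> I \<times> I"
    then obtain a b where ab: "ab = (a, b)" "a \<in> I" "b \<in> I" by auto
    have "(\<Sum>mn\<in>I \<times> I. (case mn of (m, n) \<Rightarrow> W i m * W j n) * (case ab of (a, b) \<Rightarrow> V (fst mn) a * V (snd mn) b)) =
        (\<Sum>m\<in>I. W i m * V m a) * (\<Sum>n\<in>I. W j n * V n b)"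
      unfolding sum_product sum.cartesian_product by (intro sum.cong refl) (auto simp: ab mult_ac)
    also have "\<dots> = of_bool (ab = (i, j))" using inv ij ab by auto
    finally show "(\<Sum>mn\<in>I \<times> I. (case mn of (m, n) \<Rightarrow> W i m * W j n) * (case ab of (a, b) \<Rightarrow> V (fst mn) a * V (snd mn) b)) =
        of_bool (ab = (i, j))" .
  qed (use X in auto)
  also have "\<dots> = X i j" using lincomb_single[of "I \<times> I" "(i, j)" ?X] fin X ij by auto
  finally show ?thesis .
qed

text \<open>With T' = Q T P^t, orthogonality gives T' P = Q T (\<open>T'P\<close>) and Q^t T' = T
  P^t (\<open>T'Q\<close>). Then T' (P X P^t) = Q (T X) P^t = Q (Y T) P^t = (Q Y Q^t) T'.\<close>

lemma intertwines_conj: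
  assumes fin: "finite I" "finite J"
    and X: "\<And>i j. i \<in> I \<Longrightarrow> j \<in> I \<Longrightarrow> X i j \<in> carrier A" and Y: "\<And>i j. i \<in> J \<Longrightarrow> j \<in> J \<Longrightarrow> Y i j \<in> carrier A"
    and P: "\<And>a b. a \<in> I \<Longrightarrow> b \<in> I \<Longrightarrow> (\<Sum>i\<in>I. P i a * P i b) = of_bool (a = b)"
    and Q: "\<And>a b. a \<in> J \<Longrightarrow> b \<in> J \<Longrightarrow> (\<Sum>i\<in>J. Q i a * Q i b) = of_bool (a = b)"
    and T: "intertwines A I J T X Y"
    and T': "\<And>i j. i \<in> I \<Longrightarrow> j \<in> J \<Longrightarrow> T' j i = (\<Sum>a\<in>I. \<Sum>b\<in>J. P i a * Q j b * T b a)"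
  shows "intertwines A I J T' (conj_rep A I P X) (conj_rep A J Q Y)"
  unfolding intertwines_lincomb
proof (intro ballI)
  fix j i assume j: "j \<in> J" and i: "i \<in> I"
  let ?X = "\<lambda>(a, b). X a b" and ?Y = "\<lambda>(a, b). Y a b" and ?c = "\<lambda>ba. Q j (fst ba) * P i (snd ba)"
  have T'P: "(\<Sum>i'\<in>I. T' j i' * P i' a) = (\<Sum>b\<in>J. Q j b * T b a)" if a: "a \<in> I" for a
  proof -
    have "(\<Sum>i'\<in>I. T' j i' * P i' a) = (\<Sum>i'\<in>I. \<Sum>a'\<in>I. \<Sum>b\<in>J. P i' a' * P i' a * (Q j b * T b a'))"
      by (intro sum.cong refl) (simp add: T'[OF _ j] sum_distrib_left mult_ac)
    also have "\<dots> = (\<Sum>a'\<in>I. \<Sum>b\<in>J. \<Sum>i'\<in>I. P i' a' * P i' a * (Q j b * T b a'))"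
      by (rule sum_swap3[symmetric])
    also have "\<dots> = (\<Sum>a'\<in>I. \<Sum>b\<in>J. of_bool (a' = a) * (Q j b * T b a'))"
      using P a by (intro sum.cong refl) (simp flip: sum_distrib_right)
    also have "\<dots> = (\<Sum>a'\<in>I. of_bool (a' = a) * (\<Sum>b\<in>J. Q j b * T b a'))" by (simp only: sum_distrib_left)
    also have "\<dots> = (\<Sum>b\<in>J. Q j b * T b a)" by (rule sum_kronecker(2)[OF fin(1) a])
    finally show ?thesis .
  qed
  have T'Q: "(\<Sum>j'\<in>J. T' j' i * Q j' b) = (\<Sum>a\<in>I. P i a * T b a)" if b: "b \<in> J" for b
  proof -
    have "(\<Sum>j'\<in>J. T' j' i * Q j' b) = (\<Sum>j'\<in>J. \<Sum>a\<in>I. \<Sum>b'\<in>J. Q j' b' * Q j' b * (P i a * T b' a))"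
      by (intro sum.cong refl) (simp add: T'[OF i] sum_distrib_left mult_ac)
    also have "\<dots> = (\<Sum>a\<in>I. \<Sum>b'\<in>J. \<Sum>j'\<in>J. Q j' b' * Q j' b * (P i a * T b' a))"
      by (rule sum_swap3[symmetric])
    also have "\<dots> = (\<Sum>a\<in>I. \<Sum>b'\<in>J. of_bool (b' = b) * (P i a * T b' a))"
      using Q b by (intro sum.cong refl) (simp flip: sum_distrib_right)
    also have "\<dots> = (\<Sum>a\<in>I. P i a * T b a)" by (intro sum.cong refl sum_kronecker(2)[OF fin(2) b])
    finally show ?thesis .
  qed
  have "lincomb A I (T' j) (\<lambda>i'. conj_rep A I P X i' i) =
      lincomb A (I \<times> I) (\<lambda>ab. \<Sum>i'\<in>I. T' j i' * (case ab of (a, b) \<Rightarrow> P i' a * P i b)) ?X"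
    unfolding conj_rep_def by (rule lincomb_lincomb) (use fin X in auto)
  \<comment> \<open>The coefficients are regrouped by the entry (b, a) of T X: its weight is
    \<open>?c (b, a)\<close>, and the Kronecker factor fixes the column.\<close>
  also have "\<dots> = lincomb A (I \<times> I) (\<lambda>ab. \<Sum>ba\<in>J \<times> I. ?c ba * (T (fst ba) (fst ab) * of_bool (snd ba = snd ab))) ?X"
  proof (rule lincomb_cong)
    fix ab assume "ab \<in> I \<times> I"
    then obtain a b where ab: "ab = (a, b)" "a \<in> I" "b \<in> I" by auto
    have "(\<Sum>i'\<in>I. T' j i' * (case ab of (a, b) \<Rightarrow> P i' a * P i b)) = (\<Sum>i'\<in>I. T' j i' * P i' a) * P i b"
      by (simp add: ab sum_distrib_left mult_ac)
    also have "\<dots> = (\<Sum>b'\<in>J. Q j b' * T b' a) * P i b" by (simp only: T'P[OF ab(2)])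
    also have "\<dots> = (\<Sum>b'\<in>J. \<Sum>c\<in>I. of_bool (c = b) * (Q j b' * T b' a * P i c))"
      unfolding sum_distrib_right by (intro sum.cong refl sum_kronecker(2)[OF fin(1) ab(3), symmetric])
    also have "\<dots> = (\<Sum>ba\<in>J \<times> I. ?c ba * (T (fst ba) (fst ab) * of_bool (snd ba = snd ab)))"
      unfolding sum.cartesian_product by (intro sum.cong refl) (auto simp: ab)
    finally show "(\<Sum>i'\<in>I. T' j i' * (case ab of (a, b) \<Rightarrow> P i' a * P i b)) =
        (\<Sum>ba\<in>J \<times> I. ?c ba * (T (fst ba) (fst ab) * of_bool (snd ba = snd ab)))" .
  qed (use X in auto)
  also have "\<dots> = lincomb A (J \<times> I) ?c (\<lambda>ba. lincomb A (I \<times> I) (\<lambda>ab. T (fst ba) (fst ab) * of_bool (snd ba = snd ab)) ?X)"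
    by (rule lincomb_lincomb[symmetric]) (use fin X in auto)
  \<comment> \<open>The relation T X = Y T is inserted here, one entry at a time.\<close>
  also have "\<dots> = lincomb A (J \<times> I) ?c (\<lambda>ba. lincomb A (J \<times> J) (\<lambda>ab. of_bool (fst ab = fst ba) * T (snd ab) (snd ba)) ?Y)"
  proof (rule lincomb_cong)
    fix ba assume "ba \<in> J \<times> I"
    then obtain b a where ba: "ba = (b, a)" "b \<in> J" "a \<in> I" by auto
    have "lincomb A (I \<times> I) (\<lambda>ab. T (fst ba) (fst ab) * of_bool (snd ba = snd ab)) ?X =
        lincomb A ((\<lambda>x. (x, a)) ` I) (\<lambda>ab. T (fst ba) (fst ab) * of_bool (snd ba = snd ab)) ?X"
      by (rule lincomb_mono_neutral[symmetric]) (use fin X ba in auto)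
    also have "\<dots> = lincomb A I (T b) (\<lambda>i'. X i' a)"
      using lincomb_reindex[of "\<lambda>x. (x, a)" I ?X] X ba(3) by (simp add: inj_on_def comp_def ba)
    also have "\<dots> = lincomb A J (\<lambda>j'. T j' a) (Y b)"
      using T ba unfolding intertwines_lincomb by blast
    also have "\<dots> = lincomb A (Pair b ` J) (\<lambda>ab. of_bool (fst ab = fst ba) * T (snd ab) (snd ba)) ?Y"
      using lincomb_reindex[of "Pair b" J ?Y] Y ba(2) by (simp add: inj_on_def comp_def ba)
    also have "\<dots> = lincomb A (J \<times> J) (\<lambda>ab. of_bool (fst ab = fst ba) * T (snd ab) (snd ba)) ?Y"
      by (rule lincomb_mono_neutral) (use fin Y ba in auto)
    finally show "lincomb A (I \<times> I) (\<lambda>ab. T (fst ba) (fst ab) * of_bool (snd ba = snd ab)) ?X =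
        lincomb A (J \<times> J) (\<lambda>ab. of_bool (fst ab = fst ba) * T (snd ab) (snd ba)) ?Y" .
  qed (use Y in auto)
  also have "\<dots> = lincomb A (J \<times> J) (\<lambda>ab. \<Sum>ba\<in>J \<times> I. ?c ba * (of_bool (fst ab = fst ba) * T (snd ab) (snd ba))) ?Y"
    by (rule lincomb_lincomb) (use fin Y in auto)
  also have "\<dots> = lincomb A (J \<times> J) (\<lambda>ab. \<Sum>j'\<in>J. T' j' i * (case ab of (a, b) \<Rightarrow> Q j a * Q j' b)) ?Y"
  proof (rule lincomb_cong)
    fix ab assume "ab \<in> J \<times> J"
    then obtain a b where ab: "ab = (a, b)" "a \<in> J" "b \<in> J" by auto
    have "(\<Sum>ba\<in>J \<times> I. ?c ba * (of_bool (fst ab = fst ba) * T (snd ab) (snd ba))) =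
        (\<Sum>b'\<in>J. \<Sum>c\<in>I. of_bool (a = b') * (Q j b' * (P i c * T b c)))"
      unfolding sum.cartesian_product by (intro sum.cong refl) (auto simp: ab)
    also have "\<dots> = (\<Sum>b'\<in>J. of_bool (a = b') * (\<Sum>c\<in>I. Q j b' * (P i c * T b c)))" by (simp only: sum_distrib_left)
    also have "\<dots> = (\<Sum>c\<in>I. Q j a * (P i c * T b c))" by (rule sum_kronecker(1)[OF fin(2) ab(2)])
    also have "\<dots> = Q j a * (\<Sum>j'\<in>J. T' j' i * Q j' b)" unfolding T'Q[OF ab(3)] sum_distrib_left ..
    also have "\<dots> = (\<Sum>j'\<in>J. T' j' i * (case ab of (a, b) \<Rightarrow> Q j a * Q j' b))"
      by (simp add: ab sum_distrib_left mult_ac)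
    finally show "(\<Sum>ba\<in>J \<times> I. ?c ba * (of_bool (fst ab = fst ba) * T (snd ab) (snd ba))) =
        (\<Sum>j'\<in>J. T' j' i * (case ab of (a, b) \<Rightarrow> Q j a * Q j' b))" .
  qed (use Y in auto)
  also have "\<dots> = lincomb A J (\<lambda>j'. T' j' i) (conj_rep A J Q Y j)"
    unfolding conj_rep_def by (rule lincomb_lincomb[symmetric]) (use fin Y in auto)
  finally show "lincomb A I (T' j) (\<lambda>i'. conj_rep A I P X i' i) = lincomb A J (\<lambda>j'. T' j' i) (conj_rep A J Q Y j)" .
qed

lemma intertwines_sum:
  assumes W: "finite W" and X: "\<And>i j. i \<in> I \<Longrightarrow> j \<in> I \<Longrightarrow> X i j \<in> carrier A"
    and Y: "\<And>i j. i \<in> J \<Longrightarrow> j \<in> J \<Longrightarrow> Y i j \<in> carrier A"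
    and T: "\<And>w. w \<in> W \<Longrightarrow> intertwines A I J (T w) X Y"
  shows "intertwines A I J (\<lambda>j i. \<Sum>w\<in>W. T w j i) X Y"
  using W T
proof (induction W rule: finite_induct)
  case empty
  have "lincomb A I (\<lambda>_. 0) (\<lambda>i'. X i' i) = \<zero>" "lincomb A J (\<lambda>_. 0) (Y j) = \<zero>" if "i \<in> I" "j \<in> J" for i j
    by (rule lincomb_neutral; use that X Y in auto)+
  then show ?case by (simp add: intertwines_lincomb)
next
  case (insert w W)
  have "lincomb A I (\<lambda>i. \<Sum>w\<in>insert w W. T w j i) (\<lambda>i'. X i' i) =
      lincomb A J (\<lambda>j'. \<Sum>w\<in>insert w W. T w j' i) (Y j)" if "i \<in> I" "j \<in> J" for i j
  proof -
    have "lincomb A I (\<lambda>i. \<Sum>w\<in>insert w W. T w j i) (\<lambda>i'. X i' i) =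
        lincomb A I (T w j) (\<lambda>i'. X i' i) \<oplus> lincomb A I (\<lambda>i. \<Sum>w\<in>W. T w j i) (\<lambda>i'. X i' i)"
      using insert by (subst lincomb_add) (use that X in auto)
    also have "\<dots> = lincomb A J (\<lambda>j'. T w j' i) (Y j) \<oplus> lincomb A J (\<lambda>j'. \<Sum>w\<in>W. T w j' i) (Y j)"
      using insert.IH insert.prems that unfolding intertwines_lincomb by auto
    also have "\<dots> = lincomb A J (\<lambda>j'. \<Sum>w\<in>insert w W. T w j' i) (Y j)"
      using insert by (subst lincomb_add) (use that Y in auto)
    finally show ?thesis .
  qed
  then show ?case by (simp add: intertwines_lincomb)
qed

section \<open>Tensor powers of a representation\<close>

lemma rep_power_0 [simp]: "rep_power A u 0 i j = \<one>"
  by (simp add: rep_power_def list_prod_def)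

lemma rep_power_Suc: "rep_power A u (Suc k) (x # i) (y # j) = u x y \<otimes> rep_power A u k i j"
  by (simp add: rep_power_def list_prod_def upt_conv_Cons comp_def del: upt_Suc flip: map_Suc_upt)

lemma rep_power_closed:
  "(\<And>i j. i < N \<Longrightarrow> j < N \<Longrightarrow> u i j \<in> carrier A) \<Longrightarrow> i \<in> multi_idx N k \<Longrightarrow> j \<in> multi_idx N k \<Longrightarrow>
    rep_power A u k i j \<in> carrier A"
  by (induction k arbitrary: i j) (auto simp: multi_idx_Suc rep_power_Suc)

lemma rep_power_cong:
  "(\<And>i j. i < N \<Longrightarrow> j < N \<Longrightarrow> u i j = u' i j) \<Longrightarrow> i \<in> multi_idx N k \<Longrightarrow> j \<in> multi_idx N k \<Longrightarrow>
    rep_power A u k i j = rep_power A u' k i j"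
  by (induction k arbitrary: i j) (auto simp: multi_idx_Suc rep_power_Suc)

text \<open>Scalars are central, so the coefficients can be collected in front of each product of
  entries without changing the order of its factors.\<close>

lemma rep_power_conj:
  assumes u: "\<And>i j. i < N \<Longrightarrow> j < N \<Longrightarrow> u i j \<in> carrier A"
  shows "i \<in> multi_idx N k \<Longrightarrow> j \<in> multi_idx N k \<Longrightarrow>
    rep_power A (conj_rep A {..<N} V u) k i j = conj_rep A (multi_idx N k) (tensor_power V k) (rep_power A u k) i j"
proof (induction k arbitrary: i j)
  case 0
  then show ?case
    using lincomb_insert[of "{}" "([] :: nat list, [] :: nat list)" "\<lambda>_. \<one>" "\<lambda>_. 1"]
    by (simp add: conj_rep_def tensor_power_def scale_one case_prod_unfold)
next
  case (Suc k)
  then obtain x i' y j' where i: "i = x # i'" "x < N" "i' \<in> multi_idx N k"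
    and j: "j = y # j'" "y < N" "j' \<in> multi_idx N k" unfolding multi_idx_Suc by blast
  let ?I = "multi_idx N k" and ?L = "{..<N}"
  let ?h = "\<lambda>((a, b), (a', b')). (a # a', b # b')"
  let ?c = "\<lambda>(a, b). tensor_power V (Suc k) i a * tensor_power V (Suc k) j b"
  let ?X = "\<lambda>(a, b). rep_power A u (Suc k) a b"
  have tp: "tensor_power V (Suc k) (x # i') (a # a') = V x a * tensor_power V k i' a'" for x i' a a'
    by (simp add: tensor_power_def prod.lessThan_Suc_shift del: prod.lessThan_Suc)
  have cl: "rep_power A u k a b \<in> carrier A" if "a \<in> ?I" "b \<in> ?I" for a b
    by (rule rep_power_closed[OF u that])
  have "rep_power A (conj_rep A ?L V u) (Suc k) i j =
      conj_rep A ?L V u x y \<otimes> conj_rep A ?I (tensor_power V k) (rep_power A u k) i' j'"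
    unfolding i(1) j(1) rep_power_Suc Suc.IH[OF i(3) j(3)] ..
  also have "\<dots> = lincomb A ((?L \<times> ?L) \<times> (?I \<times> ?I))
      (\<lambda>(p, q). (case p of (a, b) \<Rightarrow> V x a * V y b) * (case q of (a, b) \<Rightarrow> tensor_power V k i' a * tensor_power V k j' b))
      (\<lambda>(p, q). (case p of (a, b) \<Rightarrow> u a b) \<otimes> (case q of (a, b) \<Rightarrow> rep_power A u k a b))"
    unfolding conj_rep_def by (rule lincomb_mult) (use u cl in auto)
  \<comment> \<open>\<open>?h\<close> regroups a pair of first entries and a pair of remainders into
    a pair of index lists.\<close>
  also have "\<dots> = lincomb A ((?L \<times> ?L) \<times> (?I \<times> ?I)) (?c \<circ> ?h) (?X \<circ> ?h)"
    by (rule lincomb_cong) (use u cl in \<open>auto simp: i(1) j(1) tp rep_power_Suc mult_ac\<close>)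
  also have "\<dots> = lincomb A (?h ` ((?L \<times> ?L) \<times> (?I \<times> ?I))) ?c ?X"
    by (rule lincomb_reindex[symmetric]) (use u cl in \<open>auto simp: inj_on_def rep_power_Suc\<close>)
  also have "?h ` ((?L \<times> ?L) \<times> (?I \<times> ?I)) = multi_idx N (Suc k) \<times> multi_idx N (Suc k)"
    by (auto simp: multi_idx_Suc image_iff)
  finally show ?case by (simp add: conj_rep_def)
qed

section \<open>Subalgebras and star homomorphisms\<close>

lemma cstar_subalgebra_lincomb:
  assumes S: "cstar_subalgebra A S" and "finite I" "\<And>i. i \<in> I \<Longrightarrow> X i \<in> S"
  shows "lincomb A I c X \<in> S"
  using assms(2,3)
proof (induction I rule: finite_induct)
  case empty
  have "cscale A 0 \<one> \<in> S" using S by (simp add: cstar_subalgebra_def)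
  then show ?case by (simp add: scale_zero_left)
next
  case (insert i I)
  have "X k \<in> carrier A" if "k \<in> insert i I" for k
    using S insert.prems[OF that] by (auto simp: cstar_subalgebra_def)
  then have "lincomb A (insert i I) c X = cscale A (c i) (X i) \<oplus> lincomb A I c X"
    using insert by (intro lincomb_insert) auto
  then show ?case using insert S by (simp add: cstar_subalgebra_def)
qed

lemma cstar_subalgebra_zero: "cstar_subalgebra A S \<Longrightarrow> \<zero> \<in> S"
  using cstar_subalgebra_lincomb[of S "{}"] by simp

end

lemma star_hom_lincomb:
  assumes A: "cstar_algebra A" and B: "cstar_algebra B" and phi: "\<phi> \<in> star_hom A B"
    and I: "finite I" "\<And>i. i \<in> I \<Longrightarrow> X i \<in> carrier A"
  shows "\<phi> (lincomb A I c X) = lincomb B I c (\<lambda>i. \<phi> (X i))"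
proof -
  interpret A: cstar_algebra A by (rule A)
  interpret B: cstar_algebra B by (rule B)
  have hom: "\<phi> \<in> ring_hom A B" and sc: "x \<in> carrier A \<Longrightarrow> \<phi> (cscale A a x) = cscale B a (\<phi> x)" for a x
    using phi by (auto simp: star_hom_def)
  have cl: "x \<in> carrier A \<Longrightarrow> \<phi> x \<in> carrier B" for x using hom ring_hom_closed by fast
  have zero: "\<phi> \<zero>\<^bsub>A\<^esub> = \<zero>\<^bsub>B\<^esub>"
    using sc[of "\<one>\<^bsub>A\<^esub>" 0] by (simp add: A.scale_zero_left B.scale_zero_left cl)
  show ?thesis using I
  proof (induction I rule: finite_induct)
    case empty
    then show ?case by (simp add: zero)
  next
    case (insert i I)
    then have "\<phi> (lincomb A (insert i I) c X) = \<phi> (cscale A (c i) (X i)) \<oplus>\<^bsub>B\<^esub> \<phi> (lincomb A I c X)"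
      using ring_hom_add[OF hom] by (simp add: A.lincomb_insert A.scale_closed A.lincomb_closed)
    then show ?case using insert by (simp add: B.lincomb_insert sc cl)
  qed
qed

section \<open>The associated quantum groups\<close>

lemma pi_word_orthogonal:
  assumes N: "2 \<le> N" and len: "length w' = length w" and ne: "w' \<noteq> w"
  shows "lcomp N (pi_word N w') (pi_word N w) = 0"
proof (rule lfam_eqI[of "length w" "length w" "\<lambda>N. lcomp N (pi_word N w') (pi_word N w)" "\<lambda>N. 0", OF _ _ N])
  have P: "pi_word N w' \<in> lparts (length w) (length w)" for N using pi_word_lparts[of N w'] len by simp
  show "lfam (parts (length w) (length w)) (\<lambda>N. lcomp N (pi_word N w') (pi_word N w))"
    by (rule lfam_lcomp[OF lfam_pi_word[of w', unfolded len] lfam_pi_word])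
  show "lfam (parts (length w) (length w)) (\<lambda>N. 0)" by (rule lfam_const) simp
  fix N i j assume i: "i \<in> multi_idx N (length w)" and j: "j \<in> multi_idx N (length w)"
  have "T_map (lcomp N (pi_word N w') (pi_word N w)) j i =
      (\<Sum>h\<in>multi_idx N (length w). \<Prod>n<length w. pi_mat N (w' ! n) (j ! n) (h ! n) * pi_mat N (w ! n) (h ! n) (i ! n))"
    unfolding T_map_lcomp[OF P pi_word_lparts i j]
    by (intro sum.cong refl) (simp add: T_map_pi_word i j len prod.distrib)
  also have "\<dots> = (\<Prod>n<length w. of_bool (w' ! n = w ! n) * pi_mat N (w' ! n) (j ! n) (i ! n))"
    unfolding sum_multi_idx_prod[where f = "\<lambda>n h. pi_mat N (w' ! n) (j ! n) h * pi_mat N (w ! n) h (i ! n)"]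
    by (intro prod.cong refl) (simp add: pi_mat_mult multi_idx_nth[OF i] multi_idx_nth[OF j])
  also have "\<dots> = 0"
  proof -
    obtain n where "n < length w" "w' ! n \<noteq> w ! n" using ne len nth_equalityI by metis
    then show ?thesis by auto
  qed
  finally show "T_map (lcomp N (pi_word N w') (pi_word N w)) j i = T_map 0 j i" by (simp add: T_map_lin)
qed

text \<open>Projections of different words are orthogonal, so a morphism between two words has no
  other component.\<close>

lemma corner_other_word:
  assumes N: "2 \<le> N" and f: "f \<in> dhom N w1 w2" and len: "length w1' = length w1" "length w2' = length w2"
    and ne: "(w1', w2') \<noteq> (w1, w2)"
  shows "corner N w1' w2' f = 0"
proof -
  note fl = dhom_lparts[OF f]
  have zero: "lcomp N 0 g = 0" "lcomp N g 0 = 0" for g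
    using bilinear_ext_pscale_left[of _ 0 0 g] bilinear_ext_pscale_right[of _ g 0 0]
    unfolding lcomp_def by (simp_all only: plin.scale_zero_left)
  have P1: "pi_word N w1' \<in> lparts (length w1) (length w1)" using pi_word_lparts[of N w1'] len by simp
  have P2: "pi_word N w2' \<in> lparts (length w2) (length w2)" using pi_word_lparts[of N w2'] len by simp
  have eq: "lcomp N (pi_word N w2) f = f" "lcomp N f (pi_word N w1) = f"
    using f dhom_iff[OF N fl] by auto
  show ?thesis
  proof (cases "w2' = w2")
    case False
    have "corner N w1' w2' f = lcomp N (lcomp N (pi_word N w2') f) (pi_word N w1')"
      unfolding corner_def by (rule lcomp_assoc[OF P1 fl P2 N])
    also have "lcomp N (pi_word N w2') f = lcomp N (lcomp N (pi_word N w2') (pi_word N w2)) f"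
      using lcomp_assoc[OF fl pi_word_lparts[of N w2] P2 N] eq by simp
    finally show ?thesis using pi_word_orthogonal[OF N len(2) False] zero by simp
  next
    case True
    then have "w1 \<noteq> w1'" using ne by auto
    then have "lcomp N (pi_word N w1) (pi_word N w1') = 0"
      using pi_word_orthogonal[OF N len(1)[symmetric]] by simp
    then have "lcomp N f (pi_word N w1') = 0"
      using lcomp_assoc[OF P1 pi_word_lparts[of N w1] fl N] eq zero by simp
    then show ?thesis using zero by (simp add: corner_def)
  qed
qed

lemma tensor_power_orthogonal:
  assumes V: "\<And>a b. a < N \<Longrightarrow> b < N \<Longrightarrow> (\<Sum>i<N. V i a * V i b) = of_bool (a = b)"
    and ab: "a \<in> multi_idx N k" "b \<in> multi_idx N k"
  shows "(\<Sum>i\<in>multi_idx N k. tensor_power V k i a * tensor_power V k i b) = of_bool (a = b)"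
proof -
  have "(\<Sum>i\<in>multi_idx N k. tensor_power V k i a * tensor_power V k i b) =
      (\<Sum>i\<in>multi_idx N k. \<Prod>n<k. V (i ! n) (a ! n) * V (i ! n) (b ! n))"
    by (simp add: tensor_power_def prod.distrib)
  also have "\<dots> = (\<Prod>n<k. \<Sum>i<N. V i (a ! n) * V i (b ! n))"
    by (rule sum_multi_idx_prod)
  also have "\<dots> = (\<Prod>n<k. of_bool (a ! n = b ! n))"
    by (intro prod.cong refl V) (use ab multi_idx_nth in auto)
  finally show ?thesis by (simp add: prod_kronecker[OF ab])
qed

lemma intertwines_cong:
  assumes "\<And>i j. i \<in> I \<Longrightarrow> j \<in> J \<Longrightarrow> T j i = T' j i"
    "\<And>i j. i \<in> I \<Longrightarrow> j \<in> I \<Longrightarrow> X i j = X' i j" "\<And>i j. i \<in> J \<Longrightarrow> j \<in> J \<Longrightarrow> Y i j = Y' i j"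
    and A: "cstar_algebra A"
    and "\<And>i j. i \<in> I \<Longrightarrow> j \<in> I \<Longrightarrow> X' i j \<in> carrier A" "\<And>i j. i \<in> J \<Longrightarrow> j \<in> J \<Longrightarrow> Y' i j \<in> carrier A"
  shows "intertwines A I J T X Y \<longleftrightarrow> intertwines A I J T' X' Y'"
proof -
  interpret cstar_algebra A by (rule A)
  have "lincomb A I (T j) (\<lambda>i'. X i' i) = lincomb A I (T' j) (\<lambda>i'. X' i' i)"
    "lincomb A J (\<lambda>j'. T j' i) (Y j) = lincomb A J (\<lambda>j'. T' j' i) (Y' j)" if "i \<in> I" "j \<in> J" for i j
    by (rule lincomb_cong; use assms that in auto)+
  then show ?thesis unfolding intertwines_lincomb by auto
qed

context cstar_algebra
begin

lemma intertwines_restrict: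
  assumes fin: "finite I" "finite J" and sub: "I' \<subseteq> I" "J' \<subseteq> J"
    and X: "\<And>i j. i \<in> I \<Longrightarrow> j \<in> I \<Longrightarrow> X i j \<in> carrier A" and Y: "\<And>i j. i \<in> J \<Longrightarrow> j \<in> J \<Longrightarrow> Y i j \<in> carrier A"
    and T: "\<And>i j. i \<in> I \<Longrightarrow> j \<in> J \<Longrightarrow> \<not> (i \<in> I' \<and> j \<in> J') \<Longrightarrow> T j i = 0"
    and "intertwines A I J T X Y"
  shows "intertwines A I' J' T X Y"
  unfolding intertwines_lincomb
proof (intro ballI)
  fix j i assume j: "j \<in> J'" and i: "i \<in> I'"
  have "lincomb A I' (T j) (\<lambda>i'. X i' i) = lincomb A I (T j) (\<lambda>i'. X i' i)"
    by (rule lincomb_mono_neutral) (use fin sub X T i j in auto)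
  also have "\<dots> = lincomb A J (\<lambda>j'. T j' i) (Y j)"
    using assms(8) i j sub unfolding intertwines_lincomb by blast
  also have "\<dots> = lincomb A J' (\<lambda>j'. T j' i) (Y j)"
    by (rule lincomb_mono_neutral[symmetric]) (use fin sub Y T i j in auto)
  finally show "lincomb A I' (T j) (\<lambda>i'. X i' i) = lincomb A J' (\<lambda>j'. T j' i) (Y j)" .
qed

text \<open>The additional equations have a row outside \<open>J'\<close> or a column outside
  \<open>I'\<close>. In them a nonzero entry of T can only meet a mixed entry of X or Y, and the
  mixed entries in question vanish by assumption.\<close>

lemma intertwines_extend:
  assumes fin: "finite I" "finite J" and sub: "I' \<subseteq> I" "J' \<subseteq> J"
    and X: "\<And>i j. i \<in> I \<Longrightarrow> j \<in> I \<Longrightarrow> X i j \<in> carrier A" and Y: "\<And>i j. i \<in> J \<Longrightarrow> j \<in> J \<Longrightarrow> Y i j \<in> carrier A"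
    and T: "\<And>i j. i \<in> I \<Longrightarrow> j \<in> J \<Longrightarrow> \<not> (i \<in> I' \<and> j \<in> J') \<Longrightarrow> T j i = 0"
    and X0: "\<And>i j. i \<in> I' \<Longrightarrow> j \<in> I - I' \<Longrightarrow> X i j = \<zero>"
    and Y0: "\<And>i j. i \<in> J - J' \<Longrightarrow> j \<in> J' \<Longrightarrow> Y i j = \<zero>"
    and int: "intertwines A I' J' T X Y"
  shows "intertwines A I J T X Y"
  unfolding intertwines_lincomb
proof (intro ballI)
  fix j i assume j: "j \<in> J" and i: "i \<in> I"
  show "lincomb A I (T j) (\<lambda>i'. X i' i) = lincomb A J (\<lambda>j'. T j' i) (Y j)"
  proof (cases "i \<in> I' \<and> j \<in> J'")
    case True
    have "lincomb A I (T j) (\<lambda>i'. X i' i) = lincomb A I' (T j) (\<lambda>i'. X i' i)"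
      by (rule lincomb_mono_neutral[symmetric]) (use fin sub X T i j in auto)
    also have "\<dots> = lincomb A J' (\<lambda>j'. T j' i) (Y j)"
      using int True unfolding intertwines_lincomb by blast
    also have "\<dots> = lincomb A J (\<lambda>j'. T j' i) (Y j)"
      by (rule lincomb_mono_neutral) (use fin sub Y T i j in auto)
    finally show ?thesis .
  next
    case False
    have "T j k = 0 \<or> X k i = \<zero>" if k: "k \<in> I" for k
      using T[OF k j] X0[of k i] False i by blast
    then have "lincomb A I (T j) (\<lambda>i'. X i' i) = \<zero>"
      by (intro lincomb_neutral) (use X i in auto)
    moreover have "T k i = 0 \<or> Y j k = \<zero>" if k: "k \<in> J" for k
      using T[OF i k] Y0[of j k] False j by blast
    then have "lincomb A J (\<lambda>j'. T j' i) (Y j) = \<zero>"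
      by (intro lincomb_neutral) (use Y j in auto)
    ultimately show ?thesis by simp
  qed
qed

section \<open>Representations of the form v \<oplus> r\<close>

lemma list_prod_zero: "set xs \<subseteq> carrier A \<Longrightarrow> \<zero> \<in> set xs \<Longrightarrow> list_prod A xs = \<zero>"
proof (induction xs)
  case (Cons x xs)
  have closed: "set ys \<subseteq> carrier A \<Longrightarrow> list_prod A ys \<in> carrier A" for ys
    by (induction ys) (auto simp: list_prod_def)
  have "list_prod A (x # xs) = x \<otimes> list_prod A xs" by (simp add: list_prod_def)
  then show ?case using Cons closed[of xs] by auto
qed simp

lemma direct_sum_closed:
  assumes "\<And>i j. i < N - 1 \<Longrightarrow> j < N - 1 \<Longrightarrow> v i j \<in> carrier A" "r \<in> carrier A"
  shows "direct_sum N A v r i j \<in> carrier A"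
  using assms by (auto simp: direct_sum_def)

lemma rep_power_direct_sum:
  assumes "i \<in> word_idx N w" "j \<in> word_idx N w"
  shows "rep_power A (direct_sum N A v r) (length w) i j = word_rep A v r w i j"
  unfolding rep_power_def word_rep_def
proof (intro arg_cong[where f = "list_prod A"] map_cong refl)
  fix n assume "n \<in> set [0..<length w]"
  then show "direct_sum N A v r (i ! n) (j ! n) = (case w ! n of Ell \<Rightarrow> v (i ! n) (j ! n) | Tri \<Rightarrow> r)"
    using word_idx_nth[OF assms(1), of n] word_idx_nth[OF assms(2), of n]
    by (auto simp: direct_sum_def color_idx_def split: color.splits)
qed

text \<open>If only one of two tuples belongs to the word, then at some position one index is N - 1
  and the other is smaller; the factor there is a zero entry of v \<oplus> r. This supplies the
  vanishing that \<open>intertwines_extend\<close> asks for.\<close>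

lemma rep_power_direct_sum_zero:
  assumes vr: "\<And>i j. i < N - 1 \<Longrightarrow> j < N - 1 \<Longrightarrow> v i j \<in> carrier A" "r \<in> carrier A"
    and N: "2 \<le> N" and ij: "i \<in> multi_idx N (length w)" "j \<in> multi_idx N (length w)"
    and w: "(i \<in> word_idx N w) \<noteq> (j \<in> word_idx N w)"
  shows "rep_power A (direct_sum N A v r) (length w) i j = \<zero>"
proof -
  have "\<exists>n<length w. (i ! n \<in> color_idx N (w ! n)) \<noteq> (j ! n \<in> color_idx N (w ! n))"
    using w ij unfolding word_idx_def multi_idx_def by auto
  then obtain n where n: "n < length w" "(i ! n \<in> color_idx N (w ! n)) \<noteq> (j ! n \<in> color_idx N (w ! n))" by blast
  have "direct_sum N A v r (i ! n) (j ! n) = \<zero>"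
    using n by (auto simp: direct_sum_def color_idx_def split: color.splits)
  then show ?thesis
    unfolding rep_power_def using n direct_sum_closed[OF vr] by (intro list_prod_zero) force+
qed

lemma conjugate_conj_rep:
  assumes "\<And>i j. i < N \<Longrightarrow> j < N \<Longrightarrow> u i j \<in> carrier A"
    and V: "\<And>a b. cnj (V a b) = V a b"
  shows "conjugate N A V u i j = conj_rep A {..<N} V u i j"
proof -
  have "conjugate N A V u i j = lincomb A {..<N} (\<lambda>_. 1) (\<lambda>a. lincomb A {..<N} (\<lambda>b. V i a * V j b) (u a))"
    unfolding conjugate_def lincomb_def adjoint_mat_def V
    by (rule finsum_cong') (auto simp: scale_one assms scale_closed intro!: finsum_closed)
  also have "\<dots> = conj_rep A {..<N} V u i j"
    unfolding conj_rep_def by (subst lincomb_Times) (use assms in auto)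
  finally show ?thesis .
qed

end

context
  fixes N :: nat and s :: real
  assumes N: "2 \<le> N" and s: "s = 1 \<or> s = - 1"
begin

text \<open>By \<open>corner_other_word\<close> a single pair of words contributes to the sum over
  components.\<close>

lemma conj_T_dhom:
  assumes f: "f \<in> dhom N w1 w2" and i: "i \<in> multi_idx N (length w1)" and j: "j \<in> multi_idx N (length w2)"
  shows "conj_T N s (length w1) (length w2) f j i = tT_map N (map U_obj w1) (map U_obj w2) (U_map N s f) j i"
proof -
  let ?t = "\<lambda>w1' w2'. tT_map N (map U_obj w1') (map U_obj w2') (U_map N s (corner N w1' w2' f)) j i"
  have zero: "?t w1' w2' = 0" if "length w1' = length w1" "length w2' = length w2" "(w1', w2') \<noteq> (w1, w2)" for w1' w2'
    using corner_other_word[OF N f that] by (simp add: U_map_zero[OF N] tT_map_def)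
  have "conj_T N s (length w1) (length w2) f j i =
      (\<Sum>x\<in>{w. length w = length w1} \<times> {w. length w = length w2}. ?t (fst x) (snd x))"
    unfolding T_U_map_conj_T[OF s N dhom_lparts[OF f] i j, symmetric] T_U_map_def
    by (simp add: sum.cartesian_product case_prod_unfold)
  also have "\<dots> = (\<Sum>x\<in>{(w1, w2)}. ?t (fst x) (snd x))"
  proof (rule sum.mono_neutral_right)
    show "\<forall>x\<in>{w. length w = length w1} \<times> {w. length w = length w2} - {(w1, w2)}. ?t (fst x) (snd x) = 0"
    proof
      fix x assume "x \<in> {w. length w = length w1} \<times> {w. length w = length w2} - {(w1, w2)}"
      then show "?t (fst x) (snd x) = 0" by (intro zero) (auto simp: prod_eq_iff)
    qed
  qed auto
  finally show ?thesis by (simp add: dhom_corner[OF f])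
qed

text \<open>Conjugating back with the transposed matrix undoes \<open>conj_T\<close>, since the
  columns of U are orthonormal.\<close>

lemma T_map_conj_T:
  assumes i: "i \<in> multi_idx N k" and j: "j \<in> multi_idx N l"
  shows "T_map f j i = (\<Sum>a\<in>multi_idx N k. \<Sum>b\<in>multi_idx N l.
    tensor_power (\<lambda>x y. U_mat N s y x) k i a * tensor_power (\<lambda>x y. U_mat N s y x) l j b * conj_T N s k l f b a)"
proof -
  let ?I = "multi_idx N k" and ?J = "multi_idx N l" and ?U = "tensor_power (U_mat N s)"
  have "(\<Sum>a\<in>?I. \<Sum>b\<in>?J. tensor_power (\<lambda>x y. U_mat N s y x) k i a * tensor_power (\<lambda>x y. U_mat N s y x) l j b * conj_T N s k l f b a)
     = (\<Sum>a\<in>?I. \<Sum>b\<in>?J. \<Sum>a'\<in>?I. \<Sum>b'\<in>?J. (?U k a i * ?U k a a') * (?U l b j * ?U l b b') * T_map f b' a')"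
    by (simp add: conj_T_def tensor_power_def sum_distrib_left mult_ac)
  also have "\<dots> = (\<Sum>a'\<in>?I. \<Sum>b'\<in>?J. \<Sum>a\<in>?I. \<Sum>b\<in>?J. (?U k a i * ?U k a a') * (?U l b j * ?U l b b') * T_map f b' a')"
    by (rule sum_swap4)
  also have "\<dots> = (\<Sum>a'\<in>?I. \<Sum>b'\<in>?J. (\<Sum>a\<in>?I. ?U k a i * ?U k a a') * (\<Sum>b\<in>?J. ?U l b j * ?U l b b') * T_map f b' a')"
    unfolding sum_product unfolding sum_distrib_right ..
  also have "\<dots> = (\<Sum>a'\<in>?I. \<Sum>b'\<in>?J. of_bool (i = a') * of_bool (j = b') * T_map f b' a')"
    by (intro sum.cong refl) (simp add: tensor_power_orthogonal[OF U_mat_columns[OF N s]] i j)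
  also have "\<dots> = T_map f j i"
    unfolding mult.assoc sum_distrib_left[symmetric] sum_kronecker(1)[OF finite_multi_idx j]
    by (rule sum_kronecker(1)[OF finite_multi_idx i])
  finally show ?thesis ..
qed

lemma intertwines_conjugated:
  assumes A: "cstar_algebra A" and u: "\<And>i j. i < N \<Longrightarrow> j < N \<Longrightarrow> u i j \<in> carrier A"
    and V: "\<And>a b. a < N \<Longrightarrow> b < N \<Longrightarrow> (\<Sum>i<N. V i a * V i b) = of_bool (a = b)"
    and T: "intertwines A (multi_idx N k) (multi_idx N l) T (rep_power A u k) (rep_power A u l)"
    and T': "\<And>i j. i \<in> multi_idx N k \<Longrightarrow> j \<in> multi_idx N l \<Longrightarrow>
      T' j i = (\<Sum>a\<in>multi_idx N k. \<Sum>b\<in>multi_idx N l. tensor_power V k i a * tensor_power V l j b * T b a)"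
  shows "intertwines A (multi_idx N k) (multi_idx N l) T'
    (rep_power A (conj_rep A {..<N} V u) k) (rep_power A (conj_rep A {..<N} V u) l)"
proof -
  interpret cstar_algebra A by (rule A)
  have cl: "rep_power A u k a b \<in> carrier A" if "a \<in> multi_idx N k" "b \<in> multi_idx N k" for k a b
    by (rule rep_power_closed[OF u that])
  have "intertwines A (multi_idx N k) (multi_idx N l) T'
    (conj_rep A (multi_idx N k) (tensor_power V k) (rep_power A u k))
    (conj_rep A (multi_idx N l) (tensor_power V l) (rep_power A u l))"
    by (rule intertwines_conj[OF _ _ cl cl tensor_power_orthogonal[OF V] tensor_power_orthogonal[OF V] T T']) auto
  moreover have "rep_power A (conj_rep A {..<N} V u) m i j =
      conj_rep A (multi_idx N m) (tensor_power V m) (rep_power A u m) i j"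
    if "i \<in> multi_idx N m" "j \<in> multi_idx N m" for m i j
    by (rule rep_power_conj[OF u that])
  ultimately show ?thesis
    by (subst intertwines_cong[OF refl _ _ A]) (auto intro: conj_rep_closed cl)
qed

text \<open>The algebra stays the same. Relations are carried forward in \<open>A\<close> and
  backward in every test algebra, and the two families of generators are linear combinations of each
  other.\<close>

lemma U_cat_quantum_group:
  fixes A :: "'a cstar"
  assumes K: "linear_category N K" and sigma: "ltensor lsigma lsigma \<in> K 0 2"
    and G: "is_quantum_group TYPE('b) N K A u"
  shows "is_tri_quantum_group TYPE('b) N (U_cat N s K) A (conjugate N A (U_mat N s) u)"
proof -
  define U where "U = U_mat N s"
  define Ut where "Ut = (\<lambda>x y. U y x)"
  define ut where "ut = conjugate N A U u"
  define v where "v = ut"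
  define r where "r = ut (N - 1) (N - 1)"
  let ?L = "{..<N}"
  have A: "cstar_algebra A" and gen: "cstar_generated A {u i j | i j. i < N \<and> j < N}"
    and rel: "satisfies_relations N K A u"
    and univ: "\<And>(B :: 'b cstar) y. cstar_algebra B \<Longrightarrow> satisfies_relations N K B y \<Longrightarrow>
       \<exists>\<phi>\<in>star_hom A B. \<forall>i<N. \<forall>j<N. \<phi> (u i j) = y i j"
    using G by (auto simp: is_quantum_group_def)
  interpret A: cstar_algebra A by (rule A)
  have u: "u i j \<in> carrier A" "cadj A (u i j) = u i j" if "i < N" "j < N" for i j
    using rel that by (auto simp: satisfies_relations_def)
  have rel': "intertwines A (multi_idx N k) (multi_idx N l) (T_map p) (rep_power A u k) (rep_power A u l)"
    if "p \<in> K k l" for k l p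
    using rel that by (auto simp: satisfies_relations_def)
  have lp: "p \<in> lparts k l" if "p \<in> K k l" for p k l using K that by (auto simp: linear_category_def)
  have cnjU: "cnj (U a b) = U a b" for a b unfolding U_def by (rule cnj_U_mat[OF N s])
  have orthU: "(\<Sum>i<N. U i a * U i b) = of_bool (a = b)" if "a < N" "b < N" for a b
    unfolding U_def by (rule U_mat_columns[OF N s that])
  have orthUt: "(\<Sum>i<N. Ut i a * Ut i b) = of_bool (a = b)" if "a < N" "b < N" for a b
    unfolding U_def Ut_def by (rule U_mat_rows[OF N s that])
  have ut: "ut = conj_rep A ?L U u"
    unfolding ut_def by (intro ext A.conjugate_conj_rep u cnjU)
  have ut_closed: "ut i j \<in> carrier A" for i j
    unfolding ut by (rule A.conj_rep_closed) (use u in auto)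
  have adj_conj: "cadj B (conj_rep B ?L V z i j) = conj_rep B ?L V z i j"
    if B: "cstar_algebra B" and z: "\<And>i j. i < N \<Longrightarrow> j < N \<Longrightarrow> z i j \<in> carrier B \<and> cadj B (z i j) = z i j"
      and V: "\<And>a b. cnj (V a b) = V a b" for B :: "'c cstar" and V z i j
  proof -
    interpret B: cstar_algebra B by (rule B)
    have "cadj B (conj_rep B ?L V z i j) = lincomb B (?L \<times> ?L) (\<lambda>x. cnj (case x of (a, b) \<Rightarrow> V i a * V j b))
        (\<lambda>x. cadj B (case x of (a, b) \<Rightarrow> z a b))"
      unfolding conj_rep_def by (rule B.adj_lincomb) (use z in auto)
    also have "\<dots> = conj_rep B ?L V z i j"
      unfolding conj_rep_def by (rule B.lincomb_cong) (use z V in auto)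
    finally show ?thesis .
  qed
  have fwd: "intertwines A (multi_idx N k) (multi_idx N l) (conj_T N s k l p) (rep_power A ut k) (rep_power A ut l)"
    if "p \<in> K k l" for k l p
    unfolding ut by (rule intertwines_conjugated[OF A u(1) orthU rel'[OF that]]) (auto simp: conj_T_def U_def)
  \<comment> \<open>The relation for the projection of the word \<open>[Down]\<close> becomes P ut =
    ut P with P the projection onto the last coordinate. In positions (x, N - 1) and (N - 1, x) one
    side is zero and the other is a mixed entry of \<open>ut\<close>.\<close>
  have ut_zero: "ut x (N - 1) = \<zero>\<^bsub>A\<^esub> \<and> ut (N - 1) x = \<zero>\<^bsub>A\<^esub>" if x: "x < N - 1" for x
  proof -
    define p where "p = pi_word N [Down]"
    have pK: "p \<in> K 1 1"
      using linear_category_corner(2)[OF N K sigma, of "basis_elt id_part" "[Down]" "[Down]"] K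
      unfolding p_def by (simp add: linear_category_def One_nat_def)
    have R: "rep_power A ut 1 [a] [b] = ut a b" for a b
      using A.rep_power_Suc[of ut 0 a "[]" b "[]"] ut_closed by (simp add: One_nat_def)
    have T: "conj_T N s 1 1 p [b] [a] = of_bool (a = N - 1 \<and> b = N - 1)" if ab: "a < N" "b < N" for a b
    proof -
      have idx: "[a] \<in> multi_idx N (length [Down])" "[b] \<in> multi_idx N (length [Down])"
        using ab by (auto simp: multi_idx_def)
      have "U_map N s p = id_word (map U_obj [Down])"
        using U_map_functor[OF s N] unfolding monoidal_unitary_functor_def p_def by blast
      then have "conj_T N s 1 1 p [b] [a] = tT_map N [Tri] [Tri] (id_word [Tri]) [b] [a]"
        using conj_T_dhom[OF pi_word_dhom[OF N, of "[Down]", folded p_def] idx] by (simp add: One_nat_def)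
      also have "\<dots> = of_bool (a = N - 1 \<and> b = N - 1)"
        unfolding tT_map_T_map[OF id_word_ltparts]
        using T_map_id_word[of "[N - 1]" N "[Tri]" "[N - 1]"] by (auto simp: word_idx_Cons color_idx_def word_idx_def[of N "[]"])
      finally show ?thesis .
    qed
    have int: "lincomb A (multi_idx N 1) (conj_T N s 1 1 p [b]) (\<lambda>i'. rep_power A ut 1 i' [a]) =
       lincomb A (multi_idx N 1) (\<lambda>j'. conj_T N s 1 1 p j' [a]) (rep_power A ut 1 [b])" if "a < N" "b < N" for a b
      using fwd[OF pK] that unfolding intertwines_lincomb by (auto simp: multi_idx_def One_nat_def)
    have cl: "rep_power A ut 1 i j \<in> carrier A" if "i \<in> multi_idx N 1" "j \<in> multi_idx N 1" for i j
      by (rule A.rep_power_closed[OF ut_closed that])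
    have last: "[N - 1] \<in> multi_idx N 1" using N by (simp add: multi_idx_def One_nat_def)
    have L: "lincomb A (multi_idx N 1) (conj_T N s 1 1 p [b]) (\<lambda>i'. rep_power A ut 1 i' [a]) =
        (if b = N - 1 then ut (N - 1) a else \<zero>\<^bsub>A\<^esub>)" if ab: "a < N" "b < N" for a b
    proof -
      have am: "[a] \<in> multi_idx N 1" using ab by (simp add: multi_idx_def One_nat_def)
      show ?thesis
      proof (cases "b = N - 1")
        case True
        have "lincomb A (multi_idx N 1) (conj_T N s 1 1 p [b]) (\<lambda>i'. rep_power A ut 1 i' [a]) =
            lincomb A (multi_idx N 1) (\<lambda>i'. of_bool (i' = [N - 1])) (\<lambda>i'. rep_power A ut 1 i' [a])"
          by (rule A.lincomb_cong) (use True ab cl am in \<open>auto dest!: multi_idx_1 simp: T\<close>)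
        also have "\<dots> = ut (N - 1) a"
          using A.lincomb_single[of "multi_idx N 1" "[N - 1]" "\<lambda>i'. rep_power A ut 1 i' [a]"] last cl am by (simp add: R)
        finally show ?thesis using True by simp
      next
        case False
        have "lincomb A (multi_idx N 1) (conj_T N s 1 1 p [b]) (\<lambda>i'. rep_power A ut 1 i' [a]) = \<zero>\<^bsub>A\<^esub>"
          by (rule A.lincomb_neutral) (use False ab cl am in \<open>auto dest!: multi_idx_1 simp: T\<close>)
        then show ?thesis using False by simp
      qed
    qed
    have Rt: "lincomb A (multi_idx N 1) (\<lambda>j'. conj_T N s 1 1 p j' [a]) (rep_power A ut 1 [b]) =
        (if a = N - 1 then ut b (N - 1) else \<zero>\<^bsub>A\<^esub>)" if ab: "a < N" "b < N" for a b
    proof -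
      have bm: "[b] \<in> multi_idx N 1" using ab by (simp add: multi_idx_def One_nat_def)
      show ?thesis
      proof (cases "a = N - 1")
        case True
        have "lincomb A (multi_idx N 1) (\<lambda>j'. conj_T N s 1 1 p j' [a]) (rep_power A ut 1 [b]) =
            lincomb A (multi_idx N 1) (\<lambda>j'. of_bool (j' = [N - 1])) (rep_power A ut 1 [b])"
          by (rule A.lincomb_cong) (use True ab cl bm in \<open>auto dest!: multi_idx_1 simp: T\<close>)
        also have "\<dots> = ut b (N - 1)"
          using A.lincomb_single[of "multi_idx N 1" "[N - 1]" "rep_power A ut 1 [b]"] last cl bm by (simp add: R)
        finally show ?thesis using True by simp
      next
        case False
        have "lincomb A (multi_idx N 1) (\<lambda>j'. conj_T N s 1 1 p j' [a]) (rep_power A ut 1 [b]) = \<zero>\<^bsub>A\<^esub>"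
          by (rule A.lincomb_neutral) (use False ab cl bm in \<open>auto dest!: multi_idx_1 simp: T\<close>)
        then show ?thesis using False by simp
      qed
    qed
    have lt: "x < N" "N - 1 < N" "x \<noteq> N - 1" using x by auto
    show ?thesis
      using int[OF lt(1,2)] L[OF lt(1,2)] Rt[OF lt(1,2)] int[OF lt(2,1)] L[OF lt(2,1)] Rt[OF lt(2,1)] lt by simp
  qed
  have ds: "ut i j = direct_sum N A v r i j" if "i < N" "j < N" for i j
  proof -
    consider "i = N - 1" "j = N - 1" | "i = N - 1" "j < N - 1" | "i < N - 1" "j = N - 1" | "i < N - 1" "j < N - 1"
      using \<open>i < N\<close> \<open>j < N\<close> by linarith
    then show ?thesis by cases (auto simp: direct_sum_def v_def r_def ut_zero)
  qed
  have tri: "satisfies_tri_relations N (U_cat N s K) A v r"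
    unfolding satisfies_tri_relations_def
  proof (intro conjI allI impI ballI)
    show "v i j \<in> carrier A" "cadj A (v i j) = v i j" for i j
      unfolding v_def using ut_closed adj_conj[OF A _ cnjU, of u] u by (auto simp: ut)
    then show "r \<in> carrier A" "cadj A r = r" unfolding r_def v_def by auto
    fix c1 c2 p assume p: "p \<in> U_cat N s K c1 c2"
    obtain w1 w2 where c: "c1 = map U_obj w1" "c2 = map U_obj w2" using color_word by metis
    obtain f where f: "f \<in> K (length w1) (length w2)" "f \<in> dhom N w1 w2" "p = U_map N s f"
      using p unfolding c U_cat_eq by blast
    let ?I = "multi_idx N (length w1)" and ?J = "multi_idx N (length w2)"
    have N0: "0 < N" using N by simp
    have sub: "word_idx N c1 \<subseteq> ?I" "word_idx N c2 \<subseteq> ?J"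
      unfolding c using word_idx_subset[OF N0, of "map U_obj w1"] word_idx_subset[OF N0, of "map U_obj w2"] by simp_all
    have cl: "rep_power A ut k a b \<in> carrier A" if "a \<in> multi_idx N k" "b \<in> multi_idx N k" for k a b
      by (rule A.rep_power_closed[OF ut_closed that])
    have "intertwines A ?I ?J (tT_map N c1 c2 p) (rep_power A ut (length w1)) (rep_power A ut (length w2))"
      by (rule iffD1[OF intertwines_cong[OF _ refl refl A cl cl] fwd[OF f(1)]])
        (use conj_T_dhom[OF f(2)] c f(3) in auto)
    \<comment> \<open>The matrix of \<open>p\<close> vanishes outside the indices of the two words,
      so the relation restricts to them.\<close>
    then have int: "intertwines A (word_idx N c1) (word_idx N c2) (tT_map N c1 c2 p)
        (rep_power A ut (length w1)) (rep_power A ut (length w2))"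
      by (intro A.intertwines_restrict[OF _ _ sub cl cl]) (auto simp: tT_map_def)
    have wr: "rep_power A ut (length w) a b = word_rep A v r (map U_obj w) a b"
      if "a \<in> word_idx N (map U_obj w)" "b \<in> word_idx N (map U_obj w)" for w a b
    proof -
      have ab: "a \<in> multi_idx N (length w)" "b \<in> multi_idx N (length w)"
        using that word_idx_subset[OF N0, of "map U_obj w"] by auto
      have "rep_power A ut (length w) a b = rep_power A (direct_sum N A v r) (length w) a b"
        by (rule A.rep_power_cong[OF ds ab])
      then show ?thesis using A.rep_power_direct_sum[OF that, of v r] by simp
    qed
    show "intertwines A (word_idx N c1) (word_idx N c2) (tT_map N c1 c2 p) (word_rep A v r c1) (word_rep A v r c2)"
    proof (rule iffD1[OF intertwines_cong[OF refl _ _ A] int])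
      show "rep_power A ut (length w1) i j = word_rep A v r c1 i j" if "i \<in> word_idx N c1" "j \<in> word_idx N c1" for i j
        using wr that unfolding c by blast
      show "rep_power A ut (length w2) i j = word_rep A v r c2 i j" if "i \<in> word_idx N c2" "j \<in> word_idx N c2" for i j
        using wr that unfolding c by blast
      show "word_rep A v r c1 i j \<in> carrier A" if "i \<in> word_idx N c1" "j \<in> word_idx N c1" for i j
      proof -
        have ij: "i \<in> ?I" "j \<in> ?I" using that sub by blast+
        show ?thesis using wr[of i w1 j] that cl[OF ij] unfolding c by simp
      qed
      show "word_rep A v r c2 i j \<in> carrier A" if "i \<in> word_idx N c2" "j \<in> word_idx N c2" for i j
      proof -
        have ij: "i \<in> ?J" "j \<in> ?J" using that sub by blast+
        show ?thesis using wr[of i w2 j] that cl[OF ij] unfolding c by simp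
      qed
    qed
  qed
  have generated: "cstar_generated A (insert r {v i j | i j. i < N - 1 \<and> j < N - 1})"
    unfolding cstar_generated_def
  proof (intro conjI allI impI)
    show "insert r {v i j | i j. i < N - 1 \<and> j < N - 1} \<subseteq> carrier A"
      using ut_closed by (auto simp: v_def r_def)
    fix S assume S: "cstar_subalgebra A S" and sub: "insert r {v i j | i j. i < N - 1 \<and> j < N - 1} \<subseteq> S"
    have utS: "ut i j \<in> S" if "i < N" "j < N" for i j
      unfolding ds[OF that] direct_sum_def using sub A.cstar_subalgebra_zero[OF S] by auto
    \<comment> \<open>Conjugating back expresses the entries of \<open>u\<close> through those of v
      \<oplus> r; the mixed entries are zero and lie in every subalgebra.\<close>
    have "u i j \<in> S" if ij: "i < N" "j < N" for i j
    proof -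
      have "conj_rep A ?L Ut ut i j = u i j"
        unfolding ut by (rule A.conj_rep_inverse) (use u ij orthU in \<open>auto simp: Ut_def\<close>)
      moreover have "conj_rep A ?L Ut ut i j \<in> S"
        unfolding conj_rep_def by (rule A.cstar_subalgebra_lincomb[OF S]) (use utS in auto)
      ultimately show ?thesis by simp
    qed
    then show "S = carrier A" using gen S unfolding cstar_generated_def by blast
  qed
  have universal: "\<exists>\<phi>\<in>star_hom A B. (\<forall>i<N - 1. \<forall>j<N - 1. \<phi> (v i j) = v' i j) \<and> \<phi> r = r'"
    if B: "cstar_algebra B" and tri': "satisfies_tri_relations N (U_cat N s K) B v' r'" for B :: "'b cstar" and v' r'
  proof -
    interpret B: cstar_algebra B by (rule B)
    \<comment> \<open>The given v' \<oplus> r' is conjugated back by the transposed U. The resulting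
      \<open>y\<close> satisfies the relations of \<open>K\<close>, so the universal property of
      \<open>A\<close> applies to it.\<close>
    define z where "z = direct_sum N B v' r'"
    define y where "y = conj_rep B ?L Ut z"
    have vr: "\<And>i j. i < N - 1 \<Longrightarrow> j < N - 1 \<Longrightarrow> v' i j \<in> carrier B" "r' \<in> carrier B"
      "\<And>i j. i < N - 1 \<Longrightarrow> j < N - 1 \<Longrightarrow> cadj B (v' i j) = v' i j" "cadj B r' = r'"
      using tri' by (auto simp: satisfies_tri_relations_def)
    have zc: "z i j \<in> carrier B" for i j unfolding z_def by (rule B.direct_sum_closed[OF vr(1,2)])
    have zadj: "cadj B (z i j) = z i j" for i j
      using vr by (auto simp: z_def direct_sum_def B.adj_zero)
    have yc: "y i j \<in> carrier B" for i j unfolding y_def by (rule B.conj_rep_closed) (rule zc)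
    have cl: "rep_power B z k a b \<in> carrier B" if "a \<in> multi_idx N k" "b \<in> multi_idx N k" for k a b
      by (rule B.rep_power_closed[OF zc that])
    have N0: "0 < N" using N by simp
    \<comment> \<open>Each corner of \<open>p\<close> lies in \<open>K\<close>, so its image is
      among the relations of v' and r'; they hold on the indices of the words and extend by zero
      because \<open>z\<close> is block diagonal.\<close>
    have part: "intertwines B (multi_idx N (length w1)) (multi_idx N (length w2))
        (tT_map N (map U_obj w1) (map U_obj w2) (U_map N s (corner N w1 w2 p)))
        (rep_power B z (length w1)) (rep_power B z (length w2))"
      if p: "p \<in> K (length w1) (length w2)" for w1 w2 p
    proof -
      let ?c1 = "map U_obj w1" and ?c2 = "map U_obj w2"
      have sub: "word_idx N (map U_obj w) \<subseteq> multi_idx N (length w)" for w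
        using word_idx_subset[OF N0, of "map U_obj w"] by simp
      have "U_map N s (corner N w1 w2 p) \<in> U_cat N s K ?c1 ?c2"
        unfolding U_cat_eq using linear_category_corner(1)[OF N K sigma p] corner_dhom[OF N lp[OF p]] by blast
      then have int: "intertwines B (word_idx N ?c1) (word_idx N ?c2) (tT_map N ?c1 ?c2 (U_map N s (corner N w1 w2 p)))
          (word_rep B v' r' ?c1) (word_rep B v' r' ?c2)"
        using tri' by (simp add: satisfies_tri_relations_def)
      have wr: "word_rep B v' r' (map U_obj w) a b = rep_power B z (length w) a b"
        if "a \<in> word_idx N (map U_obj w)" "b \<in> word_idx N (map U_obj w)" for w a b
        using B.rep_power_direct_sum[OF that, of v' r'] by (simp add: z_def)
      have "intertwines B (word_idx N ?c1) (word_idx N ?c2) (tT_map N ?c1 ?c2 (U_map N s (corner N w1 w2 p)))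
          (rep_power B z (length w1)) (rep_power B z (length w2))"
        by (rule iffD1[OF intertwines_cong[OF refl wr wr B] int]) (use cl sub in blast)+
      then show ?thesis
      proof (rule B.intertwines_extend[OF _ _ sub sub cl cl, rotated -1])
        fix i j
        show "rep_power B z (length w1) i j = \<zero>\<^bsub>B\<^esub>" if "i \<in> word_idx N ?c1" "j \<in> multi_idx N (length w1) - word_idx N ?c1"
          using B.rep_power_direct_sum_zero[OF vr(1,2) N, where i = i and j = j and w = ?c1] that sub[of w1] by (auto simp: z_def)
        show "rep_power B z (length w2) i j = \<zero>\<^bsub>B\<^esub>" if "i \<in> multi_idx N (length w2) - word_idx N ?c2" "j \<in> word_idx N ?c2"
          using B.rep_power_direct_sum_zero[OF vr(1,2) N, where i = i and j = j and w = ?c2] that sub[of w2] by (auto simp: z_def)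
      qed (auto simp: tT_map_def)
    qed
    \<comment> \<open>Summing the extended relations over all pairs of words gives the relation for
      the full conjugated matrix of \<open>p\<close>.\<close>
    have all: "intertwines B (multi_idx N k) (multi_idx N l) (conj_T N s k l p) (rep_power B z k) (rep_power B z l)"
      if p: "p \<in> K k l" for k l p
    proof -
      let ?W = "{w :: letter list. length w = k} \<times> {w :: letter list. length w = l}"
      let ?t = "\<lambda>w. tT_map N (map U_obj (fst w)) (map U_obj (snd w)) (U_map N s (corner N (fst w) (snd w) p))"
      have "intertwines B (multi_idx N k) (multi_idx N l) (\<lambda>j i. \<Sum>w\<in>?W. ?t w j i) (rep_power B z k) (rep_power B z l)"
      proof (rule B.intertwines_sum)
        fix w assume w: "w \<in> ?W"
        then have "length (fst w) = k" "length (snd w) = l" by auto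
        then show "intertwines B (multi_idx N k) (multi_idx N l) (?t w) (rep_power B z k) (rep_power B z l)"
          using part[of p "fst w" "snd w"] p by simp
      qed (auto intro: cl)
      then show ?thesis
      proof (rule iffD1[OF intertwines_cong[OF _ refl refl B cl cl], rotated -1])
        fix i j assume i: "i \<in> multi_idx N k" and j: "j \<in> multi_idx N l"
        show "(\<Sum>w\<in>?W. ?t w j i) = conj_T N s k l p j i"
          unfolding T_U_map_conj_T[OF s N lp[OF p] i j, symmetric] T_U_map_def
          by (simp add: sum.cartesian_product case_prod_unfold)
      qed
    qed
    have "satisfies_relations N K B y"
      unfolding satisfies_relations_def
    proof (intro conjI allI impI ballI)
      show "y i j \<in> carrier B" for i j by (rule yc)
      show "cadj B (y i j) = y i j" for i j
        unfolding y_def by (rule adj_conj[OF B]) (use zc zadj cnjU in \<open>auto simp: Ut_def\<close>)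
      fix k l p assume p: "p \<in> K k l"
      show "intertwines B (multi_idx N k) (multi_idx N l) (T_map p) (rep_power B y k) (rep_power B y l)"
        unfolding y_def
        by (rule intertwines_conjugated[OF B zc orthUt all[OF p]]) (auto simp: Ut_def U_def intro: T_map_conj_T)
    qed
    then obtain \<phi> where phi: "\<phi> \<in> star_hom A B" "\<And>i j. i < N \<Longrightarrow> j < N \<Longrightarrow> \<phi> (u i j) = y i j"
      using univ[OF B] by blast
    \<comment> \<open>The homomorphism is linear, so it sends U u U^t to U y U^t, which is
      \<open>z\<close> by the definition of \<open>y\<close>.\<close>
    have phi_ut: "\<phi> (ut i j) = z i j" if ij: "i < N" "j < N" for i j
    proof -
      have "\<phi> (ut i j) = lincomb B (?L \<times> ?L) (\<lambda>(a, b). U i a * U j b) (\<lambda>x. \<phi> (case x of (a, b) \<Rightarrow> u a b))"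
        unfolding ut conj_rep_def by (rule star_hom_lincomb[OF A B phi(1)]) (use u in auto)
      also have "\<dots> = conj_rep B ?L U y i j"
        unfolding conj_rep_def by (rule B.lincomb_cong) (use phi(2) yc in auto)
      also have "\<dots> = z i j"
        unfolding y_def by (rule B.conj_rep_inverse) (use zc ij orthUt in \<open>auto simp: Ut_def\<close>)
      finally show ?thesis .
    qed
    have "\<phi> (v i j) = v' i j" if "i < N - 1" "j < N - 1" for i j
      using phi_ut[of i j] that by (simp add: v_def z_def direct_sum_def)
    moreover have "\<phi> r = r'"
      using phi_ut[of "N - 1" "N - 1"] N by (simp add: r_def z_def direct_sum_def)
    ultimately show ?thesis using phi(1) by blast
  qed
  show ?thesis
    unfolding is_tri_quantum_group_def
    using A ds tri generated universal unfolding ut_def U_def by blast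
qed

end

theorem theoremC:
  fixes N :: nat and s :: real
  assumes "2 \<le> N" and "s = 1 \<or> s = - 1"
  shows "monoidal_unitary_functor N U_obj (U_map N s) \<and>
    (\<forall>k l. \<forall>p\<in>lparts k l. \<forall>i\<in>multi_idx N k. \<forall>j\<in>multi_idx N l.
       T_U_map N s k l p j i =
         mat_prod (multi_idx N l) (tensor_power (U_mat N s) l)
           (mat_prod (multi_idx N k) (T_map p) (tensor_power (adjoint_mat (U_mat N s)) k)) j i) \<and>
    (\<forall>K. linear_category N K \<longrightarrow> ltensor lsigma lsigma \<in> K 0 2 \<longrightarrow>
       tri_linear_category N (U_cat N s K) \<and>
       (\<forall>(A :: 'a cstar) u. is_quantum_group TYPE('b) N K A u \<longrightarrow>
          is_tri_quantum_group TYPE('b) N (U_cat N s K) A (conjugate N A (U_mat N s) u)))"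
  using U_map_functor[OF assms(2,1)] T_U_map_conj_T[OF assms(2,1)] conj_T_mat_prod[OF assms(2,1)]
    U_cat_tri_linear_category[OF assms(2,1)] U_cat_quantum_group[where 'a = 'a and 'b = 'b, OF assms]
  by simp

end
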